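(* Let $A$ be a unital simple AF $C^*$-algebra and $\alpha$ an AF flow of $A$. Let $(\gamma_t)_{t\in [0,1]}$ be a continuous path in $G_{\alpha}$ such that $$\gamma_t\delta_{\alpha}\gamma_t^{-1}=\delta_{\alpha}+\mathrm{ad}\,ib(t)$$ for some rectifiable path $(b(t))_{t\in [0,1]}$ in $A_{sa}$. Then $\Phi(\gamma_0)(\omega)=\Phi(\gamma_1)(\omega)$ for every $\omega\in\partial(K_c)$.
   Context: A flow $\alpha$ (strongly continuous one-parameter automorphism group) of a unital simple AF $C^*$-algebra $A$ is an AF flow if there is an increasing sequence $(A_n)$ of $\alpha$-invariant finite-dimensional *-subalgebras of $A$ with dense union. $\delta_\alpha$ denotes the generator of $\alpha$, a closed derivation with domain $\mathcal{D}(\delta_\alpha)$, and $\mathrm{ad}\,ih$ denotes the derivation $x\mapsto i(hx-xh)$. An $\alpha$-cocycle is a continuous map $u$ from $\mathbb{R}$ into the unitaries of $A$ with $u_s\alpha_s(u_t)=u_{s+t}$. The symmetry group $G_\alpha$ is the group of automorphisms $\gamma$ of $A$ such that $\gamma\alpha_t\gamma^{-1}=\mathrm{Ad}\,u_t\circ\alpha_t$ for some $\alpha$-cocycle $u$; it is topologized by: $\gamma_n\to\gamma$ iff $\gamma_n\to\gamma$ pointwise in norm and the associated cocycles can be chosen with $u_{n,t}\to u_t$ uniformly on compact subsets of $\mathbb{R}$. Fix $c\in\mathbb{R}\setminus\{0\}$; $K_c$ is the simplex of $c$-KMS states of $A$ with respect to $\alpha$ (states $\omega$ such that for all $x,y\in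 A$ there is a bounded continuous function $F$ on the strip $\{z: 0\le \mathrm{Im}\,z/c\le 1\}$, analytic in the interior, with $F(t)=\omega(x\alpha_t(y))$ and $F(t+ic)=\omega(\alpha_t(y)x)$), and $\partial(K_c)$ is its set of extreme points (equivalently the factorial $c$-KMS states). $\Phi$ is the continuous homomorphism of $G_\alpha$ into the homeomorphism group of $K_c$ defined as follows: for $\gamma\in G_\alpha$ with $\gamma\alpha_t\gamma^{-1}=\mathrm{Ad}\,u_t\circ\alpha_t=:\beta_t$, write $u_t^*=wv_t\beta_t(w^{-1})$ with $w$ invertible and $t\mapsto v_t$ extending to an entire function; then $\Phi(\gamma)(\omega)=\omega'/\omega'(1)$ where $\omega'(a)=\omega\gamma^{-1}(w^{-1}awv_{ic})$. $\Phi(\gamma)$ is independent of the choices, $\Phi(\gamma)(\omega)$ is unitarily equivalent to $\omega\gamma^{-1}$, and $\Phi(\gamma)=\mathrm{id}$ for inner $\gamma$. *)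

theory Defs
  imports "HOL-Analysis.Analysis"
begin

class scaleC =
  fixes scaleC :: "complex \<Rightarrow> 'a \<Rightarrow> 'a" (infixr "*\<^sub>C" 75)

class cstar_algebra = banach + real_normed_algebra_1 + scaleC +
  fixes cstar :: "'a \<Rightarrow> 'a"
  assumes scaleC_of_real: "scaleC (of_real r) x = scaleR r x"
    and scaleC_add_right: "scaleC a (x + y) = scaleC a x + scaleC a y"
    and scaleC_add_left: "scaleC (a + b) x = scaleC a x + scaleC b x"
    and scaleC_scaleC: "scaleC a (scaleC b x) = scaleC (a * b) x"
    and scaleC_one: "scaleC 1 x = x"
    and scaleC_mult_left: "scaleC a x * y = scaleC a (x * y)"
    and scaleC_mult_right: "x * scaleC a y = scaleC a (x * y)"
    and norm_scaleC: "norm (scaleC a x) = cmod a * norm x"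
    and cstar_cstar: "cstar (cstar x) = x"
    and cstar_add: "cstar (x + y) = cstar x + cstar y"
    and cstar_mult: "cstar (x * y) = cstar y * cstar x"
    and cstar_scaleC: "cstar (scaleC a x) = scaleC (cnj a) (cstar x)"
    and cstar_identity: "norm (cstar x * x) = (norm x)\<^sup>2"

definition unitary :: "'a::cstar_algebra \<Rightarrow> bool" where
  "unitary u \<longleftrightarrow> cstar u * u = 1 \<and> u * cstar u = 1"

definition selfadjoint :: "'a::cstar_algebra \<Rightarrow> bool" where
  "selfadjoint x \<longleftrightarrow> cstar x = x"

definition invertible_el :: "'a::cstar_algebra \<Rightarrow> bool" where
  "invertible_el w \<longleftrightarrow> (\<exists>w'. w * w' = 1 \<and> w' * w = 1)"

definition inv_el :: "'a::cstar_algebra \<Rightarrow> 'a" where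
  "inv_el w = (SOME w'. w * w' = 1 \<and> w' * w = 1)"

definition Ad :: "'a::cstar_algebra \<Rightarrow> 'a \<Rightarrow> 'a" where
  "Ad u x = u * x * cstar u"

definition ad_i :: "'a::cstar_algebra \<Rightarrow> 'a \<Rightarrow> 'a" where
  "ad_i h x = \<i> *\<^sub>C (h * x - x * h)"

definition star_aut :: "('a::cstar_algebra \<Rightarrow> 'a) \<Rightarrow> bool" where
  "star_aut f \<longleftrightarrow> bij f \<and> (\<forall>x y. f (x + y) = f x + f y) \<and> (\<forall>c x. f (c *\<^sub>C x) = c *\<^sub>C f x)
     \<and> (\<forall>x y. f (x * y) = f x * f y) \<and> (\<forall>x. f (cstar x) = cstar (f x))"

definition inner_aut :: "('a::cstar_algebra \<Rightarrow> 'a) \<Rightarrow> bool" where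
  "inner_aut f \<longleftrightarrow> (\<exists>u. unitary u \<and> f = Ad u)"

definition cspan :: "'a::cstar_algebra set \<Rightarrow> 'a set" where
  "cspan S = {\<Sum>x\<in>F. c x *\<^sub>C x | F c. finite F \<and> F \<subseteq> S}"

definition csubspace :: "'a::cstar_algebra set \<Rightarrow> bool" where
  "csubspace B \<longleftrightarrow> 0 \<in> B \<and> (\<forall>x\<in>B. \<forall>y\<in>B. x + y \<in> B) \<and> (\<forall>c. \<forall>x\<in>B. c *\<^sub>C x \<in> B)"

definition closed_ideal :: "'a::cstar_algebra set \<Rightarrow> bool" where
  "closed_ideal I \<longleftrightarrow> closed I \<and> csubspace I \<and> (\<forall>a. \<forall>x\<in>I. a * x \<in> I \<and> x * a \<in> I)"

definition simple_cstar :: "'a::cstar_algebra itself \<Rightarrow> bool" where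
  "simple_cstar _ \<longleftrightarrow> (0::'a) \<noteq> 1 \<and> (\<forall>I::'a set. closed_ideal I \<longrightarrow> I = {0} \<or> I = UNIV)"

definition star_subalgebra :: "'a::cstar_algebra set \<Rightarrow> bool" where
  "star_subalgebra B \<longleftrightarrow> csubspace B \<and> (\<forall>x\<in>B. \<forall>y\<in>B. x * y \<in> B) \<and> (\<forall>x\<in>B. cstar x \<in> B)"

definition fd_star_subalgebra :: "'a::cstar_algebra set \<Rightarrow> bool" where
  "fd_star_subalgebra B \<longleftrightarrow> star_subalgebra B \<and> (\<exists>S. finite S \<and> B = cspan S)"

definition AF_algebra :: "'a::cstar_algebra itself \<Rightarrow> bool" where
  "AF_algebra _ \<longleftrightarrow> (\<exists>An :: nat \<Rightarrow> 'a set. (\<forall>n. fd_star_subalgebra (An n)) \<and> incseq An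
      \<and> closure (\<Union>n. An n) = UNIV)"

definition flow :: "(real \<Rightarrow> 'a::cstar_algebra \<Rightarrow> 'a) \<Rightarrow> bool" where
  "flow \<alpha> \<longleftrightarrow> (\<forall>t. star_aut (\<alpha> t)) \<and> \<alpha> 0 = id \<and> (\<forall>s t. \<alpha> (s + t) = \<alpha> s \<circ> \<alpha> t)
      \<and> (\<forall>x. continuous_on UNIV (\<lambda>t. \<alpha> t x))"

definition AF_flow :: "(real \<Rightarrow> 'a::cstar_algebra \<Rightarrow> 'a) \<Rightarrow> bool" where
  "AF_flow \<alpha> \<longleftrightarrow> flow \<alpha> \<and> (\<exists>An :: nat \<Rightarrow> 'a set. (\<forall>n. fd_star_subalgebra (An n)) \<and> incseq An
      \<and> (\<forall>n t. \<alpha> t ` An n \<subseteq> An n) \<and> closure (\<Union>n. An n) = UNIV)"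

definition generator :: "(real \<Rightarrow> 'a::cstar_algebra \<Rightarrow> 'a) \<Rightarrow> 'a \<Rightarrow> 'a option" where
  "generator \<alpha> x =
     (if \<exists>y. ((\<lambda>t. (1 / t) *\<^sub>R (\<alpha> t x - x)) \<longlongrightarrow> y) (at 0)
      then Some (Lim (at 0) (\<lambda>t. (1 / t) *\<^sub>R (\<alpha> t x - x))) else None)"

definition cocycle :: "(real \<Rightarrow> 'a::cstar_algebra \<Rightarrow> 'a) \<Rightarrow> (real \<Rightarrow> 'a) \<Rightarrow> bool" where
  "cocycle \<alpha> u \<longleftrightarrow> continuous_on UNIV u \<and> (\<forall>t. unitary (u t))
      \<and> (\<forall>s t. u s * \<alpha> s (u t) = u (s + t))"

definition assoc_cocycle :: "(real \<Rightarrow> 'a::cstar_algebra \<Rightarrow> 'a) \<Rightarrow> ('a \<Rightarrow> 'a) \<Rightarrow> (real \<Rightarrow> 'a) \<Rightarrow> bool" where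
  "assoc_cocycle \<alpha> \<gamma> u \<longleftrightarrow> cocycle \<alpha> u \<and> (\<forall>t. \<gamma> \<circ> \<alpha> t \<circ> inv \<gamma> = Ad (u t) \<circ> \<alpha> t)"

definition symmetry_group :: "(real \<Rightarrow> 'a::cstar_algebra \<Rightarrow> 'a) \<Rightarrow> ('a \<Rightarrow> 'a) set" where
  "symmetry_group \<alpha> = {\<gamma>. star_aut \<gamma> \<and> (\<exists>u. assoc_cocycle \<alpha> \<gamma> u)}"

definition G_converges :: "(real \<Rightarrow> 'a::cstar_algebra \<Rightarrow> 'a) \<Rightarrow> (nat \<Rightarrow> 'a \<Rightarrow> 'a) \<Rightarrow> ('a \<Rightarrow> 'a) \<Rightarrow> bool" where
  "G_converges \<alpha> \<gamma>s \<gamma> \<longleftrightarrow> (\<forall>x. (\<lambda>n. \<gamma>s n x) \<longlonglongrightarrow> \<gamma> x)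
     \<and> (\<exists>us u. (\<forall>n. assoc_cocycle \<alpha> (\<gamma>s n) (us n)) \<and> assoc_cocycle \<alpha> \<gamma> u
          \<and> (\<forall>K. compact K \<longrightarrow> (\<forall>e>0. \<forall>\<^sub>F n in sequentially. \<forall>s\<in>K. norm (us n s - u s) < e)))"

text \<open>Continuous path [0,1] -> G_alpha (w.r.t. the sequentially defined topology).\<close>
definition G_path :: "(real \<Rightarrow> 'a::cstar_algebra \<Rightarrow> 'a) \<Rightarrow> (real \<Rightarrow> 'a \<Rightarrow> 'a) \<Rightarrow> bool" where
  "G_path \<alpha> \<gamma> \<longleftrightarrow> (\<forall>t\<in>{0..1}. \<gamma> t \<in> symmetry_group \<alpha>)
     \<and> (\<forall>t\<in>{0..1}. \<forall>s. (\<forall>n. s n \<in> {0..1}) \<and> s \<longlonglongrightarrow> t \<longrightarrow> G_converges \<alpha> (\<lambda>n. \<gamma> (s n)) (\<gamma> t))"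

definition rectifiable_sa_path :: "(real \<Rightarrow> 'a::cstar_algebra) \<Rightarrow> bool" where
  "rectifiable_sa_path b \<longleftrightarrow> continuous_on {0..1} b \<and> (\<forall>t\<in>{0..1}. selfadjoint (b t))
     \<and> (\<exists>M. \<forall>(n::nat) (p::nat \<Rightarrow> real). 0 \<le> p 0 \<and> p n \<le> 1 \<and> (\<forall>i<n. p i \<le> p (Suc i))
            \<longrightarrow> (\<Sum>i<n. norm (b (p (Suc i)) - b (p i))) \<le> M)"

definition state :: "('a::cstar_algebra \<Rightarrow> complex) \<Rightarrow> bool" where
  "state \<omega> \<longleftrightarrow> (\<forall>x y. \<omega> (x + y) = \<omega> x + \<omega> y) \<and> (\<forall>c x. \<omega> (c *\<^sub>C x) = c * \<omega> x)
     \<and> (\<forall>x. Im (\<omega> (cstar x * x)) = 0 \<and> Re (\<omega> (cstar x * x)) \<ge> 0) \<and> \<omega> 1 = 1"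

definition strip :: "real \<Rightarrow> complex set" where
  "strip c = {z. 0 \<le> Im z / c \<and> Im z / c \<le> 1}"

definition KMS :: "real \<Rightarrow> (real \<Rightarrow> 'a::cstar_algebra \<Rightarrow> 'a) \<Rightarrow> ('a \<Rightarrow> complex) \<Rightarrow> bool" where
  "KMS c \<alpha> \<omega> \<longleftrightarrow> state \<omega> \<and> (\<forall>x y. \<exists>F. continuous_on (strip c) F \<and> bounded (F ` strip c)
       \<and> F holomorphic_on interior (strip c)
       \<and> (\<forall>t::real. F (of_real t) = \<omega> (x * \<alpha> t y))
       \<and> (\<forall>t::real. F (of_real t + \<i> * of_real c) = \<omega> (\<alpha> t y * x)))"

definition KMS_simplex :: "real \<Rightarrow> (real \<Rightarrow> 'a::cstar_algebra \<Rightarrow> 'a) \<Rightarrow> ('a \<Rightarrow> complex) set" where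
  "KMS_simplex c \<alpha> = {\<omega>. KMS c \<alpha> \<omega>}"

definition extreme_points :: "('a \<Rightarrow> complex) set \<Rightarrow> ('a \<Rightarrow> complex) set" where
  "extreme_points K = {\<omega>\<in>K. \<forall>\<omega>1\<in>K. \<forall>\<omega>2\<in>K. \<forall>l::real. 0 < l \<and> l < 1
      \<and> \<omega> = (\<lambda>x. of_real l * \<omega>1 x + of_real (1 - l) * \<omega>2 x) \<longrightarrow> \<omega>1 = \<omega> \<and> \<omega>2 = \<omega>}"

definition entire_fun :: "(complex \<Rightarrow> 'a::cstar_algebra) \<Rightarrow> bool" where
  "entire_fun V \<longleftrightarrow> (\<forall>z. \<exists>D. ((\<lambda>h. inverse h *\<^sub>C (V (z + h) - V z)) \<longlongrightarrow> D) (at 0))"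

definition Phi_data :: "(real \<Rightarrow> 'a::cstar_algebra \<Rightarrow> 'a) \<Rightarrow> ('a \<Rightarrow> 'a) \<Rightarrow> (real \<Rightarrow> 'a) \<Rightarrow> 'a \<Rightarrow> (complex \<Rightarrow> 'a) \<Rightarrow> bool" where
  "Phi_data \<alpha> \<gamma> u w V \<longleftrightarrow> assoc_cocycle \<alpha> \<gamma> u \<and> invertible_el w \<and> entire_fun V
     \<and> (\<forall>t::real. cstar (u t) = w * V (of_real t) * (Ad (u t) \<circ> \<alpha> t) (inv_el w))"

definition Phi :: "real \<Rightarrow> (real \<Rightarrow> 'a::cstar_algebra \<Rightarrow> 'a) \<Rightarrow> ('a \<Rightarrow> 'a) \<Rightarrow> ('a \<Rightarrow> complex) \<Rightarrow> ('a \<Rightarrow> complex)" where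
  "Phi c \<alpha> \<gamma> \<omega> =
     (let (u, w, V) = (SOME (u, w, V). Phi_data \<alpha> \<gamma> u w V);
          \<omega>' = (\<lambda>a. \<omega> (inv \<gamma> (inv_el w * a * w * V (\<i> * of_real c))))
      in (\<lambda>a. \<omega>' a / \<omega>' 1))"

end

theory Submission
  imports Defs "HOL-Complex_Analysis.Complex_Analysis" "HOL-Probability.Distributions"
    "HOL-Real_Asymp.Real_Asymp" "HOL-Computational_Algebra.Fundamental_Theorem_Algebra"
begin

text \<open>
  Let \<open>\<beta>\<^sup>t = \<gamma>\<^sub>t \<alpha> \<gamma>\<^sub>t\<^sup>-\<^sup>1\<close>, whose generator is \<open>\<delta> + ad i b(t)\<close>. Perturbing \<open>\<omega> \<gamma>\<^sub>0\<^sup>-\<^sup>1\<close> along the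
  cocycle generated by \<open>b(t) - b(0)\<close> yields \<open>\<beta>\<^sup>t\<close>-KMS functionals \<open>\<psi>\<^sub>t\<close>. For an \<open>\<alpha>\<close>-invariant
  projection \<open>p\<close> the projections \<open>q\<^sub>t = \<gamma>\<^sub>t(p)\<close> are \<open>\<beta>\<^sup>t\<close>-invariant and move continuously. For \<open>s\<close>
  near \<open>t\<close> the relative KMS condition linking \<open>\<psi>\<^sub>s\<close> and \<open>\<psi>\<^sub>t\<close>, applied to elements intertwining
  \<open>q\<^sub>s\<close> and \<open>q\<^sub>t\<close>, bounds the difference of \<open>\<psi>\<^sub>t(q\<^sub>t)\<close> and \<open>\<psi>\<^sub>s(q\<^sub>s)\<close> by \<open>4 |c| |b(t) - b(s)|\<close> times
  the larger of the two. Summing over a fine partition gives \<open>\<psi>\<^sub>1(\<gamma>\<^sub>1(p)) \<le> e\<^bsup>8 |c| L\<^esup> \<omega>(p)\<close>, where \<open>L\<close>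
  bounds the length of \<open>b\<close>; the constant does not depend on \<open>p\<close>. For an AF flow the invariant
  projections control KMS functionals, so the KMS functional \<open>\<psi>\<^sub>1 \<gamma>\<^sub>1\<close> is dominated by a multiple of
  \<open>\<omega>\<close>, and extremality makes it a multiple of \<open>\<omega>\<close>. Finally, two cocycles implementing the same
  perturbation differ by a character of the reals because the centre is trivial, and a character
  changes the perturbed functional only by a scalar, which the normalisation removes.
\<close>

section \<open>C*-algebras and positive functionals\<close>

text \<open>The projections \<open>\<gamma>\<^sub>t(p)\<close> move continuously, but their
  variation is not controlled; only that of b is. Hence a single step must cost an amount governed
  by |b(t) - b(s)| alone, uniformly in the projections. Distance at most 1/2 already bounds an
  intertwiner by 2, and the oscillation of the relative KMS function across the strip sees only the
  drift of the two cocycles against each other. The error must also be relative: it is proportional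
  to the values at the projections, because the functionals are evaluated in the corners that these
  cut out. So the number of steps may depend on p while the product of the factors does not. The 4
  is 2 (real and imaginary parts) times 2 (the intertwiner), and passing to an exponential factor
  doubles it to 8. Since b(t) need not be analytic for the flow, the value of its cocycle at ic has
  no direct meaning; a Gaussian average supplies a cohomologous entire cocycle.\<close>

lemma scaleC_zero_left [simp]: "0 *\<^sub>C (x::'a::cstar_algebra) = 0"
  using scaleC_of_real[of 0 x] by simp

lemma scaleC_zero_right [simp]: "a *\<^sub>C (0::'a::cstar_algebra) = 0"
  using scaleC_add_right[of a "0::'a" 0] by simp

lemma scaleC_minus_left [simp]: "(- a) *\<^sub>C (x::'a::cstar_algebra) = - (a *\<^sub>C x)"
  using scaleC_add_left[of "-a" a x] by (simp add: eq_neg_iff_add_eq_0)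

lemma scaleC_minus_right [simp]: "a *\<^sub>C (- x::'a::cstar_algebra) = - (a *\<^sub>C x)"
  using scaleC_add_right[of a "-x" x] by (simp add: eq_neg_iff_add_eq_0)

lemma scaleC_diff_right: "a *\<^sub>C (x - y::'a::cstar_algebra) = a *\<^sub>C x - a *\<^sub>C y"
  using scaleC_add_right[of a x "-y"] by simp

lemma scaleC_diff_left: "(a - b) *\<^sub>C (x::'a::cstar_algebra) = a *\<^sub>C x - b *\<^sub>C x"
  using scaleC_add_left[of a "-b" x] by simp

lemma scaleC_sum_right: "a *\<^sub>C (\<Sum>i\<in>I. f i) = (\<Sum>i\<in>I. a *\<^sub>C (f i::'a::cstar_algebra))"
  by (induction I rule: infinite_finite_induct) (auto simp: scaleC_add_right)

lemma scaleC_eq_0_iff [simp]: "a *\<^sub>C (x::'a::cstar_algebra) = 0 \<longleftrightarrow> a = 0 \<or> x = 0"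
  by (metis norm_scaleC norm_eq_zero mult_eq_0_iff)

declare scaleC_one [simp] cstar_cstar [simp]

lemma bounded_bilinear_scaleC: "bounded_bilinear (scaleC :: complex \<Rightarrow> 'a::cstar_algebra \<Rightarrow> 'a)"
proof
  fix a a' :: complex and b b' :: 'a and r :: real
  show "(a + a') *\<^sub>C b = a *\<^sub>C b + a' *\<^sub>C b" "a *\<^sub>C (b + b') = a *\<^sub>C b + a *\<^sub>C b'"
    by (simp_all add: scaleC_add_left scaleC_add_right)
  show "(r *\<^sub>R a) *\<^sub>C b = r *\<^sub>R (a *\<^sub>C b)"
    by (simp add: scaleC_of_real[symmetric] scaleC_scaleC scaleR_conv_of_real)
  show "a *\<^sub>C (r *\<^sub>R b) = r *\<^sub>R (a *\<^sub>C b)"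
    by (simp add: scaleC_of_real[symmetric] scaleC_scaleC mult.commute)
  show "\<exists>K. \<forall>a (b::'a). norm (a *\<^sub>C b) \<le> norm a * norm b * K"
    by (intro exI[of _ 1]) (simp add: norm_scaleC)
qed

lemmas tendsto_scaleC = bounded_bilinear.tendsto[OF bounded_bilinear_scaleC]
  and continuous_on_scaleC = bounded_bilinear.continuous_on[OF bounded_bilinear_scaleC]

lemma norm_cstar [simp]: "norm (cstar (x::'a::cstar_algebra)) = norm x"
proof -
  have le: "norm y \<le> norm (cstar y)" for y :: 'a
  proof (cases "norm y = 0")
    case False
    have "norm y * norm y \<le> norm (cstar y) * norm y"
      using norm_mult_ineq[of "cstar y" y] by (simp add: cstar_identity power2_eq_square)
    with False show ?thesis by simp
  qed auto
  from le[of x] le[of "cstar x"] show ?thesis by simp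
qed

lemma cstar_zero [simp]: "cstar (0::'a::cstar_algebra) = 0"
  by (metis norm_cstar norm_eq_zero)

lemma cstar_one [simp]: "cstar (1::'a::cstar_algebra) = 1"
  by (metis cstar_cstar cstar_mult mult_1_left mult_1_right)

lemma cstar_minus [simp]: "cstar (- x::'a::cstar_algebra) = - cstar x"
  using cstar_scaleC[of "-1" x] by simp

lemma cstar_diff: "cstar (x - y::'a::cstar_algebra) = cstar x - cstar y"
  using cstar_add[of x "-y"] by simp

lemma cstar_scaleR: "cstar (r *\<^sub>R x::'a::cstar_algebra) = r *\<^sub>R cstar x"
  using cstar_scaleC[of "of_real r" x] by (simp add: scaleC_of_real)

lemma cstar_sum: "cstar (\<Sum>i\<in>I. f i) = (\<Sum>i\<in>I. cstar (f i::'a::cstar_algebra))"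
  by (induction I rule: infinite_finite_induct) (auto simp: cstar_add)

lemma bounded_linear_cstar: "bounded_linear (cstar :: 'a::cstar_algebra \<Rightarrow> 'a)"
  by (rule bounded_linear_intro[of _ 1]) (simp_all add: cstar_add cstar_scaleR)

lemma cstar_mult_self_eq_0_iff [simp]: "cstar x * x = 0 \<longleftrightarrow> x = (0::'a::cstar_algebra)"
  by (metis cstar_identity norm_eq_zero power_eq_0_iff zero_neq_numeral mult_zero_right)

lemma norm_unitary: "unitary (u::'a::cstar_algebra) \<Longrightarrow> norm u = 1"
  using cstar_identity[of u] power2_eq_iff_nonneg[of "norm u" 1] by (simp add: unitary_def)

lemma norm_unitary_le: "unitary (u::'a::cstar_algebra) \<Longrightarrow> norm u \<le> 1"
  by (simp add: norm_unitary)

lemma unitary_cstar: "unitary (u::'a::cstar_algebra) \<Longrightarrow> unitary (cstar u)"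
  by (simp add: unitary_def)

lemma unitary_mult: "unitary (u::'a::cstar_algebra) \<Longrightarrow> unitary v \<Longrightarrow> unitary (u * v)"
  unfolding unitary_def cstar_mult by (metis mult.assoc mult_1_left)

text \<open>The square root \<open>1 - s\<close> of \<open>1 - a\<close> is found as the fixed point of the contraction
  \<open>s \<mapsto> (a + s\<^sup>2) / 2\<close>; the closed set of selfadjoint \<open>s\<close> commuting with \<open>a\<close> is preserved.\<close>

lemma sqrt_one_minus_selfadjoint:
  fixes a :: "'a::cstar_algebra"
  assumes sa: "cstar a = a" and less: "norm a < 1"
  obtains r where "cstar r = r" "r * r = 1 - a" "\<And>b. a * b = b * a \<Longrightarrow> r * b = b * r"
proof -
  \<comment> \<open>The smaller root of \<open>norm a + \<rho> * \<rho> = 2 * \<rho>\<close>: the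
    map then sends the ball of radius \<open>\<rho>\<close> into itself, and
    \<open>\<rho> < 1\<close> is its contraction constant there.\<close>
  define \<rho> where "\<rho> = 1 - sqrt (1 - norm a)"
  have \<rho>: "0 \<le> \<rho>" "\<rho> < 1" using less by (auto simp: \<rho>_def)
  have "(sqrt (1 - norm a))\<^sup>2 = 1 - norm a" using less by simp
  then have \<rho>eq: "norm a + \<rho> * \<rho> = 2 * \<rho>"
    unfolding \<rho>_def by (simp add: power2_eq_square algebra_simps)
  define T where "T s = (1/2) *\<^sub>R (a + s * s)" for s :: 'a
  define S where "S = cball 0 \<rho> \<inter> {s. cstar s = s} \<inter> (\<Inter>b\<in>{b. a * b = b * a}. {s. s * b = b * s})"
  have "closed {s::'a. cstar s = s}"
    by (intro closed_Collect_eq continuous_intros linear_continuous_on bounded_linear_cstar)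
  moreover have "closed (\<Inter>b\<in>{b. a * b = b * a}. {s. s * b = b * s})"
    by (intro closed_INT ballI closed_Collect_eq continuous_intros)
  ultimately have "complete S"
    unfolding S_def complete_eq_closed by (intro closed_Int closed_cball)
  moreover have "0 \<in> S" using \<rho> by (simp add: S_def)
  moreover have "T ` S \<subseteq> S"
  proof
    fix y assume "y \<in> T ` S"
    then obtain s where s: "s \<in> S" and y: "y = T s" by auto
    from s have n: "norm s \<le> \<rho>" and c: "cstar s = s" "\<And>b. a * b = b * a \<Longrightarrow> s * b = b * s"
      by (auto simp: S_def)
    have "norm (s * s) \<le> \<rho> * \<rho>"
      using norm_mult_ineq[of s s] n \<rho> by (meson mult_mono norm_ge_zero order_trans)
    then have "norm (a + s * s) \<le> 2 * \<rho>"
      using norm_triangle_ineq[of a "s * s"] \<rho>eq by linarith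
    then have "norm y \<le> \<rho>" by (simp add: y T_def)
    moreover have "cstar y = y" by (simp add: y T_def cstar_scaleR cstar_add cstar_mult sa c(1))
    moreover have "y * b = b * y" if b: "a * b = b * a" for b
    proof -
      have "s * s * b = s * (b * s)" by (simp only: mult.assoc c(2)[OF b])
      also have "\<dots> = b * (s * s)" by (simp only: mult.assoc[symmetric] c(2)[OF b])
      finally have "s * s * b = b * (s * s)" .
      then show ?thesis by (simp add: y T_def distrib_left distrib_right b)
    qed
    ultimately show "y \<in> S" by (simp add: S_def)
  qed
  moreover have "dist (T x) (T y) \<le> \<rho> * dist x y" if "x \<in> S" "y \<in> S" for x y
  proof -
    have n: "norm x \<le> \<rho>" "norm y \<le> \<rho>" using that by (auto simp: S_def)
    have "T x - T y = (1/2) *\<^sub>R (x * (x - y) + (x - y) * y)"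
      by (simp add: T_def algebra_simps)
    also have "norm \<dots> \<le> (1/2) * (norm x * norm (x - y) + norm (x - y) * norm y)"
      using norm_triangle_ineq[of "x * (x - y)" "(x - y) * y"]
        norm_mult_ineq[of x "x - y"] norm_mult_ineq[of "x - y" y] by simp
    also have "\<dots> \<le> (1/2) * (\<rho> * norm (x - y) + norm (x - y) * \<rho>)"
      using n \<rho> by (intro mult_left_mono add_mono mult_mono) auto
    finally show ?thesis by (simp add: dist_norm)
  qed
  ultimately have "\<exists>!x. x \<in> S \<and> T x = x"
    using Banach_fix[of S \<rho> T] \<rho> by auto
  then obtain s where s: "s \<in> S" "T s = s" by auto
  have "2 *\<^sub>R T s = a + s * s" by (simp add: T_def)
  then have e: "s + s = a + s * s" by (simp only: s(2) scaleR_2)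
  show thesis
  proof (rule that[of "1 - s"])
    show "cstar (1 - s) = 1 - s" using s by (simp add: S_def cstar_diff)
    show "(1 - s) * (1 - s) = 1 - a" using e by (simp add: algebra_simps)
    show "(1 - s) * b = b * (1 - s)" if "a * b = b * a" for b
      using s that by (simp add: S_def left_diff_distrib right_diff_distrib)
  qed
qed

text \<open>The element \<open>x + iy\<close> has norm 1 by the C*-identity, and x is its real
  part.\<close>

lemma norm_le_1_if_squares_sum_to_one:
  fixes x y :: "'a::cstar_algebra"
  assumes "cstar x = x" "cstar y = y" "x * y = y * x" "x * x + y * y = 1"
  shows "norm x \<le> 1"
proof -
  define u where "u = x + \<i> *\<^sub>C y"
  have cu: "cstar u = x - \<i> *\<^sub>C y" by (simp add: u_def cstar_add cstar_scaleC assms)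
  have "cstar u * u = 1"
    unfolding cu unfolding u_def using assms
    by (simp add: algebra_simps scaleC_mult_left scaleC_mult_right scaleC_scaleC scaleC_diff_right)
  then have "(norm u)\<^sup>2 = 1" using cstar_identity[of u] by simp
  then have nu: "norm u = 1" using power2_eq_iff_nonneg[of "norm u" 1] by simp
  have "2 *\<^sub>R x = u + cstar u" by (simp add: cu) (simp add: u_def scaleR_2)
  then have "2 * norm x = norm (u + cstar u)" by (metis norm_scaleR abs_numeral)
  also have "\<dots> \<le> 2" using norm_triangle_ineq[of u "cstar u"] nu by simp
  finally show ?thesis by simp
qed

section \<open>Star automorphisms are isometries\<close>

lemma star_autD:
  assumes "star_aut f"
  shows "bij f" "f (x + y) = f x + f y" "f (c *\<^sub>C x) = c *\<^sub>C f x" "f (x * y) = f x * f y"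
    "f (cstar x) = cstar (f x)" "f 0 = 0" "f 1 = 1" "f (- x) = - f x" "f (x - y) = f x - f y"
    "f (r *\<^sub>R x) = r *\<^sub>R f x"
proof -
  show *: "bij f" "\<And>x y. f (x + y) = f x + f y" "\<And>c x. f (c *\<^sub>C x) = c *\<^sub>C f x" "\<And>x y. f (x * y) = f x * f y"
    "f (cstar x) = cstar (f x)"
    using assms by (auto simp: star_aut_def)
  show "f 0 = 0" using *(3)[of 0 0] by simp
  obtain e where "f e = 1" using *(1) by (metis bij_pointE)
  then show "f 1 = 1" using *(4)[of e 1] by (metis mult_1_left mult_1_right)
  show "f (- x) = - f x" using *(3)[of "-1" x] by simp
  show "f (x - y) = f x - f y" using *(2)[of x "-y"] *(3)[of "-1" y] by simp
  show "f (r *\<^sub>R x) = r *\<^sub>R f x" using *(3)[of "of_real r" x] by (simp add: scaleC_of_real)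
qed

text \<open>For selfadjoint a of norm below 1, \<open>1 - a * a\<close> has a square root r
  commuting with a, and f carries the relation \<open>a * a + r * r = 1\<close> to the images, where
  it forces norm at most 1. This replaces the spectral radius argument. The C*-identity reduces
  general x to \<open>cstar x * x\<close>.\<close>

lemma star_aut_contractive:
  fixes f :: "'a::cstar_algebra \<Rightarrow> 'a"
  assumes f: "star_aut f"
  shows "norm (f x) \<le> norm x"
proof -
  note F = star_autD[OF f]
  have sa1: "norm (f a) \<le> 1" if a: "cstar a = a" "norm a < 1" for a
  proof -
    have "norm (a * a) < 1"
      using cstar_identity[of a] a by (simp add: power2_eq_square[symmetric] power_less_one_iff)
    then obtain r where r: "cstar r = r" "r * r = 1 - a * a" "\<And>b. a * a * b = b * (a * a) \<Longrightarrow> r * b = b * r"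
      using sqrt_one_minus_selfadjoint[of "a * a"] a by (metis cstar_mult)
    have "f a * f r = f r * f a" using r(3)[of a] by (metis F(4) mult.assoc)
    moreover have "f (r * r) = f (1 - a * a)" by (simp only: r(2))
    then have "f a * f a + f r * f r = 1" by (simp add: F)
    moreover have "cstar (f a) = f a" "cstar (f r) = f r" by (simp_all add: F(5)[symmetric] a r)
    ultimately show ?thesis
      using norm_le_1_if_squares_sum_to_one[of "f a" "f r"] by simp
  qed
  have sa: "norm (f a) \<le> norm a" if a: "cstar a = a" for a
  proof (rule field_le_epsilon)
    fix e :: real assume e: "0 < e"
    let ?k = "norm a + e"
    have k: "?k > 0" using e by (simp add: add_nonneg_pos)
    have "norm (f ((1 / ?k) *\<^sub>R a)) \<le> 1"
      by (rule sa1) (use k e a in \<open>auto simp: cstar_scaleR field_simps\<close>)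
    then show "norm (f a) \<le> norm a + e" using k by (simp add: F(10) field_simps)
  qed
  have "(norm (f x))\<^sup>2 = norm (f (cstar x * x))" by (simp add: F cstar_identity)
  also have "\<dots> \<le> norm (cstar x * x)" by (rule sa) (simp add: cstar_mult)
  finally show ?thesis by (simp add: cstar_identity power2_le_iff_abs_le)
qed

lemma star_aut_inv:
  assumes f: "star_aut f"
  shows "star_aut (inv f)" "inv f (f x) = x" "f (inv f x) = x"
proof -
  note F = star_autD[OF f]
  show i: "\<And>x. inv f (f x) = x" and s: "\<And>x. f (inv f x) = x"
    using F(1) by (auto simp: bij_is_inj bij_is_surj surj_f_inv_f)
  show "star_aut (inv f)"
    unfolding star_aut_def
  proof (intro conjI allI)
    show "bij (inv f)" using F(1) by (rule bij_imp_bij_inv)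
    fix c x y
    show "inv f (x + y) = inv f x + inv f y" by (metis F(2) i s)
    show "inv f (c *\<^sub>C x) = c *\<^sub>C inv f x" by (metis F(3) i s)
    show "inv f (x * y) = inv f x * inv f y" by (metis F(4) i s)
    show "inv f (cstar x) = cstar (inv f x)" by (metis F(5) i s)
  qed
qed

lemma norm_star_aut:
  assumes f: "star_aut f"
  shows "norm (f x) = norm x"
  using star_aut_contractive[OF f, of x] star_aut_contractive[OF star_aut_inv(1)[OF f], of "f x"]
  by (simp add: star_aut_inv(2)[OF f])

lemma bounded_linear_star_aut: "star_aut f \<Longrightarrow> bounded_linear f"
  by (rule bounded_linear_intro[of _ 1]) (simp_all only: star_autD(2,10)[of f] norm_star_aut[of f] mult_1_right order_refl)

lemma star_aut_sum: "star_aut f \<Longrightarrow> f (\<Sum>i\<in>I. g i) = (\<Sum>i\<in>I. f (g i))"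
  by (induction I rule: infinite_finite_induct) (simp_all add: star_autD(2,6)[of f])

section \<open>Positive functionals\<close>

definition positive_functional :: "('a::cstar_algebra \<Rightarrow> complex) \<Rightarrow> bool" where
  "positive_functional \<phi> \<longleftrightarrow> (\<forall>x y. \<phi> (x + y) = \<phi> x + \<phi> y) \<and> (\<forall>c x. \<phi> (c *\<^sub>C x) = c * \<phi> x)
     \<and> (\<forall>x. Im (\<phi> (cstar x * x)) = 0 \<and> Re (\<phi> (cstar x * x)) \<ge> 0)"

lemma state_iff_positive_functional: "state \<omega> \<longleftrightarrow> positive_functional \<omega> \<and> \<omega> 1 = 1"
  by (auto simp: state_def positive_functional_def)

lemma positive_functionalD:
  assumes "positive_functional \<phi>"
  shows "\<phi> (x + y) = \<phi> x + \<phi> y" "\<phi> (c *\<^sub>C x) = c * \<phi> x" "\<phi> (x - y) = \<phi> x - \<phi> y" "\<phi> 0 = 0"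
    "\<phi> (r *\<^sub>R x) = of_real r * \<phi> x" "\<phi> (- x) = - \<phi> x"
    "Im (\<phi> (cstar x * x)) = 0" "Re (\<phi> (cstar x * x)) \<ge> 0"
    "\<phi> (\<Sum>i\<in>I. g i) = (\<Sum>i\<in>I. \<phi> (g i))"
proof -
  have *: "\<And>x y. \<phi> (x + y) = \<phi> x + \<phi> y" "\<And>c x. \<phi> (c *\<^sub>C x) = c * \<phi> x"
    using assms by (auto simp: positive_functional_def)
  show "Im (\<phi> (cstar x * x)) = 0" "Re (\<phi> (cstar x * x)) \<ge> 0"
    using assms by (auto simp: positive_functional_def)
  show "\<phi> (x + y) = \<phi> x + \<phi> y" "\<phi> (c *\<^sub>C x) = c * \<phi> x" by (rule *)+
  show m: "\<phi> (- x) = - \<phi> x" for x using *(2)[of "-1" x] by simp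
  show "\<phi> (x - y) = \<phi> x - \<phi> y" using *(1)[of x "-y"] m by simp
  show z: "\<phi> 0 = 0" using *(2)[of 0 0] by simp
  show "\<phi> (r *\<^sub>R x) = of_real r * \<phi> x" using *(2)[of "of_real r" x] by (simp add: scaleC_of_real)
  show "\<phi> (\<Sum>i\<in>I. g i) = (\<Sum>i\<in>I. \<phi> (g i))"
    by (induction I rule: infinite_finite_induct) (auto simp: * z)
qed

lemma positive_functional_one:
  assumes "positive_functional \<phi>"
  shows "Im (\<phi> 1) = 0" "Re (\<phi> 1) \<ge> 0"
  using positive_functionalD(7,8)[OF assms, of 1] by simp_all

text \<open>The value is real because it is the cross term of
  \<open>cstar (1 + a) * (1 + a)\<close>. For the bound, \<open>1 - b\<close> is a square when b is
  selfadjoint of norm below 1, so positivity gives \<open>\<phi> b \<le> \<phi> 1\<close>, and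
  scaling does the rest.\<close>

lemma positive_functional_selfadjoint:
  assumes \<phi>: "positive_functional \<phi>" and a: "cstar a = a"
  shows "Im (\<phi> a) = 0" "\<bar>Re (\<phi> a)\<bar> \<le> Re (\<phi> 1) * norm a"
proof -
  note P = positive_functionalD[OF \<phi>]
  have "cstar (1 + a) * (1 + a) = 1 + 2 *\<^sub>R a + cstar a * a"
    by (simp add: cstar_add a algebra_simps scaleR_2)
  then have "Im (\<phi> (1 + 2 *\<^sub>R a + cstar a * a)) = 0" using P(7)[of "1 + a"] by simp
  then show im: "Im (\<phi> a) = 0"
    using P(7)[of a] positive_functional_one[OF \<phi>] by (simp add: P)
  have le1: "Re (\<phi> b) \<le> Re (\<phi> 1)" if b: "cstar b = b" "norm b < 1" for b
  proof -
    obtain r where r: "cstar r = r" "r * r = 1 - b"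
      using sqrt_one_minus_selfadjoint[of b] b by metis
    have "Re (\<phi> (cstar r * r)) \<ge> 0" by (rule P)
    then show ?thesis by (simp add: r P)
  qed
  have le: "Re (\<phi> b) \<le> Re (\<phi> 1) * norm b" if b: "cstar b = b" for b
  proof (rule field_le_mult_one_interval)
    fix z :: real assume z: "0 < z" "z < 1"
    show "z * Re (\<phi> b) \<le> Re (\<phi> 1) * norm b"
    proof (cases "b = 0")
      case False
      have "Re (\<phi> ((z / norm b) *\<^sub>R b)) \<le> Re (\<phi> 1)"
        by (rule le1) (use z False b in \<open>auto simp: cstar_scaleR\<close>)
      then show ?thesis using False by (simp add: P field_simps)
    qed (simp add: P)
  qed
  show "\<bar>Re (\<phi> a)\<bar> \<le> Re (\<phi> 1) * norm a"
    using le[of a] le[of "-a"] a by (simp add: P abs_le_iff)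
qed

lemma selfadjoint_decomposition:
  fixes a :: "'a::cstar_algebra"
  obtains h k where "cstar h = h" "cstar k = k" "a = h + \<i> *\<^sub>C k" "norm h \<le> norm a" "norm k \<le> norm a"
proof (rule that[of "(1/2) *\<^sub>R (a + cstar a)" "(- \<i> / 2) *\<^sub>C (a - cstar a)"])
  show "cstar ((1/2) *\<^sub>R (a + cstar a)) = (1/2) *\<^sub>R (a + cstar a)"
    by (simp add: cstar_scaleR cstar_add add.commute)
  show "cstar ((- \<i> / 2) *\<^sub>C (a - cstar a)) = (- \<i> / 2) *\<^sub>C (a - cstar a)"
    by (simp add: cstar_scaleC cstar_diff scaleC_diff_right)
  show "norm ((1/2) *\<^sub>R (a + cstar a)) \<le> norm a"
    using norm_triangle_ineq[of a "cstar a"] by simp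
  show "norm ((- \<i> / 2) *\<^sub>C (a - cstar a)) \<le> norm a"
    using norm_triangle_ineq4[of a "cstar a"] by (simp add: norm_scaleC norm_divide)
  have "\<i> *\<^sub>C (- \<i> / 2) *\<^sub>C (a - cstar a) = (1/2) *\<^sub>R (a - cstar a)"
    using scaleC_of_real[of "1/2" "a - cstar a"] by (simp add: scaleC_scaleC)
  then have "(1/2) *\<^sub>R (a + cstar a) + \<i> *\<^sub>C (- \<i> / 2) *\<^sub>C (a - cstar a)
      = (1/2) *\<^sub>R (a + cstar a) + (1/2) *\<^sub>R (a - cstar a)" by simp
  also have "\<dots> = (1/2) *\<^sub>R (a + a)" by (simp only: scaleR_add_right[symmetric]) simp
  finally show "a = (1/2) *\<^sub>R (a + cstar a) + \<i> *\<^sub>C (- \<i> / 2) *\<^sub>C (a - cstar a)"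
    by (simp add: scaleR_2[symmetric])
qed

text \<open>The 2 comes from treating real and imaginary part separately instead of using
  Cauchy-Schwarz; it is one of the factors in the final constant.\<close>

lemma positive_functional_bound:
  assumes \<phi>: "positive_functional \<phi>"
  shows "norm (\<phi> a) \<le> 2 * Re (\<phi> 1) * norm a"
proof -
  note P = positive_functionalD[OF \<phi>]
  obtain h k where hk: "cstar h = h" "cstar k = k" "a = h + \<i> *\<^sub>C k" "norm h \<le> norm a" "norm k \<le> norm a"
    by (rule selfadjoint_decomposition)
  have n: "norm (\<phi> b) \<le> Re (\<phi> 1) * norm b" if "cstar b = b" for b
    using positive_functional_selfadjoint[OF \<phi> that] by (simp add: cmod_eq_Re)
  have "norm (\<phi> a) \<le> norm (\<phi> h) + norm (\<phi> k)"
    unfolding hk(3) P using norm_triangle_ineq[of "\<phi> h" "\<i> * \<phi> k"] by (simp add: norm_mult)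
  also have "\<dots> \<le> Re (\<phi> 1) * norm a + Re (\<phi> 1) * norm a"
    using n[OF hk(1)] n[OF hk(2)] mult_left_mono[OF hk(4) positive_functional_one(2)[OF \<phi>]]
      mult_left_mono[OF hk(5) positive_functional_one(2)[OF \<phi>]] by linarith
  finally show ?thesis by (simp add: mult_ac)
qed

lemma bounded_linear_positive_functional:
  assumes \<phi>: "positive_functional \<phi>"
  shows "bounded_linear \<phi>"
proof (rule bounded_linear_intro[of _ "2 * Re (\<phi> 1)"])
  show "norm (\<phi> x) \<le> norm x * (2 * Re (\<phi> 1))" for x
    using positive_functional_bound[OF \<phi>, of x] by (simp add: mult.commute)
  show "\<phi> (x + y) = \<phi> x + \<phi> y" for x y by (rule positive_functionalD(1)[OF \<phi>])
  show "\<phi> (r *\<^sub>R x) = r *\<^sub>R \<phi> x" for r x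
    unfolding positive_functionalD(5)[OF \<phi>] by (simp add: scaleR_conv_of_real)
qed

text \<open>For a projection q the compressed functional has mass \<open>\<phi> q\<close>, so
  \<open>positive_functional_bound\<close> controls elements of the corner by
  \<open>\<phi> q\<close> instead of \<open>\<phi> 1\<close>.\<close>

lemma positive_functional_compress:
  assumes \<phi>: "positive_functional \<phi>"
  shows "positive_functional (\<lambda>a. \<phi> (cstar q * a * q))"
proof -
  note P = positive_functionalD[OF \<phi>]
  have e: "cstar q * (cstar x * x) * q = cstar (x * q) * (x * q)" for x
    by (simp only: cstar_mult mult.assoc)
  show ?thesis
    unfolding positive_functional_def
  proof (intro conjI allI)
    fix c x y
    show "\<phi> (cstar q * (x + y) * q) = \<phi> (cstar q * x * q) + \<phi> (cstar q * y * q)"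
      by (simp only: distrib_left distrib_right P)
    show "\<phi> (cstar q * c *\<^sub>C x * q) = c * \<phi> (cstar q * x * q)"
      by (simp only: scaleC_mult_left scaleC_mult_right P)
  qed (simp_all only: e P)
qed

section \<open>Bounded analytic functions on the strip\<close>

lemma closed_strip: "closed (strip c)"
proof -
  have "strip c = {z. 0 \<le> Im z / c} \<inter> {z. Im z / c \<le> 1}" by (auto simp: strip_def)
  also have "closed \<dots>"
    by (intro closed_Int closed_Collect_le) (auto simp: divide_inverse intro!: continuous_intros)
  finally show ?thesis .
qed

lemma open_strip_inner: "open {z. 0 < Im z / c \<and> Im z / c < 1}"
  unfolding Collect_conj_eq
  by (intro open_Int open_Collect_less) (auto simp: divide_inverse intro!: continuous_intros)

lemma strip_inner_subset: "{z. 0 < Im z / c \<and> Im z / c < 1} \<subseteq> interior (strip c)"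
  by (intro interior_maximal open_strip_inner) (auto simp: strip_def)

lemma strip_add_real [simp]: "z + of_real t \<in> strip c \<longleftrightarrow> z \<in> strip c"
  by (simp add: strip_def)

lemma real_in_strip [simp]: "of_real t \<in> strip c"
  by (simp add: strip_def)

lemma real_add_ic_in_strip [simp]: "of_real t + \<i> * of_real c \<in> strip c"
  by (simp add: strip_def)

section \<open>A Phragmen-Lindelof principle on the strip\<close>

lemma norm_exp_neg_square: "norm (exp (- of_real e * z\<^sup>2)) = exp (- e * ((Re z)\<^sup>2 - (Im z)\<^sup>2))"
  by (simp add: norm_exp_eq_Re power2_eq_square algebra_simps)

text \<open>The factor \<open>exp (- e z\<^sup>2)\<close> makes a bounded function on the strip small at infinity,
  so that the maximum modulus principle on rectangles applies; then let \<open>e\<close> tend to 0.\<close>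

lemma strip_maximum_principle:
  assumes c: "c \<noteq> 0" and cont: "continuous_on (strip c) F" and bdd: "bounded (F ` strip c)"
    and hol: "F holomorphic_on interior (strip c)"
    and lo: "\<And>t::real. norm (F (of_real t)) \<le> M"
    and hi: "\<And>t::real. norm (F (of_real t + \<i> * of_real c)) \<le> M"
    and z: "z \<in> strip c"
  shows "norm (F z) \<le> M"
proof -
  obtain B where B: "\<And>z. z \<in> strip c \<Longrightarrow> norm (F z) \<le> B" "B > 0"
    using bdd by (force simp: bounded_pos)
  have M: "M \<ge> 0" using lo[of 0] norm_ge_zero by (rule order_trans[rotated])
  have *: "norm (exp (- of_real e * z\<^sup>2)) * norm (F z) \<le> M * exp (e * c\<^sup>2)" if e: "e > 0" for e
  proof -
    define G where "G z = exp (- of_real e * z\<^sup>2) * F z" for z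
    have Im_le: "(Im z)\<^sup>2 \<le> c\<^sup>2" if "z \<in> strip c" for z
    proof -
      have "\<bar>Im z / c\<bar> \<le> 1" using that by (auto simp: strip_def)
      then have "\<bar>Im z\<bar> \<le> \<bar>c\<bar>" using c by (simp add: abs_divide divide_le_eq_1)
      then show ?thesis by (simp add: abs_le_square_iff)
    qed
    have Gle: "norm (G z) \<le> exp (e * c\<^sup>2) * exp (- e * (Re z)\<^sup>2) * norm (F z)" if "z \<in> strip c" for z
    proof -
      have "exp (- e * ((Re z)\<^sup>2 - (Im z)\<^sup>2)) \<le> exp (e * c\<^sup>2) * exp (- e * (Re z)\<^sup>2)"
        unfolding exp_add[symmetric] exp_le_cancel_iff using Im_le[OF that] e
        by (simp add: algebra_simps)
      then show ?thesis
        unfolding G_def norm_mult norm_exp_neg_square by (rule mult_right_mono) simp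
    qed
    have GM: "norm (G z) \<le> exp (e * c\<^sup>2) * M" if z: "z \<in> strip c" and n: "norm (F z) \<le> M" for z
    proof -
      have "exp (- e * (Re z)\<^sup>2) * norm (F z) \<le> 1 * M"
        using e M n by (intro mult_mono) auto
      then have "exp (e * c\<^sup>2) * exp (- e * (Re z)\<^sup>2) * norm (F z) \<le> exp (e * c\<^sup>2) * M"
        unfolding mult.assoc mult_1_left by (rule mult_left_mono) simp
      with Gle[OF z] show ?thesis by (rule order_trans)
    qed
    have bnd: "norm (G z) \<le> exp (e * c\<^sup>2) * (M + B * exp (- e * R\<^sup>2))" if R: "R > \<bar>Re z\<bar>" for R
    proof -
      \<comment> \<open>The strip is cut to a rectangle of half-width R, whose vertical sides
        contribute only the Gaussian term; R then tends to infinity.\<close>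
      define S where "S = strip c \<inter> {z. Re z \<le> R} \<inter> {z. - R \<le> Re z}"
      have "closed S" unfolding S_def
        by (intro closed_Int closed_strip closed_halfspace_Re_le closed_halfspace_Re_ge)
      have "bounded S"
      proof (rule boundedI)
        fix w assume w: "w \<in> S"
        have "\<bar>Im w\<bar> \<le> \<bar>c\<bar>" using Im_le[of w] w by (auto simp: S_def abs_le_square_iff)
        then show "norm w \<le> R + \<bar>c\<bar>" using w cmod_le[of w] by (auto simp: S_def)
      qed
      have SF: "w \<in> strip c" if "w \<in> S" for w using that by (auto simp: S_def)
      show ?thesis
      proof (rule maximum_modulus_frontier[of G S])
        have "interior S \<subseteq> interior (strip c)" by (rule interior_mono) (auto simp: S_def)
        then show "G holomorphic_on interior S"
          unfolding G_def by (intro holomorphic_intros holomorphic_on_subset[OF hol])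
        show "continuous_on (closure S) G"
          unfolding G_def closure_closed[OF \<open>closed S\<close>]
          by (intro continuous_intros continuous_on_subset[OF cont]) (auto simp: S_def)
        show "bounded S" by fact
        show "z \<in> S" using z R by (auto simp: S_def)
        fix w assume w: "w \<in> frontier S"
        then have wS: "w \<in> S" using \<open>closed S\<close> frontier_subset_closed by blast
        have "\<not> (0 < Im w / c \<and> Im w / c < 1 \<and> Re w < R \<and> - R < Re w)"
        proof
          let ?O = "{z. 0 < Im z / c \<and> Im z / c < 1} \<inter> {z. Re z < R} \<inter> {z. - R < Re z}"
          assume "0 < Im w / c \<and> Im w / c < 1 \<and> Re w < R \<and> - R < Re w"
          then have "w \<in> ?O" by simp
          moreover have "open ?O"
            by (intro open_Int open_strip_inner open_halfspace_Re_lt open_halfspace_Re_gt)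
          moreover have "?O \<subseteq> S" by (auto simp: S_def strip_def)
          ultimately have "w \<in> interior S" by (meson interior_maximal subsetD)
          with w show False by (simp add: frontier_def)
        qed
        moreover have "0 \<le> Im w / c" "Im w / c \<le> 1" "Re w \<le> R" "- R \<le> Re w"
          using wS by (auto simp: S_def strip_def)
        ultimately have "0 = Im w / c \<or> Im w / c = 1 \<or> Re w = R \<or> - R = Re w"
          unfolding less_le by blast
        then consider "0 = Im w / c" | "Im w / c = 1" | "Re w = R \<or> - R = Re w" by blast
        then show "norm (G w) \<le> exp (e * c\<^sup>2) * (M + B * exp (- e * R\<^sup>2))"
        proof cases
          case 3
          then have "(Re w)\<^sup>2 = R\<^sup>2" by (metis power2_minus)
          then have "norm (G w) \<le> exp (e * c\<^sup>2) * (exp (- e * R\<^sup>2) * B)"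
            using order_trans[OF Gle[OF SF[OF wS]], of "exp (e * c\<^sup>2) * (exp (- e * R\<^sup>2) * B)"] B(1)[OF SF[OF wS]]
            by (simp add: mult.assoc)
          also have "\<dots> \<le> exp (e * c\<^sup>2) * (M + B * exp (- e * R\<^sup>2))"
            using M by (intro mult_left_mono) (auto simp: mult.commute)
          finally show ?thesis .
        next
          case 1
          then have "w = of_real (Re w)" using c by (simp add: complex_eq_iff)
          then have "norm (F w) \<le> M" using lo[of "Re w"] by simp
          then show ?thesis
            using GM[OF SF[OF wS]] B(2) by (simp add: distrib_left add_increasing2)
        next
          case 2
          then have "Im w = c" using c by simp
          then have "w = of_real (Re w) + \<i> * of_real c" by (simp add: complex_eq_iff)
          then have "norm (F w) \<le> M" using hi[of "Re w"] by simp
          then show ?thesis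
            using GM[OF SF[OF wS]] B(2) by (simp add: distrib_left add_increasing2)
        qed
      qed
    qed
    have "((\<lambda>R. exp (e * c\<^sup>2) * (M + B * exp (- e * R\<^sup>2))) \<longlongrightarrow> exp (e * c\<^sup>2) * (M + B * 0)) at_top"
      using e by (intro tendsto_intros) real_asymp
    then have "norm (G z) \<le> exp (e * c\<^sup>2) * (M + B * 0)"
      by (rule tendsto_lowerbound)
         (use bnd in \<open>auto intro!: eventually_mono[OF eventually_gt_at_top[of "\<bar>Re z\<bar>"]]\<close>)
    then show ?thesis by (simp add: G_def norm_mult mult.commute)
  qed
  have "((\<lambda>e. norm (exp (- of_real e * z\<^sup>2)) * norm (F z)) \<longlongrightarrow> norm (exp (- of_real 0 * z\<^sup>2)) * norm (F z)) (at_right 0)"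
    by (intro tendsto_intros)
  moreover have "((\<lambda>e. M * exp (e * c\<^sup>2)) \<longlongrightarrow> M * exp (0 * c\<^sup>2)) (at_right 0)"
    by (intro tendsto_intros)
  ultimately show ?thesis
    using tendsto_le[OF trivial_limit_at_right_real, of "\<lambda>e. M * exp (e * c\<^sup>2)" "M * exp (0 * c\<^sup>2)" 0
        "\<lambda>e. norm (exp (- of_real e * z\<^sup>2)) * norm (F z)" "norm (exp (- of_real 0 * z\<^sup>2)) * norm (F z)"]
      * by (auto simp: eventually_at_right_less eventually_mono[OF eventually_at_right_less])
qed

text \<open>Both boundary functions are parameters, so that sums, multiples and limits of KMS-type
  relations become closure properties of one predicate.\<close>

definition strip_fun :: "real \<Rightarrow> (complex \<Rightarrow> complex) \<Rightarrow> (real \<Rightarrow> complex) \<Rightarrow> (real \<Rightarrow> complex) \<Rightarrow> bool" where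
  "strip_fun c F f g \<longleftrightarrow> continuous_on (strip c) F \<and> bounded (F ` strip c) \<and> F holomorphic_on interior (strip c)
     \<and> (\<forall>t. F (of_real t) = f t) \<and> (\<forall>t. F (of_real t + \<i> * of_real c) = g t)"

lemma strip_fun_bound:
  assumes "c \<noteq> 0" "strip_fun c F f g" "\<And>t. norm (f t) \<le> M" "\<And>t. norm (g t) \<le> M" "z \<in> strip c"
  shows "norm (F z) \<le> M"
  using assms unfolding strip_fun_def by (intro strip_maximum_principle[of c F M z]) auto

lemma strip_fun_add:
  assumes "strip_fun c F f g" "strip_fun c F' f' g'"
  shows "strip_fun c (\<lambda>z. F z + F' z) (\<lambda>t. f t + f' t) (\<lambda>t. g t + g' t)"
  using assms unfolding strip_fun_def
  by (auto intro!: continuous_intros holomorphic_intros bounded_plus_comp)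

lemma strip_fun_cmult:
  assumes "strip_fun c F f g"
  shows "strip_fun c (\<lambda>z. k * F z) (\<lambda>t. k * f t) (\<lambda>t. k * g t)"
proof -
  have "bounded ((\<lambda>z. k * F z) ` strip c)"
    using assms bounded_linear_image[OF _ bounded_linear_mult_right[of k], of "F ` strip c"]
    by (simp add: strip_fun_def image_image)
  then show ?thesis
    using assms unfolding strip_fun_def by (auto intro!: continuous_intros holomorphic_intros)
qed

lemma strip_fun_diff:
  assumes "strip_fun c F f g" "strip_fun c F' f' g'"
  shows "strip_fun c (\<lambda>z. F z - F' z) (\<lambda>t. f t - f' t) (\<lambda>t. g t - g' t)"
  using strip_fun_add[OF assms(1) strip_fun_cmult[OF assms(2), of "-1"]] by simp

lemma strip_fun_sum:
  assumes "\<And>i. i \<in> I \<Longrightarrow> strip_fun c (F i) (f i) (g i)"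
  shows "strip_fun c (\<lambda>z. \<Sum>i\<in>I. F i z) (\<lambda>t. \<Sum>i\<in>I. f i t) (\<lambda>t. \<Sum>i\<in>I. g i t)"
  using assms
proof (induction I rule: infinite_finite_induct)
  case (insert x I)
  then show ?case using strip_fun_add[of c "F x" "f x" "g x"] by simp
qed (auto simp: strip_fun_def image_constant_conv)

lemma norm_exp_i_div: "norm (exp (of_real l * \<i> * z / of_real c)) = exp (- l * (Im z / c))"
  by (simp add: norm_exp_eq_Re)

lemma exp_neg_mult_tendsto_0: "k > 0 \<Longrightarrow> ((\<lambda>l. exp (- l * k)) \<longlongrightarrow> (0::real)) at_top"
  by real_asymp

text \<open>If one boundary value vanishes, multiply by \<open>exp (i l z / c)\<close> and let \<open>l\<close> tend to
  plus or minus infinity.\<close>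

lemma strip_fun_zero:
  assumes c: "c \<noteq> 0" and F: "strip_fun c F f g" and z: "0 < Im z / c" "Im z / c < 1"
    and zero: "(\<forall>t. f t = 0) \<or> (\<forall>t. g t = 0)"
  shows "F z = 0"
proof -
  have zs: "z \<in> strip c" using z by (auto simp: strip_def)
  obtain B where B: "\<And>z. z \<in> strip c \<Longrightarrow> norm (F z) \<le> B" "B > 0"
    using F by (force simp: bounded_pos strip_fun_def)
  have fB: "norm (f t) \<le> B" "norm (g t) \<le> B" for t
    using B(1)[of "of_real t"] B(1)[of "of_real t + \<i> * of_real c"] F by (auto simp: strip_fun_def)
  define E where "E l z = exp (of_real l * \<i> * z / of_real c)" for l :: real and z :: complex
  have nE: "norm (E l z) = exp (- l * (Im z / c))" for l z
    unfolding E_def by (rule norm_exp_i_div)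
  have EF: "strip_fun c (\<lambda>z. E l z * F z) (\<lambda>t. E l (of_real t) * f t) (\<lambda>t. E l (of_real t + \<i> * of_real c) * g t)" for l
  proof -
    have "norm (E l z * F z) \<le> exp \<bar>l\<bar> * B" if "z \<in> strip c" for z
    proof -
      have "\<bar>l * (Im z / c)\<bar> \<le> \<bar>l\<bar> * 1" unfolding abs_mult
        by (rule mult_left_mono) (use that in \<open>auto simp: strip_def\<close>)
      then have "- l * (Im z / c) \<le> \<bar>l\<bar>" unfolding mult_minus_left by linarith
      then show ?thesis unfolding norm_mult nE
        using B(1)[OF that] by (intro mult_mono) auto
    qed
    then have "bounded ((\<lambda>z. E l z * F z) ` strip c)" by (auto intro!: boundedI)
    then show ?thesis
      using F c unfolding strip_fun_def E_def by (auto intro!: continuous_intros holomorphic_intros)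
  qed
  have bnd: "exp (- l * (Im z / c)) * norm (F z) \<le> M"
    if "\<And>t. norm (E l (of_real t) * f t) \<le> M" "\<And>t. norm (E l (of_real t + \<i> * of_real c) * g t) \<le> M" for l M
    using strip_fun_bound[OF c EF that zs] by (simp add: norm_mult nE)
  from zero show ?thesis
  proof
    assume f0: "\<forall>t. f t = 0"
    have "norm (F z) \<le> B * exp (- l * (1 - Im z / c))" for l
    proof -
      have "exp (- l * (Im z / c)) * norm (F z) \<le> exp (- l) * B"
        by (rule bnd) (use f0 fB B c in \<open>auto simp: norm_mult nE\<close>)
      then have "exp (l * (Im z / c)) * (exp (- l * (Im z / c)) * norm (F z)) \<le> exp (l * (Im z / c)) * (exp (- l) * B)"
        by (rule mult_left_mono) simp
      moreover have "exp (l * (Im z / c)) * exp (- l * (Im z / c)) = 1"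
        by (simp only: exp_add[symmetric]) simp
      moreover have "exp (l * (Im z / c)) * exp (- l) = exp (- l * (1 - Im z / c))"
        by (simp only: exp_add[symmetric]) (simp add: algebra_simps)
      ultimately show ?thesis by (simp only: mult.assoc[symmetric] mult_1_left mult.commute[of B])
    qed
    moreover have "((\<lambda>l. B * exp (- l * (1 - Im z / c))) \<longlongrightarrow> B * 0) at_top"
      using z by (intro tendsto_intros exp_neg_mult_tendsto_0) auto
    ultimately have "norm (F z) \<le> B * 0"
      by (intro tendsto_lowerbound[where F = "at_top :: real filter"]) auto
    then show ?thesis by simp
  next
    assume g0: "\<forall>t. g t = 0"
    have "norm (F z) \<le> B * exp (- l * (Im z / c))" for l
    proof -
      have "exp (l * (Im z / c)) * norm (F z) \<le> B"
      proof -
        have "exp (- (- l) * (Im z / c)) * norm (F z) \<le> B"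
          by (rule bnd) (use g0 fB B c in \<open>auto simp: norm_mult nE\<close>)
        then show ?thesis by simp
      qed
      then have "exp (- l * (Im z / c)) * (exp (l * (Im z / c)) * norm (F z)) \<le> exp (- l * (Im z / c)) * B"
        by (rule mult_left_mono) simp
      moreover have "exp (- l * (Im z / c)) * exp (l * (Im z / c)) = 1"
        by (simp only: exp_add[symmetric]) simp
      ultimately show ?thesis by (simp only: mult.assoc[symmetric] mult_1_left mult.commute[of B])
    qed
    moreover have "((\<lambda>l. B * exp (- l * (Im z / c))) \<longlongrightarrow> B * 0) at_top"
      using z by (intro tendsto_intros exp_neg_mult_tendsto_0) auto
    ultimately have "norm (F z) \<le> B * 0"
      by (intro tendsto_lowerbound[where F = "at_top :: real filter"]) auto
    then show ?thesis by simp
  qed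
qed

text \<open>Inside the strip F is 0 by \<open>strip_fun_zero\<close>; continuity along the vertical
  segment through t carries this to both ends.\<close>

lemma strip_fun_zero_boundary:
  assumes c: "c \<noteq> 0" and F: "strip_fun c F f g" and zero: "(\<forall>t. f t = 0) \<or> (\<forall>t. g t = 0)"
  shows "f t = 0" "g t = 0"
proof -
  define p where "p s = of_real t + \<i> * of_real (c * s)" for s :: real
  have "continuous_on {0..1} p" unfolding p_def by (intro continuous_intros)
  moreover have "p ` {0..1} \<subseteq> strip c" using c by (auto simp: p_def strip_def)
  ultimately have cont: "continuous_on {0..1} (\<lambda>s. F (p s))"
    using F unfolding strip_fun_def by (intro continuous_on_compose2[of "strip c" F _ p]) auto
  have z: "F (p s) = 0" if "s \<in> {0<..<1}" for s
    by (rule strip_fun_zero[OF c F _ _ zero]) (use that c in \<open>auto simp: p_def\<close>)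
  have cl: "closure {0<..<1} = {0..1::real}" by simp
  have "F (p s) = 0" if "s \<in> {0..1}" for s
    using continuous_constant_on_closure[of "{0<..<1}" "\<lambda>s. F (p s)" 0 s] cont z that cl by simp
  from this[of 0] this[of 1] show "f t = 0" "g t = 0"
    using F by (auto simp: strip_fun_def p_def)
qed

text \<open>One boundary value determines the other. This is how identities at real time are
  transported to the time ic.\<close>

lemma strip_fun_unique:
  assumes c: "c \<noteq> 0" and F: "strip_fun c F f g" and F': "strip_fun c F' f g'"
  shows "g t = g' t"
  using strip_fun_zero_boundary(2)[OF c strip_fun_diff[OF F F']] by simp

text \<open>The Lipschitz bounds are uniform in t, so by the maximum principle the extensions for
  approximants of y form a uniform Cauchy sequence on the whole strip. KMS-type relations can
  therefore be checked on sums of eigenvectors.\<close>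

lemma strip_fun_dense:
  fixes f g :: "'a::cstar_algebra \<Rightarrow> real \<Rightarrow> complex"
  assumes c: "c \<noteq> 0" and S: "closure S = UNIV"
    and ex: "\<And>y. y \<in> S \<Longrightarrow> \<exists>F. strip_fun c F (f y) (g y)"
    and f: "\<And>y y' t. norm (f y t - f y' t) \<le> K * norm (y - y')"
    and g: "\<And>y y' t. norm (g y t - g y' t) \<le> K * norm (y - y')"
  shows "\<exists>F. strip_fun c F (f y) (g y)"
proof -
  obtain Y where Y: "\<And>n. Y n \<in> S" "Y \<longlonglongrightarrow> y"
    using S by (metis UNIV_I closure_sequential)
  obtain F where F: "\<And>n. strip_fun c (F n) (f (Y n)) (g (Y n))"
    using choice[of "\<lambda>n F. strip_fun c F (f (Y n)) (g (Y n))"] ex Y(1) by blast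
  have K: "K \<ge> 0" using f[of 1 0 0] norm_ge_zero by (simp add: order_trans[OF norm_ge_zero])
  have diff: "norm (F n z - F m z) \<le> K * norm (Y n - Y m)" if "z \<in> strip c" for n m z
    by (rule strip_fun_bound[OF c strip_fun_diff[OF F F] _ _ that]) (simp_all add: f g)
  have "uniformly_convergent_on (strip c) F"
  proof (rule Cauchy_uniformly_convergent, rule uniformly_Cauchy_onI')
    fix e :: real assume e: "e > 0"
    then have "e / (K + 1) > 0" using K by simp
    then obtain N where N: "\<And>m n. m \<ge> N \<Longrightarrow> n \<ge> N \<Longrightarrow> norm (Y m - Y n) < e / (K + 1)"
      using LIMSEQ_imp_Cauchy[OF Y(2)] unfolding Cauchy_def dist_norm by metis
    have "dist (F m z) (F n z) < e" if "z \<in> strip c" "m \<ge> N" "n > m" for z m n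
    proof -
      have "dist (F m z) (F n z) \<le> K * norm (Y m - Y n)" using diff[OF that(1)] by (simp add: dist_norm)
      also have "\<dots> \<le> K * (e / (K + 1))" using N[of m n] that K by (intro mult_left_mono) auto
      also have "\<dots> < e" using e K by (simp add: field_simps)
      finally show ?thesis .
    qed
    then show "\<exists>M. \<forall>x\<in>strip c. \<forall>m\<ge>M. \<forall>n>m. dist (F m x) (F n x) < e" by blast
  qed
  then obtain G where G: "uniform_limit (strip c) F G sequentially"
    by (auto simp: uniformly_convergent_on_def)
  have lim: "(\<lambda>n. F n z) \<longlonglongrightarrow> G z" if "z \<in> strip c" for z
    using tendsto_uniform_limitI[OF G that] .
  have h: "(\<lambda>n. h (Y n)) \<longlonglongrightarrow> h y"
    if "\<And>y y'. norm (h y - h y') \<le> K * norm (y - y')" for h :: "'a \<Rightarrow> complex"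
  proof (rule LIM_zero_cancel, rule Lim_null_comparison)
    show "\<forall>\<^sub>F n in sequentially. norm (h (Y n) - h y) \<le> K * norm (Y n - y)" using that by simp
    have "(\<lambda>n. K * norm (Y n - y)) \<longlonglongrightarrow> K * norm (y - y)" by (intro tendsto_intros Y)
    then show "(\<lambda>n. K * norm (Y n - y)) \<longlonglongrightarrow> 0" by simp
  qed
  have "strip_fun c G (f y) (g y)"
    unfolding strip_fun_def
  proof (intro conjI allI)
    show cG: "continuous_on (strip c) G"
      by (rule uniform_limit_theorem[OF _ G]) (use F in \<open>auto simp: strip_fun_def\<close>)
    show "bounded (G ` strip c)"
      by (rule uniform_limit_bounded[OF G]) (use F in \<open>auto simp: strip_fun_def\<close>)
    show "G holomorphic_on interior (strip c)"
    proof (rule holomorphic_uniform_sequence[of _ F])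
      fix x assume "x \<in> interior (strip c)"
      then obtain d where "d > 0" "cball x d \<subseteq> interior (strip c)"
        using open_contains_cball open_interior by blast
      then show "\<exists>d>0. cball x d \<subseteq> interior (strip c) \<and> uniform_limit (cball x d) F G sequentially"
        using uniform_limit_on_subset[OF G] interior_subset by (metis subset_trans)
    qed (use F in \<open>auto simp: strip_fun_def\<close>)
    fix t :: real
    have "(\<lambda>n. F n (of_real t)) \<longlonglongrightarrow> f y t" "(\<lambda>n. F n (of_real t + \<i> * of_real c)) \<longlonglongrightarrow> g y t"
      using h[of "\<lambda>y. f y t"] h[of "\<lambda>y. g y t"] f g F by (simp_all add: strip_fun_def)
    then show "G (of_real t) = f y t" "G (of_real t + \<i> * of_real c) = g y t"
      using lim LIMSEQ_unique real_in_strip real_add_ic_in_strip by blast+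
  qed
  then show "\<exists>F. strip_fun c F (f y) (g y)" by blast
qed

section \<open>Eigenvectors of flows on finite-dimensional subspaces\<close>

interpretation cvs: vector_space "scaleC :: complex \<Rightarrow> 'a::cstar_algebra \<Rightarrow> 'a"
  by unfold_locales (auto simp: scaleC_add_right scaleC_add_left scaleC_scaleC)

lemma cspan_eq_span: "cspan S = cvs.span S"
  unfolding cspan_def cvs.span_explicit by blast

lemma csubspace_iff_subspace: "csubspace B \<longleftrightarrow> cvs.subspace B"
  unfolding csubspace_def cvs.subspace_def by blast

text \<open>Induction on S. If a ball of radius d around a misses the closed span of S, the
  coefficient of a in an element of the larger span is at most the norm of that element divided by
  d. So the coefficients of a convergent sequence converge.\<close>

lemma closed_span_finite:
  fixes S :: "'a::cstar_algebra set"
  assumes "finite S"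
  shows "closed (cvs.span S)"
  using assms
proof (induction S rule: finite_induct)
  case (insert a S)
  show ?case
  proof (cases "a \<in> cvs.span S")
    case True
    then show ?thesis using insert.IH by (simp add: cvs.span_redundant)
  next
    case False
    then have "open (- cvs.span S)" "a \<in> - cvs.span S" using insert.IH by (auto simp: open_Compl)
    then obtain d where d: "d > 0" "ball a d \<subseteq> - cvs.span S" using open_contains_ball by blast
    have coef: "cmod k * d \<le> norm x" if x: "x - k *\<^sub>C a \<in> cvs.span S" for x k
    proof (cases "k = 0")
      case False
      have "(- 1 / k) *\<^sub>C (x - k *\<^sub>C a) \<in> cvs.span S" using x by (rule cvs.span_scale)
      then have "a - (1 / k) *\<^sub>C x \<in> cvs.span S"
        using False by (simp add: scaleC_diff_right scaleC_scaleC)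
      then have "a - (1 / k) *\<^sub>C x \<notin> ball a d" using d by blast
      then have "d \<le> norm x / cmod k" by (simp add: dist_norm norm_scaleC norm_divide)
      then show ?thesis using False by (simp add: field_simps)
    qed (use d in simp)
    show ?thesis
      unfolding closed_sequential_limits
    proof (intro allI impI, elim conjE)
      fix X l assume X: "\<forall>n. X n \<in> cvs.span (insert a S)" and lim: "X \<longlonglongrightarrow> l"
      have "\<exists>k. \<forall>n. X n - k n *\<^sub>C a \<in> cvs.span S"
        using X unfolding cvs.span_insert by (intro choice) blast
      then obtain k where k: "\<And>n. X n - k n *\<^sub>C a \<in> cvs.span S" by blast
      have kd: "cmod (k m - k n) * d \<le> norm (X m - X n)" for m n
      proof (rule coef)
        have "(X m - k m *\<^sub>C a) - (X n - k n *\<^sub>C a) \<in> cvs.span S" using cvs.span_diff[OF k k] .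
        then show "X m - X n - (k m - k n) *\<^sub>C a \<in> cvs.span S"
          by (simp add: scaleC_diff_left algebra_simps)
      qed
      have "Cauchy k"
      proof (rule CauchyI)
        fix e :: real assume "e > 0"
        then have "e * d > 0" using d by simp
        then obtain N where "\<And>m n. m \<ge> N \<Longrightarrow> n \<ge> N \<Longrightarrow> norm (X m - X n) < e * d"
          using CauchyD[OF LIMSEQ_imp_Cauchy[OF lim]] by blast
        then show "\<exists>M. \<forall>m\<ge>M. \<forall>n\<ge>M. norm (k m - k n) < e"
          using kd d by (meson le_less_trans mult_less_cancel_right_pos)
      qed
      then obtain k0 where k0: "k \<longlonglongrightarrow> k0" using Cauchy_convergent convergent_def by blast
      have "(\<lambda>n. X n - k n *\<^sub>C a) \<longlonglongrightarrow> l - k0 *\<^sub>C a"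
        by (intro tendsto_diff lim tendsto_scaleC k0 tendsto_const)
      then have "l - k0 *\<^sub>C a \<in> cvs.span S"
        using closed_sequentially[OF insert.IH, of "\<lambda>n. X n - k n *\<^sub>C a"] k by simp
      then show "l \<in> cvs.span (insert a S)" unfolding cvs.span_insert by blast
    qed
  qed
qed simp

lemma subspace_of_span_finite:
  assumes T: "cvs.subspace T" "T \<subseteq> cvs.span S" and S: "finite (S :: 'a::cstar_algebra set)"
  obtains S0 where "finite S0" "T = cvs.span S0"
proof -
  obtain B where B: "B \<subseteq> T" "cvs.independent B" "T \<subseteq> cvs.span B"
    using cvs.maximal_independent_subset by blast
  have "finite B" using cvs.independent_span_bound[OF S B(2)] B(1) T(2) by auto
  moreover have "T = cvs.span B" using B T by (metis cvs.span_minimal subset_antisym)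
  ultimately show thesis by (rule that)
qed

section \<open>Eigenvectors of operators without Jordan blocks\<close>

locale linear_operator_on =
  fixes B :: "'a::cstar_algebra set" and D :: "'a \<Rightarrow> 'a"
  assumes sub: "cvs.subspace B"
    and maps: "x \<in> B \<Longrightarrow> D x \<in> B"
    and add: "x \<in> B \<Longrightarrow> y \<in> B \<Longrightarrow> D (x + y) = D x + D y"
    and scale: "x \<in> B \<Longrightarrow> D (c *\<^sub>C x) = c *\<^sub>C D x"
begin

lemma mem: "0 \<in> B" "x \<in> B \<Longrightarrow> y \<in> B \<Longrightarrow> x + y \<in> B" "x \<in> B \<Longrightarrow> c *\<^sub>C x \<in> B" "x \<in> B \<Longrightarrow> y \<in> B \<Longrightarrow> x - y \<in> B"
  using sub by (auto simp: cvs.subspace_0 cvs.subspace_add cvs.subspace_scale cvs.subspace_diff)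

lemma diff: "x \<in> B \<Longrightarrow> y \<in> B \<Longrightarrow> D (x - y) = D x - D y"
  using add[of x "-1 *\<^sub>C y"] scale[of y "-1"] mem(3)[of y "-1"] by simp

lemma zero: "D 0 = 0"
  using scale[of 0 0] mem by simp

lemma funpow_maps: "x \<in> B \<Longrightarrow> (D ^^ i) x \<in> B"
  by (induction i) (auto simp: maps)

lemma funpow_diff: "x \<in> B \<Longrightarrow> y \<in> B \<Longrightarrow> (D ^^ i) (x - y) = (D ^^ i) x - (D ^^ i) y"
  by (induction i) (auto simp: diff funpow_maps)

lemma funpow_scale: "x \<in> B \<Longrightarrow> (D ^^ i) (c *\<^sub>C x) = c *\<^sub>C (D ^^ i) x"
  by (induction i) (auto simp: scale funpow_maps)

lemma sum_mem: "(\<And>i. i \<in> I \<Longrightarrow> f i \<in> B) \<Longrightarrow> (\<Sum>i\<in>I. f i) \<in> B"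
  by (induction I rule: infinite_finite_induct) (auto simp: mem)

lemma D_sum: "(\<And>i. i \<in> I \<Longrightarrow> f i \<in> B) \<Longrightarrow> D (\<Sum>i\<in>I. f i) = (\<Sum>i\<in>I. D (f i))"
  by (induction I rule: infinite_finite_induct) (auto simp: zero add sum_mem)

definition ev :: "complex poly \<Rightarrow> 'a \<Rightarrow> 'a" where
  "ev p x = (\<Sum>i\<le>degree p. coeff p i *\<^sub>C (D ^^ i) x)"

lemma ev_bound: "degree p \<le> N \<Longrightarrow> ev p x = (\<Sum>i\<le>N. coeff p i *\<^sub>C (D ^^ i) x)"
  unfolding ev_def by (rule sum.mono_neutral_left) (auto simp: coeff_eq_0)

lemma ev_add: "ev (p + q) x = ev p x + ev q x"
proof -
  let ?N = "max (degree p) (degree q)"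
  have "degree (p + q) \<le> ?N" by (rule degree_add_le_max)
  then show ?thesis
    unfolding ev_bound[of p ?N, OF max.cobounded1] ev_bound[of q ?N, OF max.cobounded2]
    by (subst ev_bound) (auto simp: scaleC_add_left sum.distrib)
qed

lemma ev_smult: "ev (smult c p) x = c *\<^sub>C ev p x"
  by (subst ev_bound[of _ "degree p"]) (auto simp: ev_def scaleC_sum_right scaleC_scaleC)

lemma ev_pCons0: "ev (pCons 0 q) x = ev q (D x)"
proof (cases "q = 0")
  case False
  then show ?thesis
    by (simp add: ev_def sum.atMost_Suc_shift funpow_swap1 del: sum.atMost_Suc)
qed (simp add: ev_def)

lemma ev_linear_factor:
  assumes x: "x \<in> B"
  shows "ev ([:-l, 1:] * q) x = ev q (D x - l *\<^sub>C x)"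
proof -
  have "[:-l, 1:] * q = smult (- l) q + pCons 0 q" by simp
  then have "ev ([:-l, 1:] * q) x = ev q (D x) - l *\<^sub>C ev q x"
    by (simp only: ev_add ev_smult ev_pCons0) simp
  also have "\<dots> = ev q (D x - l *\<^sub>C x)"
    using x by (simp add: ev_def funpow_diff funpow_scale mem maps scaleC_sum_right scaleC_diff_right
        scaleC_scaleC sum_subtractf mult.commute)
  finally show ?thesis .
qed

lemma annihilating_polynomial:
  assumes S: "finite S" "B = cvs.span S" and x: "x \<in> B"
  obtains p where "p \<noteq> 0" "ev p x = 0"
proof -
  define n where "n = card S"
  define f where "f i = (D ^^ i) x" for i
  have "\<exists>k. (\<exists>i\<le>n. k i \<noteq> 0) \<and> (\<Sum>i\<le>n. k i *\<^sub>C f i) = 0"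
  \<comment> \<open>Linear dependence is a property of the set of iterates, which has too many
    elements only if the iterates are distinct; a repetition is itself a linear relation.\<close>
  proof (cases "inj_on f {..n}")
    case False
    then obtain i j where ij: "i \<le> n" "j \<le> n" "i \<noteq> j" "f i = f j" by (auto simp: inj_on_def)
    define k where "k m = (if m = i then 1 else if m = j then -1 else 0 :: complex)" for m
    have "(\<Sum>m\<le>n. k m *\<^sub>C f m) = (\<Sum>m\<in>{i, j}. k m *\<^sub>C f m)"
      by (rule sum.mono_neutral_right) (use ij in \<open>auto simp: k_def\<close>)
    also have "\<dots> = 0" using ij by (simp add: k_def)
    finally show ?thesis using ij by (intro exI[of _ k]) (auto simp: k_def)
  next
    case True
    have "cvs.dependent (f ` {..n})"
    proof (rule ccontr)
      assume "cvs.independent (f ` {..n})"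
      moreover have "f ` {..n} \<subseteq> cvs.span S" using S(2) x funpow_maps by (auto simp: f_def)
      ultimately have "card (f ` {..n}) \<le> card S" using cvs.independent_span_bound[OF S(1)] by blast
      then show False using True by (simp add: card_image n_def)
    qed
    then obtain u v where u: "v \<in> f ` {..n}" "u v \<noteq> 0" "(\<Sum>v\<in>f ` {..n}. u v *\<^sub>C v) = 0"
      unfolding cvs.dependent_finite[OF finite_imageI[OF finite_atMost]] by blast
    then show ?thesis
      using True by (intro exI[of _ "\<lambda>i. u (f i)"]) (auto simp: sum.reindex)
  qed
  then obtain k i where k: "i \<le> n" "k i \<noteq> 0" "(\<Sum>i\<le>n. k i *\<^sub>C f i) = 0" by blast
  define p where "p = (\<Sum>i\<le>n. monom (k i) i)"
  have co: "coeff p j = (if j \<le> n then k j else 0)" for j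
    unfolding p_def coeff_sum by (simp add: if_distrib cong: if_cong)
  show thesis
  proof (rule that)
    show "p \<noteq> 0" using co[of i] k by auto
    have "degree p \<le> n" by (rule degree_le) (simp add: co)
    then show "ev p x = 0" using k(3) by (simp add: ev_bound co f_def)
  qed
qed

text \<open>Induction on the degree of a polynomial annihilating x. For a root m, the vector
  \<open>(D - m) x\<close> is already a sum of eigenvectors. Dividing its components with l \<noteq>
  m by \<open>l - m\<close> gives a preimage of them, and what remains of x after subtracting it is
  an eigenvector for m by \<open>semisimple\<close>, which excludes Jordan blocks.\<close>

lemma eigenvector_decomposition:
  assumes S: "finite S" "B = cvs.span S" and x: "x \<in> B"
    and semisimple: "\<And>l v. v \<in> B \<Longrightarrow> D (D v - l *\<^sub>C v) = l *\<^sub>C (D v - l *\<^sub>C v) \<Longrightarrow> D v = l *\<^sub>C v"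
  shows "\<exists>L f. finite L \<and> (\<forall>l\<in>L. f l \<in> B \<and> D (f l) = l *\<^sub>C f l) \<and> x = (\<Sum>l\<in>L. f l)"
proof -
  have "\<exists>L f. finite L \<and> (\<forall>l\<in>L. f l \<in> B \<and> D (f l) = l *\<^sub>C f l) \<and> x = (\<Sum>l\<in>L. f l)"
    if "p \<noteq> 0" "ev p x = 0" "x \<in> B" for p x
    using that
  proof (induction "degree p" arbitrary: p x)
    case 0
    then have "coeff p 0 \<noteq> 0" by (metis leading_coeff_0_iff)
    then have "x = 0" using 0 by (simp add: ev_def)
    then show ?case by (intro exI[of _ "{}"]) auto
  next
    case (Suc n)
    have "\<not> constant (poly p)" using Suc.hyps(2) by (simp add: constant_degree)
    then obtain m where "poly p m = 0" using fundamental_theorem_of_algebra by blast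
    then obtain q where p: "p = [:-m, 1:] * q" by (auto simp: poly_eq_0_iff_dvd)
    have q: "q \<noteq> 0" using p Suc.prems by auto
    have "degree p = Suc (degree q)" unfolding p using q by (subst degree_mult_eq) auto
    then have deg: "n = degree q" using Suc.hyps(2) by simp
    have ev0: "ev q (D x - m *\<^sub>C x) = 0" using Suc.prems ev_linear_factor[of x m q] p by simp
    have mB: "D x - m *\<^sub>C x \<in> B" using Suc.prems by (intro mem maps)
    obtain L f where Lf: "finite L" "\<And>l. l \<in> L \<Longrightarrow> f l \<in> B" "\<And>l. l \<in> L \<Longrightarrow> D (f l) = l *\<^sub>C f l"
      "D x - m *\<^sub>C x = (\<Sum>l\<in>L. f l)"
      using Suc.hyps(1)[OF deg q ev0 mB] by blast
    define f' where "f' l = (1 / (l - m)) *\<^sub>C f l" for l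
    have f'B: "f' l \<in> B" "D (f' l) = l *\<^sub>C f' l" if "l \<in> L" for l
      using Lf(2,3)[OF that] by (auto simp: f'_def mem scale scaleC_scaleC mult.commute)
    define s where "s = (\<Sum>l\<in>L - {m}. f' l)"
    define x' where "x' = x - s"
    have sB: "s \<in> B" unfolding s_def using f'B by (intro sum_mem) auto
    have x'B: "x' \<in> B" unfolding x'_def using sB Suc.prems by (intro mem)
    have Ds: "D s - m *\<^sub>C s = (\<Sum>l\<in>L - {m}. f l)"
    proof -
      have "D s - m *\<^sub>C s = (\<Sum>l\<in>L - {m}. D (f' l)) - m *\<^sub>C s"
        unfolding s_def using f'B by (subst D_sum) auto
      also have "\<dots> = (\<Sum>l\<in>L - {m}. D (f' l) - m *\<^sub>C f' l)"
        by (simp add: s_def scaleC_sum_right sum_subtractf)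
      also have "\<dots> = (\<Sum>l\<in>L - {m}. f l)"
      proof (rule sum.cong[OF refl])
        fix l assume l: "l \<in> L - {m}"
        then have "D (f' l) - m *\<^sub>C f' l = (l - m) *\<^sub>C f' l" using f'B by (simp add: scaleC_diff_left)
        also have "\<dots> = f l" using l by (simp add: f'_def scaleC_scaleC)
        finally show "D (f' l) - m *\<^sub>C f' l = f l" .
      qed
      finally show ?thesis .
    qed
    \<comment> \<open>The component of \<open>(D - m) x\<close> at the eigenvalue m itself, which
      could not be divided by \<open>l - m\<close>. It equals \<open>(D - m) x'\<close> and is
      annihilated by \<open>D - m\<close>, so \<open>semisimple\<close> makes it vanish.\<close>
    define e where "e = (if m \<in> L then f m else 0)"
    have "D x' - m *\<^sub>C x' = (D x - m *\<^sub>C x) - (D s - m *\<^sub>C s)"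
      unfolding x'_def using sB Suc.prems by (simp add: diff scaleC_diff_right)
    also have "\<dots> = e"
      unfolding Ds Lf(4) e_def using Lf(1) by (auto simp: sum.remove)
    finally have x'e: "D x' - m *\<^sub>C x' = e" .
    have "D e = m *\<^sub>C e" using Lf(3) by (auto simp: e_def zero)
    then have Dx': "D x' = m *\<^sub>C x'" using semisimple[OF x'B, of m] x'e by simp
    define g where "g l = (if l = m then x' else f' l)" for l
    have "x = (\<Sum>l\<in>insert m L. g l)"
    proof -
      have "(\<Sum>l\<in>insert m L. g l) = g m + (\<Sum>l\<in>L - {m}. g l)"
        by (rule sum.insert_remove[OF Lf(1)])
      also have "(\<Sum>l\<in>L - {m}. g l) = s" unfolding s_def by (rule sum.cong) (auto simp: g_def)
      finally show ?thesis by (simp add: g_def x'_def)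
    qed
    then show ?case
      using Lf(1) f'B x'B Dx' by (intro exI[of _ "insert m L"] exI[of _ g]) (auto simp: g_def)
  qed
  moreover obtain p where "p \<noteq> 0" "ev p x = 0" using annihilating_polynomial[OF S x] by blast
  ultimately show ?thesis using x by blast
qed

end

section \<open>Calculus for vector-valued functions of a real variable\<close>

lemma has_integral_in_closed_subspace:
  fixes f :: "real \<Rightarrow> 'a::cstar_algebra"
  assumes f: "(f has_integral I) (cbox a b)" and B: "cvs.subspace B" "closed B" and fB: "\<And>x. f x \<in> B"
  shows "I \<in> B"
proof -
  have "\<exists>y\<in>B. dist y I < e" if e: "e > 0" for e
  proof -
    from f[unfolded has_integral, THEN spec, THEN mp, OF e]
    obtain g where gg: "gauge g \<and> (\<forall>D. D tagged_division_of (cbox a b) \<and> g fine D \<longrightarrow>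
        norm ((\<Sum>(x,k)\<in>D. measure lborel k *\<^sub>R f x) - I) < e)"
      by (elim exE)
    then have g: "gauge g" ..
    obtain D where D: "D tagged_division_of (cbox a b)" "g fine D"
      by (rule fine_division_exists[OF g])
    have "(\<Sum>(x,k)\<in>D. measure lborel k *\<^sub>R f x) \<in> B"
    proof (rule cvs.subspace_sum[OF B(1)])
      fix p assume "p \<in> D"
      show "(case p of (x, k) \<Rightarrow> measure lborel k *\<^sub>R f x) \<in> B"
        unfolding split_def scaleC_of_real[symmetric] by (rule cvs.subspace_scale[OF B(1) fB])
    qed
    then show ?thesis using gg D unfolding dist_norm by metis
  qed
  then have "I \<in> closure B" by (simp add: closure_approachable)
  then show ?thesis using B(2) by simp
qed

lemma antiderivative_exists:
  fixes f :: "real \<Rightarrow> 'a::banach"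
  assumes cont: "continuous_on UNIV f"
  obtains J where "J 0 = 0" "\<And>r. (J has_vector_derivative f r) (at r)" "\<And>r. r \<ge> 0 \<Longrightarrow> J r = integral {0..r} f"
proof -
  define J where "J r = (if r \<ge> 0 then integral {0..r} f else - integral {r..0} f)" for r
  have int: "f integrable_on {a..b}" for a b
    by (rule integrable_continuous_real) (rule continuous_on_subset[OF cont], simp)
  \<comment> \<open>A base point a left of both 0 and u puts the two signs of u into one formula, to
    which the fundamental theorem on an interval applies.\<close>
  have J: "J u = integral {a..u} f - integral {a..0} f" if "a \<le> u" "a \<le> 0" for a u
  proof (cases "u \<ge> 0")
    case True
    then show ?thesis using Henstock_Kurzweil_Integration.integral_combine[of a 0 u f] that int by (simp add: J_def algebra_simps)
  next
    case False
    then show ?thesis using Henstock_Kurzweil_Integration.integral_combine[of a u 0 f] that int by (simp add: J_def algebra_simps)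
  qed
  show thesis
  proof (rule that)
    show "J 0 = 0" by (simp add: J_def)
    show "J r = integral {0..r} f" if "r \<ge> 0" for r using that by (simp add: J_def)
    fix r :: real
    define a b where "a = - \<bar>r\<bar> - 1" and "b = \<bar>r\<bar> + 1"
    have ab: "r \<in> {a<..<b}" "a \<le> 0" by (auto simp: a_def b_def)
    have "((\<lambda>u. integral {a..u} f - integral {a..0} f) has_vector_derivative f r - 0) (at r within {a..b})"
      using ab by (intro has_vector_derivative_diff integral_has_vector_derivative has_vector_derivative_const
          continuous_on_subset[OF cont]) auto
    then have "((\<lambda>u. integral {a..u} f - integral {a..0} f) has_vector_derivative f r) (at r)"
      using ab at_within_Icc_at[of a r b] by simp
    then show "(J has_vector_derivative f r) (at r)"
      by (rule has_vector_derivative_transform_within_open[of _ _ _ "{a<..<b}"])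
         (use ab in \<open>auto simp: J[of a]\<close>)
  qed
qed

lemma has_vector_derivative_zero_imp_eq:
  fixes f :: "real \<Rightarrow> 'a::real_normed_vector"
  assumes "\<And>r. (f has_vector_derivative 0) (at r)"
  shows "f r = f 0"
proof -
  obtain c where "\<And>x. x \<in> UNIV \<Longrightarrow> f x = c"
    by (rule has_vector_derivative_zero_constant[of UNIV f]) (use assms in auto)
  then show ?thesis by simp
qed

lemma has_vector_derivative_iff_quotient:
  fixes f :: "real \<Rightarrow> 'a::real_normed_vector"
  shows "(f has_vector_derivative d) (at r) \<longleftrightarrow> ((\<lambda>h. (1 / h) *\<^sub>R (f (r + h) - f r)) \<longlongrightarrow> d) (at 0)"
proof -
  \<comment> \<open>At h = 0 both sides are 0, since division by zero yields 0; hence the case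
    distinction around d.\<close>
  have e: "(\<lambda>h. norm (f (r + h) - f r - h *\<^sub>R d) / norm h) = (\<lambda>h. norm ((1 / h) *\<^sub>R (f (r + h) - f r) - (if h = 0 then 0 else d)))"
  proof
    fix h :: real
    show "norm (f (r + h) - f r - h *\<^sub>R d) / norm h = norm ((1 / h) *\<^sub>R (f (r + h) - f r) - (if h = 0 then 0 else d))"
    proof (cases "h = 0")
      case False
      then have "(1 / h) *\<^sub>R (f (r + h) - f r) - d = (1 / h) *\<^sub>R (f (r + h) - f r - h *\<^sub>R d)"
        by (simp add: scaleR_diff_right)
      then show ?thesis using False by (simp add: divide_inverse_commute)
    qed simp
  qed
  have "(f has_vector_derivative d) (at r) \<longleftrightarrow> (\<lambda>h. norm (f (r + h) - f r - h *\<^sub>R d) / norm h) \<midarrow>0\<rightarrow> 0"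
    unfolding has_vector_derivative_def has_derivative_at by (simp add: bounded_linear_scaleR_left)
  also have "\<dots> \<longleftrightarrow> (\<lambda>h. norm ((1 / h) *\<^sub>R (f (r + h) - f r) - d)) \<midarrow>0\<rightarrow> 0"
    unfolding e by (rule filterlim_cong) (auto simp: eventually_at_filter)
  also have "\<dots> \<longleftrightarrow> ((\<lambda>h. (1 / h) *\<^sub>R (f (r + h) - f r)) \<longlongrightarrow> d) (at 0)"
    by (simp add: tendsto_norm_zero_iff LIM_zero_iff)
  finally show ?thesis .
qed

text \<open>Flows satisfy this, and so does multiplication by a continuous character of the reals;
  the eigenvector theorem below is applied to both.\<close>

locale isometry_group =
  fixes W :: "real \<Rightarrow> 'a::cstar_algebra \<Rightarrow> 'a"
  assumes W_add: "W r (x + y) = W r x + W r y"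
    and W_scale: "W r (c *\<^sub>C x) = c *\<^sub>C W r x"
    and W_group: "W (r + s) x = W r (W s x)"
    and W_0: "W 0 x = x"
    and W_norm: "norm (W r x) = norm x"
    and W_cont: "continuous_on UNIV (\<lambda>r. W r x)"
begin

lemma W_bounded_linear: "bounded_linear (W r)"
  by (rule bounded_linear_intro[of _ 1])
     (simp_all only: W_add W_scale scaleC_of_real[symmetric] W_norm mult_1_right order_refl)

lemma W_diff: "W r (x - y) = W r x - W r y"
  using bounded_linear.linear[OF W_bounded_linear] by (rule linear_diff)

lemma W_scaleR: "W r (a *\<^sub>R x) = a *\<^sub>R W r x"
  using bounded_linear.linear[OF W_bounded_linear] by (rule linear_scale)

definition gen :: "'a \<Rightarrow> 'a \<Rightarrow> bool" where
  "gen x y \<longleftrightarrow> ((\<lambda>h. (1 / h) *\<^sub>R (W h x - x)) \<longlongrightarrow> y) (at 0)"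

lemma gen_derivative:
  assumes "gen x y"
  shows "((\<lambda>r. W r x) has_vector_derivative W r y) (at r)"
proof -
  have "((\<lambda>h. W r ((1 / h) *\<^sub>R (W h x - x))) \<longlongrightarrow> W r y) (at 0)"
    using assms unfolding gen_def by (rule bounded_linear.tendsto[OF W_bounded_linear])
  then show ?thesis
    unfolding has_vector_derivative_iff_quotient by (simp add: W_scaleR W_diff W_group)
qed

lemma gen_iff: "gen x y \<longleftrightarrow> ((\<lambda>r. W r x) has_vector_derivative y) (at 0)"
  unfolding has_vector_derivative_iff_quotient gen_def by (simp add: W_0)

lemma gen_add: "gen x y \<Longrightarrow> gen x' y' \<Longrightarrow> gen (x + x') (y + y')"
  unfolding gen_iff W_add by (rule has_vector_derivative_add)

lemma gen_scale: "gen x y \<Longrightarrow> gen (c *\<^sub>C x) (c *\<^sub>C y)"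
  unfolding gen_iff W_scale
  by (rule bounded_linear.has_vector_derivative[OF bounded_bilinear.bounded_linear_right[OF bounded_bilinear_scaleC]])

lemma gen_0: "gen 0 0"
  using W_scale[of _ 0 0] by (simp add: gen_def)

lemma gen_unique: "gen x y \<Longrightarrow> gen x z \<Longrightarrow> y = z"
  unfolding gen_def by (rule tendsto_unique[OF trivial_limit_at])

lemma exp_W_derivative:
  assumes g: "gen x y"
  shows "((\<lambda>r. exp (- l * of_real r) *\<^sub>C W r x) has_vector_derivative exp (- l * of_real r) *\<^sub>C W r (y - l *\<^sub>C x)) (at r)"
proof -
  have "((\<lambda>r. exp (- l * of_real r)) has_vector_derivative - l * exp (- l * of_real r)) (at r)"
  proof -
    have "((\<lambda>z. exp (- l * z)) has_field_derivative - l * exp (- l * of_real r)) (at (of_real r))"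
      by (auto intro!: derivative_eq_intros)
    then show ?thesis
      using field_vector_diff_chain_at[of of_real 1 r "\<lambda>z. exp (- l * z)" "- l * exp (- l * of_real r)"]
        has_vector_derivative_of_real[OF DERIV_ident[of "at r"], where 'a=complex] by (simp add: o_def)
  qed
  then have "((\<lambda>r. exp (- l * of_real r) *\<^sub>C W r x) has_vector_derivative
      exp (- l * of_real r) *\<^sub>C W r y + (- l * exp (- l * of_real r)) *\<^sub>C W r x) (at r)"
    by (rule bounded_bilinear.has_vector_derivative[OF bounded_bilinear_scaleC]) (rule gen_derivative[OF g])
  then show ?thesis
    by (simp add: W_diff W_scale scaleC_diff_right scaleC_scaleC mult.commute)
qed

lemma eigenvector_exp:
  assumes "gen x (l *\<^sub>C x)"
  shows "W r x = exp (l * of_real r) *\<^sub>C x"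
proof -
  have "exp (- l * of_real r) *\<^sub>C W r x = exp (- l * of_real 0) *\<^sub>C W 0 x"
    by (rule has_vector_derivative_zero_imp_eq[where f = "\<lambda>r. exp (- l * of_real r) *\<^sub>C W r x"])
       (use exp_W_derivative[OF assms, of l] W_scale[of _ 0 0] in simp)
  then have "exp (l * of_real r) *\<^sub>C exp (- l * of_real r) *\<^sub>C W r x = exp (l * of_real r) *\<^sub>C x"
    by (simp add: W_0)
  then show ?thesis by (simp add: scaleC_scaleC exp_minus)
qed

lemma eigenvalue_imaginary:
  assumes "gen x (l *\<^sub>C x)" "x \<noteq> 0"
  shows "Re l = 0"
proof -
  have "norm (exp (l * of_real 1) *\<^sub>C x) = norm x" using eigenvector_exp[OF assms(1), of 1] W_norm by metis
  then show ?thesis using assms(2) by (simp add: norm_scaleC norm_exp_eq_Re)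
qed

text \<open>A generalised eigenvector would grow linearly: with \<open>u = y - l *\<^sub>C v\<close>
  the vector \<open>exp (- l r) W r v\<close> is \<open>v + r u\<close>, yet its norm is constant in
  r because l is imaginary.\<close>

lemma generator_semisimple:
  assumes v: "gen v y" and w: "gen (y - l *\<^sub>C v) (l *\<^sub>C (y - l *\<^sub>C v))"
  shows "y = l *\<^sub>C v"
proof (rule ccontr)
  define u where "u = y - l *\<^sub>C v"
  assume "y \<noteq> l *\<^sub>C v"
  then have u0: "u \<noteq> 0" by (simp add: u_def)
  have w: "gen u (l *\<^sub>C u)" using w by (simp add: u_def)
  have Re: "Re l = 0" by (rule eigenvalue_imaginary[OF w u0])
  have "exp (- l * of_real r) *\<^sub>C W r v - r *\<^sub>R u = exp (- l * of_real 0) *\<^sub>C W 0 v - 0 *\<^sub>R u" for r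
  proof (rule has_vector_derivative_zero_imp_eq[where f = "\<lambda>r. exp (- l * of_real r) *\<^sub>C W r v - r *\<^sub>R u"])
    fix r
    have "exp (- l * of_real r) *\<^sub>C W r u = u"
      unfolding eigenvector_exp[OF w] by (simp add: scaleC_scaleC exp_minus)
    then show "((\<lambda>r. exp (- l * of_real r) *\<^sub>C W r v - r *\<^sub>R u) has_vector_derivative 0) (at r)"
      using has_vector_derivative_diff[OF exp_W_derivative[OF v, of l r]
          has_vector_derivative_scaleR[OF DERIV_ident has_vector_derivative_const, of u r UNIV]]
      by (simp add: u_def)
  qed
  then have e: "exp (- l * of_real r) *\<^sub>C W r v = v + r *\<^sub>R u" for r
    by (simp add: W_0 algebra_simps)
  have "norm (v + r *\<^sub>R u) = norm v" for r
    unfolding e[symmetric] norm_scaleC W_norm norm_exp_eq_Re using Re by simp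
  then have "\<bar>r\<bar> * norm u \<le> 2 * norm v" for r
    using norm_triangle_ineq4[of "v + r *\<^sub>R u" v] by simp
  from this[of "(2 * norm v + 1) / norm u"] show False using u0 by simp
qed

text \<open>On a finite-dimensional invariant subspace the group is automatically differentiable,
  and the generator of a group of isometries has imaginary eigenvalues and no Jordan blocks.\<close>

lemma finite_dimensional_eigenvectors:
  assumes S: "finite S" "B = cvs.span S" and inv: "\<And>r x. x \<in> B \<Longrightarrow> W r x \<in> B" and x: "x \<in> B"
  shows "\<exists>L f. finite L \<and> (\<forall>m\<in>L. f m \<in> B \<and> (\<forall>r. W r (f m) = exp (\<i> * of_real (m * r)) *\<^sub>C f m)) \<and> x = (\<Sum>m\<in>(L::real set). f m)"
proof -
  have sub: "cvs.subspace B" and clB: "closed B" using S closed_span_finite by (simp_all add: cvs.subspace_span)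
  \<comment> \<open>The differentiable vectors of B form a subspace of a finite-dimensional space,
    hence a closed one. The averages \<open>(1 / h) *\<^sub>R J h\<close> of the orbit of x lie in
    it and tend to x, so it is all of B.\<close>
  define B0 where "B0 = {x \<in> B. \<exists>y. gen x y}"
  have "cvs.subspace B0"
    unfolding B0_def cvs.subspace_def using sub gen_0 gen_add gen_scale
    by (auto simp: cvs.subspace_0 cvs.subspace_add cvs.subspace_scale; blast)
  moreover have "B0 \<subseteq> cvs.span S" by (auto simp: B0_def S)
  ultimately have clB0: "closed B0"
    using subspace_of_span_finite[OF _ _ S(1)] closed_span_finite by metis
  have B0: "\<exists>y. gen x y" if x: "x \<in> B" for x
  proof -
    obtain J where J: "J 0 = 0" "\<And>r. (J has_vector_derivative W r x) (at r)" "\<And>r. r \<ge> 0 \<Longrightarrow> J r = integral {0..r} (\<lambda>r. W r x)"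
      using antiderivative_exists[OF W_cont[of x]] by blast
    have JB: "J r \<in> B" if "r \<ge> 0" for r
    proof (rule has_integral_in_closed_subspace[OF _ sub clB inv[OF x]])
      have "(\<lambda>r. W r x) integrable_on {0..r}"
        by (rule integrable_continuous_real) (rule continuous_on_subset[OF W_cont], simp)
      then show "((\<lambda>r. W r x) has_integral J r) (cbox 0 r)"
        using J(3)[OF that] by (simp add: has_integral_integral)
    qed
    have shift: "W h (J r) = J (h + r) - J h" for h r
    proof -
      have "W h (J r) - J (h + r) = W h (J 0) - J (h + 0)"
      proof (rule has_vector_derivative_zero_imp_eq[where f = "\<lambda>r. W h (J r) - J (h + r)"])
        fix r
        have "((\<lambda>r. J (h + r)) has_vector_derivative 1 *\<^sub>R W (h + r) x) (at r)"
          using vector_diff_chain_at[of "\<lambda>r. h + r" 1 r J "W (h + r) x"] J(2)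
            has_vector_derivative_add[OF has_vector_derivative_const[of h] has_vector_derivative_id[of "at r"]]
          by (simp add: o_def)
        moreover have "((\<lambda>r. W h (J r)) has_vector_derivative W h (W r x)) (at r)"
          by (rule bounded_linear.has_vector_derivative[OF W_bounded_linear J(2)])
        ultimately show "((\<lambda>r. W h (J r) - J (h + r)) has_vector_derivative 0) (at r)"
          using has_vector_derivative_diff[of "\<lambda>r. W h (J r)" "W h (W r x)" "at r" "\<lambda>r. J (h + r)" "W h (W r x)"]
          by (simp add: W_group)
      qed
      then show ?thesis using W_scale[of h 0 0] J(1) by (simp add: algebra_simps)
    qed
    have genJ: "gen (J r) (W r x - W 0 x)" for r
    proof -
      have "((\<lambda>h. (1 / h) *\<^sub>R (J (r + h) - J r) - (1 / h) *\<^sub>R (J (0 + h) - J 0)) \<longlongrightarrow> W r x - W 0 x) (at 0)"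
        using J(2)[of r] J(2)[of 0] unfolding has_vector_derivative_iff_quotient by (rule tendsto_diff)
      moreover have "(1 / h) *\<^sub>R (J (r + h) - J r) - (1 / h) *\<^sub>R (J (0 + h) - J 0) = (1 / h) *\<^sub>R (W h (J r) - J r)" for h
        unfolding scaleR_diff_right[symmetric] shift J(1) by (simp add: add.commute)
      ultimately show ?thesis unfolding gen_def by simp
    qed
    have "((\<lambda>h. (1 / h) *\<^sub>R (J (0 + h) - J 0)) \<longlongrightarrow> W 0 x) (at 0)"
      using J(2)[of 0] unfolding has_vector_derivative_iff_quotient .
    then have "((\<lambda>h. (1 / h) *\<^sub>R J h) \<longlongrightarrow> x) (at_right 0)"
      using tendsto_mono[OF at_le[of "{0<..}" UNIV "0::real"], of "\<lambda>h. (1 / h) *\<^sub>R J h" x]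
      by (simp add: W_0 J(1))
    moreover have "\<forall>\<^sub>F h in at_right 0. (1 / h) *\<^sub>R J h \<in> B0"
    proof (rule eventually_mono[OF eventually_at_right_less])
      fix h :: real assume "0 < h"
      then have "J h \<in> B0" using JB genJ by (auto simp: B0_def)
      then show "(1 / h) *\<^sub>R J h \<in> B0"
        using \<open>cvs.subspace B0\<close> by (simp add: cvs.subspace_scale scaleC_of_real[symmetric])
    qed
    ultimately have "x \<in> B0" by (intro Lim_in_closed_set[OF clB0 _ trivial_limit_at_right_real])
    then show ?thesis by (simp add: B0_def)
  qed
  define D where "D x = (SOME y. gen x y)" for x
  have D: "gen x (D x)" if "x \<in> B" for x unfolding D_def using B0[OF that] by (rule someI_ex)
  interpret linear_operator_on B D
  proof
    show "cvs.subspace B" by fact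
    fix x assume x: "x \<in> B"
    have "\<forall>\<^sub>F h in at 0. (1 / h) *\<^sub>R (W h x - x) \<in> B"
      using x inv sub by (intro always_eventually allI) (simp add: scaleC_of_real[symmetric] cvs.subspace_scale cvs.subspace_diff)
    then show "D x \<in> B"
      using D[OF x] unfolding gen_def by (rule Lim_in_closed_set[OF clB _ trivial_limit_at])
    show "D (c *\<^sub>C x) = c *\<^sub>C D x" for c
      by (rule gen_unique[OF D gen_scale[OF D]]) (use x sub in \<open>auto simp: cvs.subspace_scale\<close>)
    show "D (x + y) = D x + D y" if "y \<in> B" for y
      by (rule gen_unique[OF D gen_add[OF D D]]) (use x that sub in \<open>auto simp: cvs.subspace_add\<close>)
  qed
  have "D v = l *\<^sub>C v" if v: "v \<in> B" and e: "D (D v - l *\<^sub>C v) = l *\<^sub>C (D v - l *\<^sub>C v)" for v l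
  proof (rule generator_semisimple[OF D[OF v]])
    have "D v - l *\<^sub>C v \<in> B" using v by (intro mem maps)
    then show "gen (D v - l *\<^sub>C v) (l *\<^sub>C (D v - l *\<^sub>C v))" using D e by metis
  qed
  then obtain L f where Lf: "finite L" "\<And>l. l \<in> L \<Longrightarrow> f l \<in> B" "\<And>l. l \<in> L \<Longrightarrow> D (f l) = l *\<^sub>C f l" "x = (\<Sum>l\<in>L. f l)"
    using eigenvector_decomposition[OF S x] by blast
  \<comment> \<open>Zero components are dropped because only a nonzero eigenvector forces its
    eigenvalue to be imaginary; \<open>Im\<close> is then injective and can serve as the
    index.\<close>
  define L0 where "L0 = {l \<in> L. f l \<noteq> 0}"
  have gl: "gen (f l) (l *\<^sub>C f l)" if "l \<in> L" for l using D Lf(2,3)[OF that] by metis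
  have im: "l = \<i> * of_real (Im l)" if "l \<in> L0" for l
    using eigenvalue_imaginary[OF gl, of l] that by (auto simp: L0_def complex_eq_iff)
  have inj: "inj_on Im L0" by (rule inj_onI) (metis im)
  have "x = (\<Sum>l\<in>L0. f l)"
    unfolding Lf(4) L0_def using Lf(1) by (intro sum.mono_neutral_right) auto
  also have "\<dots> = (\<Sum>l\<in>L0. f (\<i> * of_real (Im l)))" using im by (intro sum.cong) auto
  also have "\<dots> = (\<Sum>m\<in>Im ` L0. f (\<i> * of_real m))" by (simp add: sum.reindex[OF inj])
  finally have "x = (\<Sum>m\<in>Im ` L0. f (\<i> * of_real m))" .
  moreover have "f (\<i> * of_real m) \<in> B \<and> (\<forall>r. W r (f (\<i> * of_real m)) = exp (\<i> * of_real (m * r)) *\<^sub>C f (\<i> * of_real m))"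
    if m: "m \<in> Im ` L0" for m
  proof -
    obtain l where l: "l \<in> L0" "m = Im l" using m by blast
    then have lm: "\<i> * of_real m = l" using im by simp
    have lL: "l \<in> L" using l by (simp add: L0_def)
    show ?thesis unfolding lm using Lf(2)[OF lL] eigenvector_exp[OF gl[OF lL]]
      by (simp add: lm[symmetric] mult.assoc)
  qed
  moreover have "finite (Im ` L0)" using Lf(1) by (simp add: L0_def)
  ultimately show ?thesis by (intro exI[of _ "Im ` L0"] exI[of _ "\<lambda>m. f (\<i> * of_real m)"]) blast
qed

end

section \<open>Flows and their eigenvectors\<close>

lemma flowD:
  assumes "flow \<alpha>"
  shows "star_aut (\<alpha> t)" "\<alpha> 0 x = x" "\<alpha> (s + t) x = \<alpha> s (\<alpha> t x)" "continuous_on UNIV (\<lambda>t. \<alpha> t x)"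
    "\<alpha> t (\<alpha> (- t) x) = x" "\<alpha> (- t) (\<alpha> t x) = x" "norm (\<alpha> t x) = norm x"
proof -
  show *: "star_aut (\<alpha> t)" "\<And>x. \<alpha> 0 x = x" "\<And>s t x. \<alpha> (s + t) x = \<alpha> s (\<alpha> t x)" "continuous_on UNIV (\<lambda>t. \<alpha> t x)"
    using assms by (auto simp: flow_def)
  show "\<alpha> t (\<alpha> (- t) x) = x" "\<alpha> (- t) (\<alpha> t x) = x"
    using *(3)[of t "-t" x] *(3)[of "-t" t x] *(2) by simp_all
  show "norm (\<alpha> t x) = norm x" by (rule norm_star_aut[OF *(1)])
qed

lemmas flow_simps = star_autD(2-10)[OF flowD(1)]

lemma isometry_group_flow: "flow \<alpha> \<Longrightarrow> isometry_group \<alpha>"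
  by unfold_locales (simp_all only: flowD(2,3,4,7) flow_simps)

definition eigenvector :: "(real \<Rightarrow> 'a::cstar_algebra \<Rightarrow> 'a) \<Rightarrow> real \<Rightarrow> 'a \<Rightarrow> bool" where
  "eigenvector \<alpha> m e \<longleftrightarrow> (\<forall>r. \<alpha> r e = exp (\<i> * of_real (m * r)) *\<^sub>C e)"

text \<open>These sums serve as analytic elements: the orbit of an eigenvector of frequency m
  extends to complex time as \<open>exp (i m z) e\<close>. For an AF flow they are dense.\<close>

definition eigen_sums :: "(real \<Rightarrow> 'a::cstar_algebra \<Rightarrow> 'a) \<Rightarrow> 'a set" where
  "eigen_sums \<alpha> = {\<Sum>m\<in>L. f m | L f. finite (L::real set) \<and> (\<forall>m\<in>L. eigenvector \<alpha> m (f m))}"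

lemma eigenvector_0_iff: "eigenvector \<alpha> 0 e \<longleftrightarrow> (\<forall>r. \<alpha> r e = e)"
  by (simp add: eigenvector_def)

lemma eigenvector_cstar_mult:
  assumes \<alpha>: "flow \<alpha>" and "eigenvector \<alpha> m e" "eigenvector \<alpha> n f"
  shows "eigenvector \<alpha> (n - m) (cstar e * f)"
  unfolding eigenvector_def
proof
  fix r
  have "\<alpha> r (cstar e * f) = (exp (- \<i> * of_real (m * r)) * exp (\<i> * of_real (n * r))) *\<^sub>C (cstar e * f)"
    using assms(2,3)
    by (simp add: eigenvector_def flow_simps[OF \<alpha>] cstar_scaleC scaleC_mult_left scaleC_mult_right scaleC_scaleC
        exp_cnj mult.commute)
  also have "exp (- \<i> * of_real (m * r)) * exp (\<i> * of_real (n * r)) = exp (\<i> * of_real ((n - m) * r))"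
    by (simp only: exp_add[symmetric]) (simp add: algebra_simps)
  finally show "\<alpha> r (cstar e * f) = exp (\<i> * of_real ((n - m) * r)) *\<^sub>C (cstar e * f)" .
qed

lemma fd_invariant_eigenvectors:
  assumes \<alpha>: "flow \<alpha>" and B: "fd_star_subalgebra B" "\<And>t. \<alpha> t ` B \<subseteq> B" and x: "x \<in> B"
  obtains L f where "finite L" "\<forall>m\<in>L. f m \<in> B" "\<forall>m\<in>L. eigenvector \<alpha> m (f m)" "x = (\<Sum>m\<in>(L::real set). f m)"
proof -
  interpret isometry_group \<alpha> by (rule isometry_group_flow[OF \<alpha>])
  obtain S where S: "finite S" "B = cvs.span S"
    using B(1) unfolding fd_star_subalgebra_def cspan_eq_span by blast
  have inv: "\<alpha> r y \<in> B" if "y \<in> B" for r y using B(2) that by blast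
  have "\<exists>L f. finite (L::real set) \<and> (\<forall>m\<in>L. f m \<in> B \<and> (\<forall>r. \<alpha> r (f m) = exp (\<i> * of_real (m * r)) *\<^sub>C f m)) \<and> x = (\<Sum>m\<in>L. f m)"
    by (rule finite_dimensional_eigenvectors[OF S _ x]) (rule inv)
  then obtain L f where "finite (L::real set) \<and> (\<forall>m\<in>L. f m \<in> B \<and> (\<forall>r. \<alpha> r (f m) = exp (\<i> * of_real (m * r)) *\<^sub>C f m)) \<and> x = (\<Sum>m\<in>L. f m)"
    by (elim exE)
  then show thesis by (intro that[of L f]) (auto simp: eigenvector_def)
qed

lemma AF_flowE:
  fixes \<alpha> :: "real \<Rightarrow> 'a::cstar_algebra \<Rightarrow> 'a"
  assumes "AF_flow \<alpha>"
  obtains An :: "nat \<Rightarrow> 'a set" where "\<forall>n. fd_star_subalgebra (An n)" "\<forall>n t. \<alpha> t ` An n \<subseteq> An n"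
    "closure (\<Union>n. An n) = UNIV" "flow \<alpha>"
proof -
  have "\<exists>An :: nat \<Rightarrow> 'a set. (\<forall>n. fd_star_subalgebra (An n)) \<and> incseq An \<and> (\<forall>n t. \<alpha> t ` An n \<subseteq> An n) \<and> closure (\<Union>n. An n) = UNIV"
    and fl: "flow \<alpha>"
    using assms by (simp_all only: AF_flow_def)
  then obtain An :: "nat \<Rightarrow> 'a set" where "(\<forall>n. fd_star_subalgebra (An n)) \<and> incseq An \<and> (\<forall>n t. \<alpha> t ` An n \<subseteq> An n) \<and> closure (\<Union>n. An n) = UNIV"
    by (elim exE)
  with fl show thesis by (intro that[of An]) simp_all
qed

lemma AF_flow_eigen_sums_dense:
  fixes \<alpha> :: "real \<Rightarrow> 'a::cstar_algebra \<Rightarrow> 'a"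
  assumes "AF_flow \<alpha>"
  shows "closure (eigen_sums \<alpha>) = UNIV"
proof -
  obtain An :: "nat \<Rightarrow> 'a set" where An0: "\<forall>n. fd_star_subalgebra (An n)" "\<forall>n t. \<alpha> t ` An n \<subseteq> An n" "closure (\<Union>n. An n) = UNIV"
    and \<alpha>: "flow \<alpha>"
    by (rule AF_flowE[OF assms])
  note An = An0[rule_format]
  have "An n \<subseteq> eigen_sums \<alpha>" for n
  proof
    fix x assume x: "x \<in> An n"
    show "x \<in> eigen_sums \<alpha>"
      by (rule fd_invariant_eigenvectors[OF \<alpha> An(1) An(2) x]) (auto simp: eigen_sums_def)
  qed
  then have "closure (\<Union>n. An n) \<subseteq> closure (eigen_sums \<alpha>)" by (intro closure_mono) blast
  then show ?thesis using An(3) by blast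
qed

section \<open>Invariant projections\<close>

definition projection :: "'a::cstar_algebra \<Rightarrow> bool" where
  "projection p \<longleftrightarrow> cstar p = p \<and> p * p = p"

text \<open>Left multiplication by a selfadjoint a has no Jordan blocks: a non-real l forces
  \<open>w = 0\<close> at once, and for real l the element \<open>cstar w * w\<close> equals
  \<open>cstar v * (a * w - l *\<^sub>C w)\<close>, which is 0.\<close>

lemma selfadjoint_mult_semisimple:
  fixes a :: "'a::cstar_algebra"
  assumes a: "cstar a = a" and e: "a * w = l *\<^sub>C w" and w: "w = a * v - l *\<^sub>C v"
  shows "w = 0"
proof -
  have "cstar w * (a * w) = cstar (a * w) * w" by (simp add: cstar_mult a mult.assoc)
  then have "l *\<^sub>C (cstar w * w) = cnj l *\<^sub>C (cstar w * w)"
    unfolding e by (simp add: cstar_scaleC scaleC_mult_left scaleC_mult_right)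
  then have "(l - cnj l) *\<^sub>C (cstar w * w) = 0" by (simp add: scaleC_diff_left)
  then consider "l = cnj l" | "w = 0" by auto
  then show ?thesis
  proof cases
    case 1
    have "cstar w = cstar v * a - l *\<^sub>C cstar v"
      unfolding w by (simp add: cstar_diff cstar_mult a cstar_scaleC 1[symmetric])
    then have "cstar w * w = cstar v * (a * w) - l *\<^sub>C (cstar v * w)"
      by (simp add: left_diff_distrib scaleC_mult_left mult.assoc)
    also have "\<dots> = 0" unfolding e by (simp add: scaleC_mult_right)
    finally show ?thesis by simp
  qed
qed

text \<open>Left multiplication by a acts on the fixed-point algebra of the finite-dimensional B.
  When the vector a itself is decomposed into eigenvectors, selfadjointness makes the components
  mutually orthogonal multiples of projections.\<close>

lemma invariant_spectral_decomposition:
  fixes a :: "'a::cstar_algebra"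
  assumes \<alpha>: "flow \<alpha>" and B: "fd_star_subalgebra B" and aB: "a \<in> B" and a: "cstar a = a" and inv: "\<And>r. \<alpha> r a = a"
  obtains L p where "finite L" "\<forall>m\<in>L. projection (p m)" "\<forall>m\<in>L. \<forall>r. \<alpha> r (p m) = p m"
    "\<forall>m\<in>L. p m * a * p m = m *\<^sub>R p m" "a = (\<Sum>m\<in>(L::real set). m *\<^sub>R p m)"
proof -
  obtain S where S: "finite S" "B = cvs.span S"
    using B unfolding fd_star_subalgebra_def cspan_eq_span by blast
  have subB: "cvs.subspace B" and multB: "\<And>x y. x \<in> B \<Longrightarrow> y \<in> B \<Longrightarrow> x * y \<in> B"
    using B by (auto simp: fd_star_subalgebra_def star_subalgebra_def csubspace_iff_subspace)
  \<comment> \<open>Working inside the fixed elements of B makes the spectral projections invariant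
    automatically.\<close>
  define C where "C = {x \<in> B. \<forall>r. \<alpha> r x = x}"
  have subC: "cvs.subspace C"
    unfolding C_def cvs.subspace_def using subB
    by (simp add: flow_simps[OF \<alpha>] cvs.subspace_0 cvs.subspace_add cvs.subspace_scale)
  then obtain S' where S': "finite S'" "C = cvs.span S'"
    by (rule subspace_of_span_finite[OF _ _ S(1)]) (auto simp: C_def S(2))
  interpret linear_operator_on C "\<lambda>x. a * x"
    using subC aB multB inv
    by unfold_locales (auto simp: C_def distrib_left scaleC_mult_right flow_simps[OF \<alpha>])
  have aC: "a \<in> C" using aB inv by (simp add: C_def)
  have ss: "a * v = l *\<^sub>C v" if "a * (a * v - l *\<^sub>C v) = l *\<^sub>C (a * v - l *\<^sub>C v)" for v l
    using selfadjoint_mult_semisimple[OF a that refl] by simp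
  have "\<exists>L y. finite L \<and> (\<forall>l\<in>L. y l \<in> C \<and> a * y l = l *\<^sub>C y l) \<and> a = (\<Sum>l\<in>L. y l)"
    by (rule eigenvector_decomposition[OF S' aC]) (rule ss)
  then obtain L y where Ly: "finite L \<and> (\<forall>l\<in>L. y l \<in> C \<and> a * y l = l *\<^sub>C y l) \<and> a = (\<Sum>l\<in>L. y l)"
    by (elim exE)
  define L0 where "L0 = {l \<in> L. y l \<noteq> 0}"
  have L0: "finite L0" "a = (\<Sum>l\<in>L0. y l)" and y: "\<And>l. l \<in> L0 \<Longrightarrow> y l \<in> C" "\<And>l. l \<in> L0 \<Longrightarrow> a * y l = l *\<^sub>C y l" "\<And>l. l \<in> L0 \<Longrightarrow> y l \<noteq> 0"
  proof -
    show "finite L0" "\<And>l. l \<in> L0 \<Longrightarrow> y l \<in> C" "\<And>l. l \<in> L0 \<Longrightarrow> a * y l = l *\<^sub>C y l" "\<And>l. l \<in> L0 \<Longrightarrow> y l \<noteq> 0"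
      using Ly by (auto simp: L0_def)
    have "(\<Sum>l\<in>L. y l) = (\<Sum>l\<in>L0. y l)"
      unfolding L0_def using Ly by (intro sum.mono_neutral_right) auto
    then show "a = (\<Sum>l\<in>L0. y l)" using Ly by simp
  qed
  have flip: "m *\<^sub>C (cstar (y l) * y m) = cnj l *\<^sub>C (cstar (y l) * y m)" if "l \<in> L0" "m \<in> L0" for l m
  proof -
    have "cstar (y l) * (a * y m) = cstar (a * y l) * y m" by (simp add: cstar_mult a mult.assoc)
    then show ?thesis
      unfolding y(2)[OF that(1)] y(2)[OF that(2)] by (simp add: cstar_scaleC scaleC_mult_left scaleC_mult_right)
  qed
  have real: "cnj l = l" if "l \<in> L0" for l
  proof -
    have "(l - cnj l) *\<^sub>C (cstar (y l) * y l) = 0" using flip[OF that that] by (simp add: scaleC_diff_left)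
    then show ?thesis using y(3)[OF that] by simp
  qed
  have orth: "cstar (y l) * y m = 0" if "l \<in> L0" "m \<in> L0" "l \<noteq> m" for l m
  proof -
    have "(m - l) *\<^sub>C (cstar (y l) * y m) = 0"
      using flip[OF that(1,2)] real[OF that(1)] by (simp add: scaleC_diff_left)
    then show ?thesis using that(3) by simp
  qed
  have sq: "cstar (y m) * y m = m *\<^sub>C y m" if m: "m \<in> L0" for m
  proof -
    have "m *\<^sub>C y m = cstar a * y m" using y(2)[OF m] a by simp
    also have "\<dots> = (\<Sum>l\<in>L0. cstar (y l) * y m)"
      by (subst L0(2)) (simp add: cstar_sum sum_distrib_right)
    also have "\<dots> = (\<Sum>l\<in>{m}. cstar (y l) * y m)"
      using L0(1) m orth by (intro sum.mono_neutral_right) auto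
    finally show ?thesis by simp
  qed
  have nz: "m \<noteq> 0" if m: "m \<in> L0" for m
    using sq[OF m] y(3)[OF m] by auto
  have Im0: "of_real (Re m) = m" if "m \<in> L0" for m
    using real[OF that] by (metis Reals_cnj_iff of_real_Re)
  have sa: "cstar (y m) = y m" if m: "m \<in> L0" for m
  proof -
    have "cstar (cstar (y m) * y m) = cstar (y m) * y m" by (simp add: cstar_mult)
    then have "m *\<^sub>C cstar (y m) = m *\<^sub>C y m"
      unfolding sq[OF m] by (simp only: cstar_scaleC real[OF m])
    then have "m *\<^sub>C (cstar (y m) - y m) = 0" by (simp add: scaleC_diff_right)
    then show ?thesis using nz[OF m] by simp
  qed
  \<comment> \<open>From \<open>cstar (y m) * y m = m *\<^sub>C y m\<close> it followed that m
    \<noteq> 0 and that \<open>y m\<close> is selfadjoint, so \<open>y m\<close> is m times a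
    projection.\<close>
  define p where "p r = (1 / complex_of_real r) *\<^sub>C y (of_real r)" for r :: real
  have pm: "p (Re m) = (1 / m) *\<^sub>C y m" if "m \<in> L0" for m
    by (simp add: p_def Im0[OF that])
  have inj: "inj_on Re L0" by (rule inj_onI) (metis Im0)
  show thesis
  proof (rule that[of "Re ` L0" p])
    show "finite (Re ` L0)" using L0 by simp
    have "a = (\<Sum>l\<in>L0. Re l *\<^sub>R p (Re l))"
      by (subst L0(2), rule sum.cong) (simp_all add: pm scaleC_of_real[symmetric] Im0 scaleC_scaleC nz)
    also have "\<dots> = (\<Sum>m\<in>Re ` L0. m *\<^sub>R p m)" by (simp add: sum.reindex[OF inj])
    finally show "a = (\<Sum>m\<in>Re ` L0. m *\<^sub>R p m)" .
    have main: "projection (p r) \<and> (\<forall>s. \<alpha> s (p r) = p r) \<and> p r * a * p r = r *\<^sub>R p r" if r: "r \<in> Re ` L0" for r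
    proof -
      obtain m where m: "m \<in> L0" "r = Re m" using r by blast
      have cs: "cstar (p r) = p r"
        by (simp add: m pm cstar_scaleC sa real)
      have "y m * y m = m *\<^sub>C y m" using sq[OF m(1)] sa[OF m(1)] by simp
      then have pp: "p r * p r = p r"
        using nz[OF m(1)] by (simp add: m pm scaleC_mult_left scaleC_mult_right scaleC_scaleC)
      have "projection (p r)" using cs pp by (simp add: projection_def)
      moreover have "\<alpha> s (p r) = p r" for s using y(1)[OF m(1)] by (simp add: m pm flow_simps[OF \<alpha>] C_def)
      moreover have "a * p r = r *\<^sub>R p r"
        by (simp add: m pm scaleC_mult_right y(2) scaleC_of_real[symmetric] Im0 scaleC_scaleC mult.commute)
      then have "p r * a * p r = r *\<^sub>R p r" using pp by (simp add: mult.assoc)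
      ultimately show ?thesis by simp
    qed
    then show "\<forall>m\<in>Re ` L0. projection (p m)" "\<forall>m\<in>Re ` L0. \<forall>r. \<alpha> r (p m) = p m"
      "\<forall>m\<in>Re ` L0. p m * a * p m = m *\<^sub>R p m" by simp_all
  qed
qed

lemma positive_functional_projection:
  assumes "positive_functional \<phi>" "projection p"
  shows "Re (\<phi> p) \<ge> 0" "Im (\<phi> p) = 0"
  using positive_functionalD(7,8)[OF assms(1), of p] assms(2) by (simp_all add: projection_def)

text \<open>Functionals that vanish on the eigenvectors with nonzero frequency are determined by their
  values on invariant elements, and invariant positive elements of the finite-dimensional
  subalgebras are combinations of invariant projections.\<close>

lemma positive_functional_comparison:
  fixes \<phi> \<omega> :: "'a::cstar_algebra \<Rightarrow> complex"
  assumes AF: "AF_flow \<alpha>" and \<phi>: "positive_functional \<phi>" and \<omega>: "positive_functional \<omega>"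
    and \<phi>0: "\<And>m e. eigenvector \<alpha> m e \<Longrightarrow> m \<noteq> 0 \<Longrightarrow> \<phi> e = 0"
    and \<omega>0: "\<And>m e. eigenvector \<alpha> m e \<Longrightarrow> m \<noteq> 0 \<Longrightarrow> \<omega> e = 0"
    and le: "\<And>p. projection p \<Longrightarrow> (\<And>r. \<alpha> r p = p) \<Longrightarrow> Re (\<phi> p) \<le> C * Re (\<omega> p)"
  shows "Re (\<phi> (cstar x * x)) \<le> C * Re (\<omega> (cstar x * x))"
proof -
  obtain An :: "nat \<Rightarrow> 'a set" where An0: "\<forall>n. fd_star_subalgebra (An n)" "\<forall>n t. \<alpha> t ` An n \<subseteq> An n" "closure (\<Union>n. An n) = UNIV"
    and \<alpha>: "flow \<alpha>"
    by (rule AF_flowE[OF AF])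
  note An = An0[rule_format]
  note P = positive_functionalD[OF \<phi>] and Q = positive_functionalD[OF \<omega>]
  have diag: "Re (\<phi> (cstar e * e)) \<le> C * Re (\<omega> (cstar e * e))" if e: "e \<in> An n" "eigenvector \<alpha> m e" for n m e
  proof -
    define a where "a = cstar e * e"
    have aB: "a \<in> An n" using An(1)[of n] e(1) by (auto simp: a_def fd_star_subalgebra_def star_subalgebra_def)
    have a: "cstar a = a" by (simp add: a_def cstar_mult)
    have inv: "\<alpha> r a = a" for r
      using eigenvector_cstar_mult[OF \<alpha> e(2) e(2)] by (simp add: a_def eigenvector_0_iff)
    obtain L p where L0: "finite L" "\<forall>m\<in>L. projection (p m)" "\<forall>m\<in>L. \<forall>r. \<alpha> r (p m) = p m"
      "\<forall>m\<in>L. p m * a * p m = m *\<^sub>R p m" and asum: "a = (\<Sum>m\<in>(L::real set). m *\<^sub>R p m)"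
      by (rule invariant_spectral_decomposition[OF \<alpha> An(1) aB a inv])
    note L = L0[rule_format]
    have "m * Re (\<phi> (p m)) \<le> C * (m * Re (\<omega> (p m)))" if m: "m \<in> L" for m
    proof -
      have "cstar (e * p m) * (e * p m) = p m * a * p m"
        using L(2)[OF m] by (simp add: cstar_mult a_def projection_def mult.assoc)
      then have ee: "cstar (e * p m) * (e * p m) = m *\<^sub>R p m" using L(4)[OF m] by simp
      have s: "m * Re (\<phi> (p m)) \<ge> 0" "m * Re (\<omega> (p m)) \<ge> 0"
        using P(8)[of "e * p m"] Q(8)[of "e * p m"] unfolding ee by (simp_all add: P(5) Q(5))
      show ?thesis
      \<comment> \<open>The sign of m has not been determined. If m < 0, then
        \<open>m *\<^sub>R p m\<close> has the form \<open>cstar z * z\<close>, and positivity of it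
        and of \<open>p m\<close> forces both functionals to vanish on \<open>p m\<close>.\<close>
      proof (cases "m \<ge> 0")
        case True
        have "m * Re (\<phi> (p m)) \<le> m * (C * Re (\<omega> (p m)))"
          by (rule mult_left_mono[OF le]) (use L m True in auto)
        then show ?thesis by (simp add: mult_ac)
      next
        case False
        then have "Re (\<phi> (p m)) = 0" "Re (\<omega> (p m)) = 0"
          using s positive_functional_projection(1)[OF \<phi> L(2)[OF m]] positive_functional_projection(1)[OF \<omega> L(2)[OF m]]
          by (simp_all add: zero_le_mult_iff)
        then show ?thesis by simp
      qed
    qed
    then have "(\<Sum>m\<in>L. m * Re (\<phi> (p m))) \<le> (\<Sum>m\<in>L. C * (m * Re (\<omega> (p m))))" by (rule sum_mono)
    moreover have "Re (\<phi> a) = (\<Sum>m\<in>L. m * Re (\<phi> (p m)))" "Re (\<omega> a) = (\<Sum>m\<in>L. m * Re (\<omega> (p m)))"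
      by (subst asum, simp add: P(9) P(5) Q(9) Q(5))+
    ultimately show ?thesis by (simp add: a_def sum_distrib_left)
  qed
  have fd: "Re (\<phi> (cstar x * x)) \<le> C * Re (\<omega> (cstar x * x))" if x: "x \<in> An n" for n x
  proof -
    obtain L f where L0: "finite L" "\<forall>m\<in>L. f m \<in> An n" "\<forall>m\<in>L. eigenvector \<alpha> m (f m)"
      and xs: "x = (\<Sum>m\<in>(L::real set). f m)"
      by (rule fd_invariant_eigenvectors[OF \<alpha> An(1) An(2) x])
    note L = L0[rule_format]
    \<comment> \<open>The cross terms \<open>cstar (f m) * f k\<close> have the nonzero frequency k
      - m, on which \<xi> vanishes.\<close>
    have expand: "\<xi> (cstar x * x) = (\<Sum>m\<in>L. \<xi> (cstar (f m) * f m))"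
      if \<xi>: "positive_functional \<xi>" and \<xi>0: "\<And>m e. eigenvector \<alpha> m e \<Longrightarrow> m \<noteq> 0 \<Longrightarrow> \<xi> e = 0" for \<xi>
    proof -
      have "\<xi> (cstar x * x) = (\<Sum>m\<in>L. \<Sum>k\<in>L. \<xi> (cstar (f m) * f k))"
        unfolding xs cstar_sum sum_product positive_functionalD(9)[OF \<xi>] ..
      also have "\<dots> = (\<Sum>m\<in>L. \<Sum>k\<in>{m}. \<xi> (cstar (f m) * f k))"
      proof (rule sum.cong[OF refl], rule sum.mono_neutral_right)
        fix m assume m: "m \<in> L"
        show "\<forall>k\<in>L - {m}. \<xi> (cstar (f m) * f k) = 0"
          using \<xi>0[OF eigenvector_cstar_mult[OF \<alpha> L(3)[OF m] L(3)]] by auto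
      qed (use L in auto)
      finally show ?thesis by simp
    qed
    have "Re (\<phi> (cstar x * x)) = (\<Sum>m\<in>L. Re (\<phi> (cstar (f m) * f m)))"
      by (simp add: expand[OF \<phi> \<phi>0])
    also have "\<dots> \<le> (\<Sum>m\<in>L. C * Re (\<omega> (cstar (f m) * f m)))"
      using L by (intro sum_mono diag) auto
    also have "\<dots> = C * Re (\<omega> (cstar x * x))"
      by (simp add: expand[OF \<omega> \<omega>0] sum_distrib_left)
    finally show ?thesis .
  qed
  have cl: "closed {x. Re (\<phi> (cstar x * x)) \<le> C * Re (\<omega> (cstar x * x))}"
    by (intro closed_Collect_le continuous_intros bounded_linear.continuous_on[OF bounded_linear_positive_functional]
        \<phi> \<omega> bounded_linear.continuous_on[OF bounded_linear_cstar])
  have "closure (\<Union>n. An n) \<subseteq> {x. Re (\<phi> (cstar x * x)) \<le> C * Re (\<omega> (cstar x * x))}"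
    by (rule closure_minimal[OF _ cl]) (use fd in blast)
  then show ?thesis using An(3) by blast
qed

section \<open>Entire functions and simple algebras\<close>

lemma neumann_inverse:
  fixes y :: "'a::cstar_algebra"
  assumes y: "norm y < 1"
  obtains r where "(1 - y) * r = 1" "r * (1 - y) = 1" "norm r \<le> 1 / (1 - norm y)"
proof -
  have "\<exists>!r. 1 + y * r = r"
  proof (rule banach_fix_type[of "norm y"])
    show "\<forall>a b. dist (1 + y * a) (1 + y * b) \<le> norm y * dist a b"
      by (simp add: dist_norm right_diff_distrib[symmetric] norm_mult_ineq)
  qed (use y in auto)
  then obtain r where r: "1 + y * r = r" by blast
  have "\<exists>!s. 1 + s * y = s"
  proof (rule banach_fix_type[of "norm y"])
    show "\<forall>a b. dist (1 + a * y) (1 + b * y) \<le> norm y * dist a b"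
      by (simp add: dist_norm left_diff_distrib[symmetric] mult.commute[of "norm y"] norm_mult_ineq)
  qed (use y in auto)
  then obtain s where s: "1 + s * y = s" by blast
  have 1: "(1 - y) * r = 1" using r by (simp add: algebra_simps)
  have 2: "s * (1 - y) = 1" using s by (simp add: algebra_simps)
  have "s = s * ((1 - y) * r)" using 1 by simp
  also have "\<dots> = r" by (simp only: mult.assoc[symmetric] 2 mult_1_left)
  finally have "s = r" .
  have "norm r \<le> 1 + norm y * norm r"
    using norm_triangle_ineq[of 1 "y * r"] norm_mult_ineq[of y r] r by simp
  then have "norm r * (1 - norm y) \<le> 1" by (simp add: algebra_simps)
  then have "norm r \<le> 1 / (1 - norm y)" using y by (simp add: field_simps)
  with 1 2 \<open>s = r\<close> show thesis by (intro that[of r]) auto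
qed

lemma inverse_commute:
  fixes a r q :: "'a::cstar_algebra"
  assumes "a * r = 1" "r * a = 1" "a * q = q * a"
  shows "r * q = q * r"
proof -
  have "r * q = r * q * (a * r)" using assms(1) by simp
  also have "\<dots> = r * (q * a) * r" by (simp only: mult.assoc)
  also have "\<dots> = (r * a) * q * r" by (simp only: assms(3)[symmetric] mult.assoc)
  also have "\<dots> = q * r" using assms(2) by simp
  finally show ?thesis .
qed

lemma inv_el:
  assumes "invertible_el w"
  shows "w * inv_el w = 1" "inv_el w * w = 1"
  using someI_ex[of "\<lambda>w'. w * w' = 1 \<and> w' * w = 1"] assms
  unfolding invertible_el_def inv_el_def by blast+

lemma invertible_elI: "w * w' = 1 \<Longrightarrow> w' * w = 1 \<Longrightarrow> invertible_el w"
  unfolding invertible_el_def by blast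

lemma inv_el_cancel:
  assumes "invertible_el w"
  shows "w * (inv_el w * x) = x" "inv_el w * (w * x) = x"
  using inv_el[OF assms] by (simp_all add: mult.assoc[symmetric])

lemma inv_el_one: "inv_el (1::'a::cstar_algebra) = 1"
  using inv_el(1)[OF invertible_elI[of "1::'a" 1]] by simp

section \<open>Entire functions with values in the algebra\<close>

definition has_cderiv :: "(complex \<Rightarrow> 'a::cstar_algebra) \<Rightarrow> 'a \<Rightarrow> complex \<Rightarrow> bool" where
  "has_cderiv V D z \<longleftrightarrow> ((\<lambda>h. inverse h *\<^sub>C (V (z + h) - V z)) \<longlongrightarrow> D) (at 0)"

lemma entire_fun_iff: "entire_fun V \<longleftrightarrow> (\<forall>z. \<exists>D. has_cderiv V D z)"
  by (simp add: entire_fun_def has_cderiv_def)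

lemma entire_funE:
  assumes "entire_fun V"
  obtains D where "has_cderiv V D z"
  using assms by (auto simp: entire_fun_iff)

lemma has_cderiv_cont:
  assumes "has_cderiv V D z"
  shows "((\<lambda>h. V (z + h)) \<longlongrightarrow> V z) (at 0)"
proof -
  have "((\<lambda>h. h *\<^sub>C inverse h *\<^sub>C (V (z + h) - V z)) \<longlongrightarrow> 0 *\<^sub>C D) (at 0)"
    using assms unfolding has_cderiv_def by (intro tendsto_scaleC tendsto_ident_at)
  moreover have "\<forall>\<^sub>F h in at 0. h *\<^sub>C inverse h *\<^sub>C (V (z + h) - V z) = V (z + h) - V z"
    by (auto simp: eventually_at_filter scaleC_scaleC)
  ultimately have "((\<lambda>h. V (z + h) - V z) \<longlongrightarrow> 0) (at 0)" by (simp add: tendsto_cong)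
  then show ?thesis by (rule LIM_zero_cancel)
qed

lemma entire_fun_continuous_on:
  assumes "entire_fun V"
  shows "continuous_on S V"
  unfolding continuous_on_eq_continuous_within
proof
  fix z assume "z \<in> S"
  obtain D where "has_cderiv V D z" by (rule entire_funE[OF assms])
  then have "V \<midarrow>z\<rightarrow> V z" using has_cderiv_cont LIM_offset_zero_cancel by blast
  then show "continuous (at z within S) V" by (auto simp: continuous_at intro: continuous_at_imp_continuous_within)
qed

lemma entire_fun_linear:
  assumes V: "entire_fun V" and T: "bounded_linear T" "\<And>c x. T (c *\<^sub>C x) = c *\<^sub>C T x"
  shows "entire_fun (\<lambda>z. T (V z))"
  unfolding entire_fun_iff
proof
  fix z
  obtain D where "has_cderiv V D z" by (rule entire_funE[OF V])
  then have "has_cderiv (\<lambda>z. T (V z)) (T D) z"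
    unfolding has_cderiv_def using bounded_linear.tendsto[OF T(1)]
    by (fastforce simp: T(2) linear_diff[OF bounded_linear.linear[OF T(1)]])
  then show "\<exists>D. has_cderiv (\<lambda>z. T (V z)) D z" ..
qed

lemma entire_fun_mult:
  assumes "entire_fun U" "entire_fun V"
  shows "entire_fun (\<lambda>z. U z * V z)"
  unfolding entire_fun_iff
proof
  fix z
  obtain A where A: "has_cderiv U A z" by (rule entire_funE[OF assms(1)])
  obtain B where B: "has_cderiv V B z" by (rule entire_funE[OF assms(2)])
  have "((\<lambda>h. (inverse h *\<^sub>C (U (z + h) - U z)) * V (z + h) + U z * (inverse h *\<^sub>C (V (z + h) - V z)))
      \<longlongrightarrow> A * V z + U z * B) (at 0)"
    using A B has_cderiv_cont[OF B] unfolding has_cderiv_def by (intro tendsto_intros)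
  then have "has_cderiv (\<lambda>z. U z * V z) (A * V z + U z * B) z"
    unfolding has_cderiv_def
    by (simp add: scaleC_mult_left scaleC_mult_right scaleC_add_right[symmetric] left_diff_distrib right_diff_distrib)
  then show "\<exists>D. has_cderiv (\<lambda>z. U z * V z) D z" ..
qed

lemma entire_fun_scaleC:
  assumes "f holomorphic_on UNIV" "entire_fun V"
  shows "entire_fun (\<lambda>z. f z *\<^sub>C V z)"
  unfolding entire_fun_iff
proof
  fix z
  obtain A where A: "(f has_field_derivative A) (at z)"
    using assms(1) by (auto simp: holomorphic_on_def field_differentiable_def)
  obtain B where B: "has_cderiv V B z" by (rule entire_funE[OF assms(2)])
  have "((\<lambda>h. ((f (z + h) - f z) / h) *\<^sub>C V (z + h) + f z *\<^sub>C (inverse h *\<^sub>C (V (z + h) - V z)))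
      \<longlongrightarrow> A *\<^sub>C V z + f z *\<^sub>C B) (at 0)"
    using A B has_cderiv_cont[OF B] unfolding has_cderiv_def DERIV_def by (intro tendsto_add tendsto_scaleC tendsto_const)
  moreover have "((f (z + h) - f z) / h) *\<^sub>C V (z + h) + f z *\<^sub>C (inverse h *\<^sub>C (V (z + h) - V z))
      = inverse h *\<^sub>C (f (z + h) *\<^sub>C V (z + h) - f z *\<^sub>C V z)" for h
    by (simp add: scaleC_diff_right scaleC_diff_left scaleC_scaleC left_diff_distrib right_diff_distrib divide_inverse mult.commute)
  ultimately have "has_cderiv (\<lambda>z. f z *\<^sub>C V z) (A *\<^sub>C V z + f z *\<^sub>C B) z"
    unfolding has_cderiv_def by simp
  then show "\<exists>D. has_cderiv (\<lambda>z. f z *\<^sub>C V z) D z" ..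
qed

lemma entire_fun_const: "entire_fun (\<lambda>z. a)"
  unfolding entire_fun_def by (simp add: exI[of _ 0])

lemma entire_fun_add:
  assumes "entire_fun U" "entire_fun V"
  shows "entire_fun (\<lambda>z. U z + V z)"
  unfolding entire_fun_iff
proof
  fix z
  obtain A where A: "has_cderiv U A z" by (rule entire_funE[OF assms(1)])
  obtain B where B: "has_cderiv V B z" by (rule entire_funE[OF assms(2)])
  have "has_cderiv (\<lambda>z. U z + V z) (A + B) z"
    using tendsto_add[OF A[unfolded has_cderiv_def] B[unfolded has_cderiv_def]] unfolding has_cderiv_def
    by (simp add: scaleC_add_right[symmetric] add_diff_add)
  then show "\<exists>D. has_cderiv (\<lambda>z. U z + V z) D z" ..
qed

lemma entire_fun_sum: "(\<And>i. i \<in> I \<Longrightarrow> entire_fun (V i)) \<Longrightarrow> entire_fun (\<lambda>z. \<Sum>i\<in>I. V i z)"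
  by (induction I rule: infinite_finite_induct) (auto simp: entire_fun_const entire_fun_add)

lemma entire_fun_cmult:
  assumes "entire_fun V"
  shows "entire_fun (\<lambda>z. a * V z)" "entire_fun (\<lambda>z. V z * a)"
  using entire_fun_mult[OF entire_fun_const assms] entire_fun_mult[OF assms entire_fun_const] by auto

lemma entire_fun_diff:
  assumes "entire_fun U" "entire_fun V"
  shows "entire_fun (\<lambda>z. U z - V z)"
  using entire_fun_add[OF assms(1) entire_fun_cmult(1)[OF assms(2), of "-1"]] by simp

lemma entire_fun_affine:
  assumes V: "entire_fun V" and k: "k \<noteq> 0"
  shows "entire_fun (\<lambda>z. V (a + k * z))"
  unfolding entire_fun_iff
proof
  fix z
  obtain D where D: "has_cderiv V D (a + k * z)" by (rule entire_funE[OF V])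
  have "filterlim (\<lambda>h. k * h) (at 0) (at 0)"
    using k by (auto simp: filterlim_at eventually_at_filter intro!: tendsto_eq_intros)
  then have "((\<lambda>h. inverse (k * h) *\<^sub>C (V (a + k * z + k * h) - V (a + k * z))) \<longlongrightarrow> D) (at 0)"
    using D unfolding has_cderiv_def by (rule filterlim_compose[rotated])
  then have "((\<lambda>h. k *\<^sub>C inverse (k * h) *\<^sub>C (V (a + k * z + k * h) - V (a + k * z))) \<longlongrightarrow> k *\<^sub>C D) (at 0)"
    by (intro tendsto_scaleC tendsto_const)
  then have "has_cderiv (\<lambda>z. V (a + k * z)) (k *\<^sub>C D) z"
    unfolding has_cderiv_def using k
    by (simp add: scaleC_scaleC distrib_left add.assoc mult.assoc[symmetric, of k])
  then show "\<exists>D. has_cderiv (\<lambda>z. V (a + k * z)) D z" ..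
qed

lemma entire_fun_cstar_cnj:
  assumes V: "entire_fun V"
  shows "entire_fun (\<lambda>z. cstar (V (cnj z)))"
  unfolding entire_fun_iff
proof
  fix z
  obtain D where D: "has_cderiv V D (cnj z)" by (rule entire_funE[OF V])
  have "filterlim cnj (at 0) (at 0)"
    by (auto simp: filterlim_at eventually_at_filter intro!: tendsto_eq_intros)
  then have "((\<lambda>h. inverse (cnj h) *\<^sub>C (V (cnj z + cnj h) - V (cnj z))) \<longlongrightarrow> D) (at 0)"
    using D unfolding has_cderiv_def by (rule filterlim_compose[rotated])
  then have "((\<lambda>h. cstar (inverse (cnj h) *\<^sub>C (V (cnj z + cnj h) - V (cnj z)))) \<longlongrightarrow> cstar D) (at 0)"
    by (rule bounded_linear.tendsto[OF bounded_linear_cstar])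
  then have "has_cderiv (\<lambda>z. cstar (V (cnj z))) (cstar D) z"
    unfolding has_cderiv_def by (simp add: cstar_scaleC cstar_diff)
  then show "\<exists>D. has_cderiv (\<lambda>z. cstar (V (cnj z))) D z" ..
qed

lemma holomorphic_functional:
  assumes V: "entire_fun V" and l: "bounded_linear l" "\<And>c x. l (c *\<^sub>C x) = c * l x"
  shows "(\<lambda>z. l (V z)) holomorphic_on S"
proof -
  have "\<exists>D'. ((\<lambda>z. l (V z)) has_field_derivative D') (at z)" for z
  proof -
    obtain D where "has_cderiv V D z" by (rule entire_funE[OF V])
    then have "((\<lambda>h. l (inverse h *\<^sub>C (V (z + h) - V z))) \<longlongrightarrow> l D) (at 0)"
      unfolding has_cderiv_def by (rule bounded_linear.tendsto[OF l(1)])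
    then have "((\<lambda>z. l (V z)) has_field_derivative l D) (at z)"
      unfolding DERIV_def by (simp add: l(2) linear_diff[OF bounded_linear.linear[OF l(1)]] divide_inverse mult.commute)
    then show ?thesis ..
  qed
  then show ?thesis
    unfolding holomorphic_on_def field_differentiable_def using has_field_derivative_at_within by blast
qed

lemma entire_zero_on_reals:
  assumes f: "f holomorphic_on UNIV" and z: "\<And>t::real. f (of_real t) = 0"
  shows "f w = 0"
proof (rule analytic_continuation[OF f _ _ subset_UNIV UNIV_I])
  show "0 islimpt range complex_of_real"
    unfolding islimpt_approachable
  proof (intro allI impI)
    fix e :: real assume "e > 0"
    then show "\<exists>x'\<in>range complex_of_real. x' \<noteq> 0 \<and> dist x' 0 < e"
      by (intro bexI[OF _ rangeI[of _ "e / 2"]]) (simp add: dist_norm norm_divide)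
  qed
qed (use z in auto)

section \<open>Separation and the centre of a simple algebra\<close>

lemma bounded_linear_functional_mult:
  fixes \<psi> :: "'a::cstar_algebra \<Rightarrow> complex"
  assumes "positive_functional \<psi>"
  shows "bounded_linear (\<lambda>a. \<psi> (X * a * Z))" "\<psi> (X * (c *\<^sub>C x) * Z) = c * \<psi> (X * x * Z)"
proof -
  show "bounded_linear (\<lambda>a. \<psi> (X * a * Z))"
    by (intro bounded_linear_compose[OF bounded_linear_positive_functional[OF assms]]
        bounded_linear_mult_const bounded_linear_const_mult bounded_linear_ident)
  show "\<psi> (X * (c *\<^sub>C x) * Z) = c * \<psi> (X * x * Z)"
    by (simp add: scaleC_mult_left scaleC_mult_right positive_functionalD(2)[OF assms])
qed

text \<open>The functionals sending a to \<open>\<psi> (X * a * Z)\<close> take the place of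
  Hahn-Banach: the elements annihilated by all of them form a closed ideal that misses 1. Scalar
  complex analysis thereby yields identities between algebra-valued entire functions.\<close>

lemma simple_separating:
  fixes \<psi> :: "'a::cstar_algebra \<Rightarrow> complex"
  assumes simple: "simple_cstar TYPE('a)" and \<psi>: "state \<psi>" and a: "\<And>X Z. \<psi> (X * a * Z) = 0"
  shows "a = 0"
proof -
  have pf: "positive_functional \<psi>" and one: "\<psi> 1 = 1" using \<psi> by (auto simp: state_iff_positive_functional)
  define N where "N = {a. \<forall>X Z. \<psi> (X * a * Z) = 0}"
  have "N = (\<Inter>X. \<Inter>Z. {a. \<psi> (X * a * Z) = 0})" by (auto simp: N_def)
  also have "closed \<dots>"
    by (intro closed_INT ballI closed_Collect_eq bounded_linear.continuous_on[OF bounded_linear_functional_mult(1)[OF pf]]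
        continuous_intros)
  finally have "closed N" .
  moreover have "csubspace N"
    by (simp add: csubspace_def N_def distrib_left distrib_right positive_functionalD[OF pf]
        bounded_linear_functional_mult(2)[OF pf])
  moreover have "b * x \<in> N \<and> x * b \<in> N" if "x \<in> N" for b x
  proof -
    have x: "\<psi> (X * x * Z) = 0" for X Z using that by (simp add: N_def)
    have "X * (b * x) * Z = (X * b) * x * Z" "X * (x * b) * Z = X * x * (b * Z)" for X Z
      by (simp_all only: mult.assoc)
    then show ?thesis unfolding N_def by (simp only: mem_Collect_eq x) simp
  qed
  ultimately have "closed_ideal N" by (simp add: closed_ideal_def)
  then have "N = {0} \<or> N = UNIV" using simple by (simp add: simple_cstar_def)
  moreover have "1 \<notin> N" using one by (auto simp: N_def intro!: exI[of _ 1])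
  moreover have "a \<in> N" using a by (simp add: N_def)
  ultimately show ?thesis by auto
qed

lemma entire_fun_zero_on_reals:
  fixes V :: "complex \<Rightarrow> 'a::cstar_algebra" and \<psi> :: "'a \<Rightarrow> complex"
  assumes simple: "simple_cstar TYPE('a)" and \<psi>: "state \<psi>" and V: "entire_fun V"
    and z: "\<And>t::real. V (of_real t) = 0"
  shows "V w = 0"
proof (rule simple_separating[OF simple \<psi>])
  fix X Z
  have pf: "positive_functional \<psi>" using \<psi> by (auto simp: state_iff_positive_functional)
  show "\<psi> (X * V w * Z) = 0"
    by (rule entire_zero_on_reals[of "\<lambda>w. \<psi> (X * V w * Z)"],
        rule holomorphic_functional[OF V bounded_linear_functional_mult[OF pf]])
       (simp add: z positive_functionalD[OF pf])
qed

text \<open>The closure of the ideal xA is a nonzero closed ideal, so it contains 1. Hence some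
  \<open>x * a\<close> is within distance 1 of 1 and therefore invertible, and with it the central
  x.\<close>

lemma simple_central_invertible:
  fixes x :: "'a::cstar_algebra"
  assumes simple: "simple_cstar TYPE('a)" and central: "\<And>a. x * a = a * x" and x0: "x \<noteq> 0"
  shows "\<exists>r. x * r = 1 \<and> r * x = 1"
proof -
  define R where "R = range (\<lambda>a. x * a)"
  have R: "u \<in> R \<Longrightarrow> v \<in> R \<Longrightarrow> u + v \<in> R" "u \<in> R \<Longrightarrow> k *\<^sub>C u \<in> R" "u \<in> R \<Longrightarrow> b * u \<in> R" "u \<in> R \<Longrightarrow> u * b \<in> R" for u v k b
  proof -
    show "u \<in> R \<Longrightarrow> v \<in> R \<Longrightarrow> u + v \<in> R" unfolding R_def by (auto simp: distrib_left[symmetric])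
    show "u \<in> R \<Longrightarrow> k *\<^sub>C u \<in> R" unfolding R_def by (auto simp: scaleC_mult_right[symmetric])
    show "u \<in> R \<Longrightarrow> u * b \<in> R" unfolding R_def by (auto simp: mult.assoc)
    show "u \<in> R \<Longrightarrow> b * u \<in> R" unfolding R_def by (auto simp: mult.assoc[symmetric] central[symmetric]) (auto simp: mult.assoc)
  qed
  define I where "I = closure R"
  have lim: "u \<in> I \<longleftrightarrow> (\<exists>X. (\<forall>n. X n \<in> R) \<and> X \<longlonglongrightarrow> u)" for u
    unfolding I_def by (rule closure_sequential)
  have "csubspace I"
    unfolding csubspace_def
  proof (intro conjI ballI allI)
    have "0 \<in> R" using R_def by (auto intro!: image_eqI[of _ _ 0])
    then show "0 \<in> I" unfolding I_def using closure_subset by blast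
    fix u k assume u: "u \<in> I"
    then obtain X where X: "\<And>n. X n \<in> R" "X \<longlonglongrightarrow> u" unfolding lim by blast
    have "(\<lambda>n. k *\<^sub>C X n) \<longlonglongrightarrow> k *\<^sub>C u" by (intro tendsto_scaleC tendsto_const X)
    then show "k *\<^sub>C u \<in> I" unfolding lim using R(2)[OF X(1)] by (intro exI[of _ "\<lambda>n. k *\<^sub>C X n"]) simp
    fix v assume "v \<in> I"
    then obtain Y where Y: "\<And>n. Y n \<in> R" "Y \<longlonglongrightarrow> v" unfolding lim by blast
    have "(\<lambda>n. X n + Y n) \<longlonglongrightarrow> u + v" by (intro tendsto_add X Y)
    then show "u + v \<in> I" unfolding lim using R(1)[OF X(1) Y(1)] by (intro exI[of _ "\<lambda>n. X n + Y n"]) simp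
  qed
  moreover have "b * u \<in> I \<and> u * b \<in> I" if u: "u \<in> I" for b u
  proof -
    obtain X where X: "\<And>n. X n \<in> R" "X \<longlonglongrightarrow> u" using u unfolding lim by blast
    have "(\<lambda>n. b * X n) \<longlonglongrightarrow> b * u" "(\<lambda>n. X n * b) \<longlonglongrightarrow> u * b" by (intro tendsto_intros X)+
    then show ?thesis
      unfolding lim using R(3)[OF X(1)] R(4)[OF X(1)]
      by (intro conjI exI[of _ "\<lambda>n. b * X n"] exI[of _ "\<lambda>n. X n * b"]) simp_all
  qed
  ultimately have "closed_ideal I" by (simp add: closed_ideal_def I_def)
  moreover have "x * 1 \<in> R" unfolding R_def by (rule rangeI)
  then have "x \<in> I" unfolding I_def using closure_subset by auto
  ultimately have "I = UNIV" using simple x0 by (auto simp: simple_cstar_def)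
  then have "1 \<in> closure R" by (simp add: I_def)
  then obtain u where u: "u \<in> R" "dist u 1 < 1" unfolding closure_approachable by (meson zero_less_one)
  obtain a where a: "u = x * a" using u(1) by (auto simp: R_def)
  have "norm (1 - x * a) < 1" using u(2) a by (simp add: dist_norm norm_minus_commute)
  then obtain r where r: "(1 - (1 - x * a)) * r = 1" "r * (1 - (1 - x * a)) = 1"
    by (rule neumann_inverse)
  have "x * (a * r) = 1" using r(1) by (simp add: mult.assoc)
  then show ?thesis using central[of "a * r"] by metis
qed

text \<open>The Gelfand-Mazur argument: if no \<open>z - k\<close> vanished, then \<open>\<psi> (z (z - k)\<^sup>-\<^sup>1)\<close> would be an
  entire function of \<open>k\<close> tending to 0 at infinity, with value 1 at 0.\<close>

lemma simple_center_trivial: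
  fixes z :: "'a::cstar_algebra" and \<psi> :: "'a \<Rightarrow> complex"
  assumes simple: "simple_cstar TYPE('a)" and \<psi>: "state \<psi>" and central: "\<And>a. z * a = a * z"
  shows "\<exists>k. z = k *\<^sub>C 1"
proof (rule ccontr)
  assume no: "\<nexists>k. z = k *\<^sub>C 1"
  have pf: "positive_functional \<psi>" and one: "\<psi> 1 = 1" using \<psi> by (auto simp: state_iff_positive_functional)
  have "\<exists>r. (z - k *\<^sub>C 1) * r = 1 \<and> r * (z - k *\<^sub>C 1) = 1" for k
    by (rule simple_central_invertible[OF simple])
       (use no in \<open>auto simp: left_diff_distrib right_diff_distrib central scaleC_mult_left scaleC_mult_right\<close>)
  then obtain R where R: "\<And>k. (z - k *\<^sub>C 1) * R k = 1" "\<And>k. R k * (z - k *\<^sub>C 1) = 1" by metis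
  \<comment> \<open>A Neumann inverse around k bounds the resolvent locally; with the resolvent
    identity this gives continuity and then differentiability.\<close>
  have small: "norm (R (k + h)) \<le> 2 * norm (R k)" if h: "cmod h * norm (R k) \<le> 1 / 2" for k h
  proof -
    have "norm (h *\<^sub>C R k) \<le> 1/2" using h by (simp add: norm_scaleC)
    then have "norm (h *\<^sub>C R k) < 1" by simp
    then obtain r where r: "(1 - h *\<^sub>C R k) * r = 1" "r * (1 - h *\<^sub>C R k) = 1" "norm r \<le> 1 / (1 - norm (h *\<^sub>C R k))"
      by (rule neumann_inverse)
    have "(z - k *\<^sub>C 1) * (1 - h *\<^sub>C R k) = z - (k + h) *\<^sub>C 1"
      by (simp add: right_diff_distrib scaleC_mult_right R scaleC_add_left)
    then have "(z - (k + h) *\<^sub>C 1) * (r * R k) = (z - k *\<^sub>C 1) * ((1 - h *\<^sub>C R k) * r) * R k"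
      by (simp only: mult.assoc[symmetric])
    also have "\<dots> = 1" by (simp add: r R)
    finally have e: "(z - (k + h) *\<^sub>C 1) * (r * R k) = 1" .
    have "R (k + h) = R (k + h) * ((z - (k + h) *\<^sub>C 1) * (r * R k))" by (simp add: e)
    also have "\<dots> = r * R k" by (simp only: mult.assoc[symmetric] R(2) mult_1_left)
    finally have "norm (R (k + h)) \<le> norm r * norm (R k)" using norm_mult_ineq[of r "R k"] by simp
    moreover have "1 / (1 - norm (h *\<^sub>C R k)) \<le> 1 / (1 / 2)"
      using \<open>norm (h *\<^sub>C R k) \<le> 1/2\<close> by (intro divide_left_mono) auto
    then have "norm r \<le> 2" using r(3) by simp
    then have "norm r * norm (R k) \<le> 2 * norm (R k)" by (rule mult_right_mono) simp
    ultimately show ?thesis by linarith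
  qed
  have res: "R (k + h) - R k = h *\<^sub>C (R (k + h) * R k)" for k h
  proof -
    have "R (k + h) - R k = R (k + h) * ((z - k *\<^sub>C 1) * R k) - (R (k + h) * (z - (k + h) *\<^sub>C 1)) * R k"
      by (simp add: R)
    also have "\<dots> = R (k + h) * ((z - k *\<^sub>C 1) - (z - (k + h) *\<^sub>C 1)) * R k"
      by (simp only: mult.assoc left_diff_distrib right_diff_distrib)
    also have "(z - k *\<^sub>C 1) - (z - (k + h) *\<^sub>C 1) = h *\<^sub>C 1" by (simp add: scaleC_add_left)
    finally show ?thesis by (simp add: scaleC_mult_left scaleC_mult_right)
  qed
  have cont: "((\<lambda>h. R (k + h)) \<longlongrightarrow> R k) (at 0)" for k
  proof (rule LIM_zero_cancel, rule Lim_null_comparison)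
    have "((\<lambda>h. cmod h * norm (R k)) \<longlongrightarrow> cmod 0 * norm (R k)) (at 0)" by (intro tendsto_intros)
    then have "\<forall>\<^sub>F h in at 0. cmod h * norm (R k) < 1 / 2"
      by (rule order_tendstoD(2)) simp
    then show "\<forall>\<^sub>F h in at 0. norm (R (k + h) - R k) \<le> cmod h * (2 * norm (R k) * norm (R k))"
    proof eventually_elim
      case (elim h)
      have "norm (R (k + h) * R k) \<le> 2 * norm (R k) * norm (R k)"
        using norm_mult_ineq[of "R (k + h)" "R k"] mult_right_mono[OF small[of h k], of "norm (R k)"] elim by simp
      then show ?case unfolding res norm_scaleC by (rule mult_left_mono) simp
    qed
    have "((\<lambda>h. cmod h * (2 * norm (R k) * norm (R k))) \<longlongrightarrow> cmod 0 * (2 * norm (R k) * norm (R k))) (at 0)"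
      by (intro tendsto_intros)
    then show "((\<lambda>h. cmod h * (2 * norm (R k) * norm (R k))) \<longlongrightarrow> 0) (at 0)" by simp
  qed
  have ent: "entire_fun R"
    unfolding entire_fun_iff
  proof
    fix k
    have "((\<lambda>h. R (k + h) * R k) \<longlongrightarrow> R k * R k) (at 0)" by (intro tendsto_intros cont)
    then have "has_cderiv R (R k * R k) k"
      unfolding has_cderiv_def res
      by (rule Lim_transform_eventually) (auto simp: eventually_at_filter scaleC_scaleC)
    then show "\<exists>D. has_cderiv R D k" ..
  qed
  define f where "f k = \<psi> (z * R k * 1)" for k
  have hol: "f holomorphic_on UNIV"
    unfolding f_def by (rule holomorphic_functional[OF ent bounded_linear_functional_mult[OF pf]])
  have nR: "norm (R k) \<le> 1 / (cmod k - norm z)" if k: "cmod k > norm z" for k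
  proof -
    have "z * R k - k *\<^sub>C R k = 1" using R(1)[of k] by (simp add: left_diff_distrib scaleC_mult_left)
    then have "k *\<^sub>C R k = z * R k - 1" by (simp add: algebra_simps)
    then have "cmod k * norm (R k) = norm (z * R k - 1)" by (metis norm_scaleC)
    also have "\<dots> \<le> norm z * norm (R k) + 1"
      using norm_triangle_ineq4[of "z * R k" 1] norm_mult_ineq[of z "R k"] by simp
    finally show ?thesis using k by (simp add: field_simps)
  qed
  have "(f \<longlongrightarrow> 0) at_infinity"
  proof (rule Lim_null_comparison)
    have "norm (f k) \<le> 2 * norm z * (1 / (cmod k - norm z))" if k: "cmod k > norm z" for k
    proof -
      have "norm (f k) \<le> 2 * norm (z * R k)"
        using positive_functional_bound[OF pf, of "z * R k"] by (simp add: f_def one)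
      also have "\<dots> \<le> 2 * (norm z * (1 / (cmod k - norm z)))"
        using norm_mult_ineq[of z "R k"] mult_left_mono[OF nR[OF k], of "norm z"] by simp
      finally show ?thesis by simp
    qed
    then show "\<forall>\<^sub>F k in at_infinity. norm (f k) \<le> 2 * norm z * (1 / (cmod k - norm z))"
      unfolding eventually_at_infinity by (intro exI[of _ "norm z + 1"]) simp
    have "filterlim (\<lambda>k::complex. cmod k - norm z) at_top at_infinity"
      using filterlim_tendsto_add_at_top[OF tendsto_const[of "- norm z"] filterlim_norm_at_top] by simp
    then have "((\<lambda>k::complex. 2 * norm z * inverse (cmod k - norm z)) \<longlongrightarrow> 2 * norm z * 0) at_infinity"
      by (intro tendsto_intros tendsto_inverse_0_at_top)
    then show "((\<lambda>k::complex. 2 * norm z * (1 / (cmod k - norm z))) \<longlongrightarrow> 0) at_infinity"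
      by (simp add: divide_inverse)
  qed
  then have "f 0 = 0" by (rule Liouville_weak_0[OF hol])
  then show False using R(1)[of 0] one by (simp add: f_def)
qed

text \<open>Central values are scalars k(r), and \<alpha> fixes scalars, so k is a continuous
  character of the reals. Its exponential form comes from the eigenvector theorem for the group of
  multiplications by k(r) on the one-dimensional span of 1.\<close>

lemma central_cocycle_scalar:
  fixes z :: "real \<Rightarrow> 'a::cstar_algebra" and \<psi> :: "'a \<Rightarrow> complex"
  assumes simple: "simple_cstar TYPE('a)" and \<psi>: "state \<psi>" and \<alpha>: "flow \<alpha>"
    and cont: "continuous_on UNIV z" and unit: "\<And>r. unitary (z r)"
    and central: "\<And>r a. z r * a = a * z r" and coc: "\<And>s r. z (s + r) = z s * \<alpha> s (z r)"
  obtains m :: real where "\<forall>r. z r = exp (\<i> * of_real (m * r)) *\<^sub>C 1"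
proof -
  have pf: "positive_functional \<psi>" and one: "\<psi> 1 = 1" using \<psi> by (auto simp: state_iff_positive_functional)
  have "\<exists>k. z r = k *\<^sub>C 1" for r by (rule simple_center_trivial[OF simple \<psi> central])
  then obtain k where k: "\<And>r. z r = k r *\<^sub>C 1" by metis
  have k\<psi>: "k r = \<psi> (z r)" for r by (simp add: k positive_functionalD(2)[OF pf] one)
  have kmult: "k (s + r) = k s * k r" for s r
    unfolding k\<psi>[of "s + r"] coc by (simp add: k flow_simps[OF \<alpha>] scaleC_mult_left scaleC_scaleC positive_functionalD(2)[OF pf] one)
  have nk: "cmod (k r) = 1" for r
    using norm_unitary[OF unit[of r]] by (simp add: k norm_scaleC)
  have k0: "k 0 = 1" using kmult[of 0 0] nk[of 0] by auto
  have kc: "continuous_on UNIV k"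
    unfolding k\<psi> by (rule bounded_linear.continuous_on[OF bounded_linear_positive_functional[OF pf] cont])
  interpret isometry_group "\<lambda>r (x::'a). k r *\<^sub>C x"
    by unfold_locales
       (simp_all add: scaleC_add_right scaleC_scaleC mult.commute kmult k0 norm_scaleC nk
         continuous_on_scaleC[OF kc continuous_on_const])
  have "\<exists>L f. finite L \<and> (\<forall>m\<in>L. f m \<in> cvs.span {1::'a} \<and> (\<forall>r. k r *\<^sub>C f m = exp (\<i> * of_real (m * r)) *\<^sub>C f m)) \<and> 1 = (\<Sum>m\<in>(L::real set). f m)"
    by (rule finite_dimensional_eigenvectors[OF _ refl]) (auto simp: cvs.span_scale cvs.span_base)
  then obtain L f where Lf: "finite (L::real set) \<and> (\<forall>m\<in>L. f m \<in> cvs.span {1::'a} \<and> (\<forall>r. k r *\<^sub>C f m = exp (\<i> * of_real (m * r)) *\<^sub>C f m)) \<and> 1 = (\<Sum>m\<in>L. f m)"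
    by (elim exE)
  have "\<exists>m\<in>L. f m \<noteq> 0"
  proof (rule ccontr)
    assume "\<not> ?thesis"
    then have "(\<Sum>m\<in>L. f m) = 0" by simp
    then show False using Lf by simp
  qed
  then obtain m where m: "m \<in> L" "f m \<noteq> 0" by blast
  have "k r = exp (\<i> * of_real (m * r))" for r
  proof -
    have "(k r - exp (\<i> * of_real (m * r))) *\<^sub>C f m = 0"
      unfolding scaleC_diff_left using Lf m(1) by (metis right_minus_eq)
    then show ?thesis using m(2) by simp
  qed
  then show thesis using that k by metis
qed

section \<open>Perturbation of KMS states\<close>

lemma KMS_iff_strip_fun:
  "KMS c \<alpha> \<omega> \<longleftrightarrow> state \<omega> \<and> (\<forall>x y. \<exists>F. strip_fun c F (\<lambda>t. \<omega> (x * \<alpha> t y)) (\<lambda>t. \<omega> (\<alpha> t y * x)))"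
  unfolding KMS_def strip_fun_def ..

lemma entire_strip_fun:
  assumes "G holomorphic_on UNIV" and "\<And>z. z \<in> strip c \<Longrightarrow> norm (G z) \<le> M"
  shows "strip_fun c G (\<lambda>t. G (of_real t)) (\<lambda>t. G (of_real t + \<i> * of_real c))"
proof -
  have "bounded (G ` strip c)" using assms(2) by (auto intro!: boundedI)
  moreover have "continuous_on (strip c) G"
    using assms(1) holomorphic_on_imp_continuous_on holomorphic_on_subset subset_UNIV by metis
  moreover have "G holomorphic_on interior (strip c)"
    using assms(1) holomorphic_on_subset subset_UNIV by metis
  ultimately show ?thesis by (simp add: strip_fun_def)
qed

lemma strip_Im_bound:
  assumes c: "c \<noteq> 0" and "z \<in> strip c"
  shows "\<bar>Im z\<bar> \<le> \<bar>c\<bar>"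
proof -
  have "\<bar>Im z / c\<bar> \<le> 1" using assms(2) by (auto simp: strip_def)
  then show ?thesis using c by (simp add: abs_divide divide_le_eq_1)
qed

lemma norm_exp_eigen_le:
  assumes "c \<noteq> 0" "z \<in> strip c"
  shows "norm (exp (\<i> * of_real m * z)) \<le> exp (\<bar>m\<bar> * \<bar>c\<bar>)"
proof -
  have "\<bar>m * Im z\<bar> \<le> \<bar>m\<bar> * \<bar>c\<bar>"
    unfolding abs_mult using strip_Im_bound[OF assms] by (rule mult_left_mono) simp
  then show ?thesis by (simp add: norm_exp_eq_Re)
qed

lemma norm_mult4_le: "norm (a * b * d * e) \<le> norm a * norm b * norm d * norm (e::'a::cstar_algebra)"
  by (meson norm_mult_ineq mult_right_mono norm_ge_zero order_trans)

lemma norm_mult3_le: "norm (a * b * d) \<le> norm a * norm b * norm (d::'a::cstar_algebra)"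
  by (meson norm_mult_ineq mult_right_mono norm_ge_zero order_trans)

text \<open>The flow is kept general because the locale is instantiated with \<alpha> and with its
  conjugates by \<open>\<gamma> 0\<close> and \<open>\<gamma> 1\<close>.\<close>

locale kms_system =
  fixes c :: real and \<sigma> :: "real \<Rightarrow> 'a::cstar_algebra \<Rightarrow> 'a" and \<psi> :: "'a \<Rightarrow> complex"
  assumes c0: "c \<noteq> 0" and flow: "flow \<sigma>" and dense: "closure (eigen_sums \<sigma>) = UNIV"
    and kms: "KMS c \<sigma> \<psi>" and simple: "simple_cstar TYPE('a)"
begin

lemma st: "state \<psi>" and pf: "positive_functional \<psi>" and one: "\<psi> 1 = 1"
  using kms by (auto simp: KMS_def state_iff_positive_functional)

lemmas P = positive_functionalD[OF pf]
lemmas S = flow_simps[OF flow]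
lemmas S_mult = S(3) and S_star = S(4)

lemma bound: "norm (\<psi> a) \<le> 2 * norm a"
  using positive_functional_bound[OF pf, of a] by (simp add: one)

lemma kms_fun: "\<exists>F. strip_fun c F (\<lambda>t. \<psi> (x * \<sigma> t y)) (\<lambda>t. \<psi> (\<sigma> t y * x))"
  using kms by (simp add: KMS_iff_strip_fun)

lemma \<sigma>_eigen: "eigenvector \<sigma> m e \<Longrightarrow> \<sigma> r e = exp (\<i> * of_real m * of_real r) *\<^sub>C e"
  by (simp add: eigenvector_def mult.assoc)

lemma exp_ic: "exp (\<i> * of_real m * (\<i> * of_real c)) = of_real (exp (- m * c))"
proof -
  have "\<i> * of_real m * (\<i> * of_real c) = of_real (- m * c)" by (simp add: complex_eq_iff)
  then show ?thesis by (simp only: exp_of_real)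
qed

text \<open>The orbit of e is explicit, so the KMS function can only be
  \<open>exp (i m z) \<psi> (x * e)\<close> at the far edge; its value at ic gives the
  factor.\<close>

lemma eigen_kms:
  assumes e: "eigenvector \<sigma> m e"
  shows "\<psi> (e * x) = of_real (exp (- m * c)) * \<psi> (x * e)"
proof -
  obtain F where F: "strip_fun c F (\<lambda>t. \<psi> (x * \<sigma> t e)) (\<lambda>t. \<psi> (\<sigma> t e * x))" using kms_fun by blast
  define G where "G z = exp (\<i> * of_real m * z) * \<psi> (x * e)" for z
  have "G holomorphic_on UNIV" unfolding G_def by (intro holomorphic_intros)
  moreover have "norm (G z) \<le> exp (\<bar>m\<bar> * \<bar>c\<bar>) * norm (\<psi> (x * e))" if "z \<in> strip c" for z
    unfolding G_def norm_mult using norm_exp_eigen_le[OF c0 that] by (rule mult_right_mono) simp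
  ultimately have "strip_fun c G (\<lambda>t. G (of_real t)) (\<lambda>t. G (of_real t + \<i> * of_real c))"
    by (rule entire_strip_fun)
  moreover have "(\<lambda>t. G (of_real t)) = (\<lambda>t. \<psi> (x * \<sigma> t e))"
    by (simp add: G_def \<sigma>_eigen[OF e] scaleC_mult_right P(2))
  ultimately have "G (of_real 0 + \<i> * of_real c) = \<psi> (\<sigma> 0 e * x)"
    using strip_fun_unique[OF c0 F] by metis
  then show ?thesis by (simp add: G_def exp_ic flowD(2)[OF flow])
qed

lemma eigen_zero:
  assumes e: "eigenvector \<sigma> m e" and m: "m \<noteq> 0"
  shows "\<psi> e = 0"
proof -
  have "\<psi> e = of_real (exp (- m * c)) * \<psi> e" using eigen_kms[OF e, of 1] by simp
  then have "of_real (exp (- m * c)) = (1::complex) \<or> \<psi> e = 0" by auto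
  moreover have "exp (- m * c) \<noteq> 1" using m c0 by simp
  ultimately show ?thesis by (metis of_real_eq_1_iff)
qed

lemma eigen_sumsE:
  assumes "y \<in> eigen_sums \<sigma>"
  obtains L f where "finite (L::real set)" "\<forall>m\<in>L. eigenvector \<sigma> m (f m)" "y = (\<Sum>m\<in>L. f m)"
  using assms unfolding eigen_sums_def by blast

lemma dense_closed:
  assumes "closed T" "eigen_sums \<sigma> \<subseteq> T"
  shows "x \<in> T"
  using closure_minimal[OF assms(2,1)] dense by blast

lemma cont_\<sigma>: "continuous_on A (\<sigma> t)"
  by (rule linear_continuous_on[OF bounded_linear_star_aut[OF flowD(1)[OF flow]]])

lemma cont_\<psi>: "continuous_on A f \<Longrightarrow> continuous_on A (\<lambda>x. \<psi> (f x))"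
  by (rule bounded_linear.continuous_on[OF bounded_linear_positive_functional[OF pf]])

lemma invariant: "\<psi> (\<sigma> t y) = \<psi> y"
proof -
  have "y \<in> {y. \<psi> (\<sigma> t y) = \<psi> y}"
  proof (rule dense_closed)
    show "closed {y. \<psi> (\<sigma> t y) = \<psi> y}"
      by (intro closed_Collect_eq cont_\<psi> cont_\<sigma> continuous_on_id)
    show "eigen_sums \<sigma> \<subseteq> {y. \<psi> (\<sigma> t y) = \<psi> y}"
    proof
      fix y assume "y \<in> eigen_sums \<sigma>"
      then obtain L f where L: "finite (L::real set)" "\<forall>m\<in>L. eigenvector \<sigma> m (f m)" "y = (\<Sum>m\<in>L. f m)"
        by (rule eigen_sumsE)
      have "\<psi> (\<sigma> t (f m)) = \<psi> (f m)" if m: "m \<in> L" for m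
      proof (cases "m = 0")
        case True
        then show ?thesis using L(2) m \<sigma>_eigen[of m "f m" t] by simp
      next
        case False
        then show ?thesis using L(2) m eigen_zero[of m "f m"] \<sigma>_eigen[of m "f m" t] by (simp add: P(2))
      qed
      then show "y \<in> {y. \<psi> (\<sigma> t y) = \<psi> y}"
        by (simp add: L(3) star_aut_sum[OF flowD(1)[OF flow]] P(9))
    qed
  qed
  then show ?thesis by simp
qed

text \<open>\<open>V\<close> extends the cocycle
  \<open>inv_el w * \<kappa> t * \<sigma> t w\<close>, which is cohomologous to \<kappa> but need
  not be unitary. When \<sigma> is the conjugated flow and \<kappa> the adjoint of an associated
  cocycle, this is the relation of \<open>Phi_data\<close> multiplied on the right by
  \<open>\<sigma> t w\<close>.\<close>

definition perturbation :: "(real \<Rightarrow> 'a) \<Rightarrow> 'a \<Rightarrow> (complex \<Rightarrow> 'a) \<Rightarrow> bool" where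
  "perturbation \<kappa> w V \<longleftrightarrow> cocycle \<sigma> \<kappa> \<and> invertible_el w \<and> entire_fun V \<and>
     (\<forall>t. \<kappa> t * \<sigma> t w = w * V (of_real t))"

text \<open>The unnormalised functional in the definition of \<open>Phi\<close>. If \<kappa> itself
  is analytic, w = 1 gives the usual perturbed functional
  \<open>\<psi> (a * \<kappa> (ic))\<close>.\<close>

definition perturbed :: "'a \<Rightarrow> (complex \<Rightarrow> 'a) \<Rightarrow> 'a \<Rightarrow> complex" where
  "perturbed w V a = \<psi> (inv_el w * a * w * V (\<i> * of_real c))"

lemma perturbation_trivial: "perturbation (\<lambda>t. 1) 1 (\<lambda>z. 1)" "perturbed 1 (\<lambda>z. 1) = \<psi>"
  by (auto simp: perturbation_def perturbed_def cocycle_def unitary_def S entire_fun_const inv_el_one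
      intro: invertible_elI[of 1 1])

end

lemma cocycleD:
  assumes "flow \<sigma>" "cocycle \<sigma> \<kappa>"
  shows "continuous_on UNIV \<kappa>" "cstar (\<kappa> t) * \<kappa> t = 1" "\<kappa> t * cstar (\<kappa> t) = 1"
    "\<kappa> (s + t) = \<kappa> s * \<sigma> s (\<kappa> t)" "\<kappa> 0 = 1" "norm (\<kappa> t) \<le> 1" "unitary (\<kappa> t)"
proof -
  show *: "continuous_on UNIV \<kappa>" "\<And>t. cstar (\<kappa> t) * \<kappa> t = 1" "\<kappa> t * cstar (\<kappa> t) = 1"
    "\<And>s t. \<kappa> (s + t) = \<kappa> s * \<sigma> s (\<kappa> t)" and u: "unitary (\<kappa> t)"
    using assms(2) by (auto simp: cocycle_def unitary_def)
  have "\<kappa> 0 = \<kappa> 0 * \<kappa> 0" using *(4)[of 0 0] flowD(2)[OF assms(1)] by simp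
  then have "cstar (\<kappa> 0) * \<kappa> 0 = cstar (\<kappa> 0) * \<kappa> 0 * \<kappa> 0" by (metis mult.assoc)
  then show "\<kappa> 0 = 1" by (simp add: *(2))
  show "norm (\<kappa> t) \<le> 1" by (rule norm_unitary_le[OF u])
qed

section \<open>Analyticity and positivity of one perturbation\<close>

locale kms_perturbation = kms_system +
  fixes \<kappa> :: "real \<Rightarrow> 'a::cstar_algebra" and w :: 'a and V :: "complex \<Rightarrow> 'a"
  assumes pert: "perturbation \<kappa> w V"
begin

lemma coc: "cocycle \<sigma> \<kappa>" and inv: "invertible_el w" and ent: "entire_fun V"
  and \<kappa>w: "\<kappa> t * \<sigma> t w = w * V (of_real t)"
  using pert by (auto simp: perturbation_def)

lemmas K = cocycleD[OF flow coc]
lemmas wi = inv_el[OF inv] inv_el_cancel[OF inv]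

lemma V_real: "V (of_real t) = inv_el w * (\<kappa> t * \<sigma> t w)"
  unfolding \<kappa>w by (simp add: wi)

text \<open>At real z this is the cocycle identity for
  \<open>inv_el w * \<kappa> t * \<sigma> t w\<close>, and both sides are entire in z.\<close>

lemma V_shift: "V (of_real t + z) = V (of_real t) * \<sigma> t (V z)"
proof -
  define G where "G z = V (of_real t + 1 * z) - V (of_real t) * \<sigma> t (V z)" for z
  have "entire_fun (\<lambda>z. \<sigma> t (V z))"
    by (rule entire_fun_linear[OF ent bounded_linear_star_aut[OF flowD(1)[OF flow]] S(2)])
  then have "entire_fun G"
    unfolding G_def by (intro entire_fun_diff entire_fun_affine[OF ent] entire_fun_cmult(1)) simp
  moreover have "G (of_real s) = 0" for s
  proof -
    have "w * V (of_real (t + s)) = \<kappa> t * \<sigma> t (\<kappa> s * \<sigma> s w)"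
      unfolding \<kappa>w[symmetric] by (simp add: K(4) flowD(3)[OF flow] S mult.assoc)
    also have "\<dots> = w * (V (of_real t) * \<sigma> t (V (of_real s)))"
      unfolding \<kappa>w S_mult mult.assoc[symmetric] ..
    finally have "inv_el w * (w * V (of_real (t + s))) = inv_el w * (w * (V (of_real t) * \<sigma> t (V (of_real s))))"
      by simp
    then show ?thesis by (simp add: wi G_def)
  qed
  ultimately have "G z = 0" by (rule entire_fun_zero_on_reals[OF simple st])
  then show ?thesis by (simp add: G_def)
qed

text \<open>A real translation changes V only by a uniformly bounded left factor and an isometry, so
  a bound on a compact imaginary segment suffices.\<close>

lemma V_bounded: "\<exists>M. \<forall>z. \<bar>Im z\<bar> \<le> \<bar>c\<bar> \<longrightarrow> norm (V z) \<le> M"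
proof -
  have "compact ((\<lambda>y. V (\<i> * of_real y)) ` {-\<bar>c\<bar>..\<bar>c\<bar>})"
  proof (rule compact_continuous_image)
    show "continuous_on {-\<bar>c\<bar>..\<bar>c\<bar>} (\<lambda>y. V (\<i> * of_real y))"
      by (rule continuous_on_compose2[OF entire_fun_continuous_on[OF ent, of UNIV]]) (auto intro!: continuous_intros)
  qed simp
  from compact_imp_bounded[OF this]
  obtain B where B0: "\<forall>v\<in>(\<lambda>y. V (\<i> * of_real y)) ` {-\<bar>c\<bar>..\<bar>c\<bar>}. norm v \<le> B"
    unfolding bounded_iff by (elim exE)
  have B: "norm (V (\<i> * of_real y)) \<le> B" if "\<bar>y\<bar> \<le> \<bar>c\<bar>" for y
    using bspec[OF B0 imageI[of y]] that by (simp add: abs_le_iff)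
  have "norm (V z) \<le> norm (inv_el w) * norm w * B" if z: "\<bar>Im z\<bar> \<le> \<bar>c\<bar>" for z
  proof -
    have "z = of_real (Re z) + \<i> * of_real (Im z)" by (simp add: complex_eq_iff)
    then have "V z = V (of_real (Re z)) * \<sigma> (Re z) (V (\<i> * of_real (Im z)))" using V_shift by metis
    then have "norm (V z) \<le> norm (V (of_real (Re z))) * norm (V (\<i> * of_real (Im z)))"
      using norm_mult_ineq flowD(7)[OF flow] by metis
    moreover have "norm (V (of_real (Re z))) \<le> norm (inv_el w) * norm w"
    proof -
      have "norm (\<kappa> (Re z) * \<sigma> (Re z) w) \<le> 1 * norm w"
        using norm_mult_ineq[of "\<kappa> (Re z)" "\<sigma> (Re z) w"] mult_right_mono[OF K(6)[of "Re z"], of "norm w"]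
        by (simp add: flowD(7)[OF flow])
      then show ?thesis
        unfolding V_real using norm_mult_ineq[of "inv_el w" "\<kappa> (Re z) * \<sigma> (Re z) w"]
          mult_left_mono[of "norm (\<kappa> (Re z) * \<sigma> (Re z) w)" "norm w" "norm (inv_el w)"] by simp
    qed
    ultimately show ?thesis
      using mult_mono[OF _ B[OF z], of "norm (V (of_real (Re z)))" "norm (inv_el w) * norm w"] by fastforce
  qed
  then show ?thesis by blast
qed

text \<open>The KMS condition with an additional entire factor V, which is not the orbit of an
  element. For an eigenvector in place of Y the extension is explicit; density does the
  rest.\<close>

lemma analytic_extension:
  "\<exists>F. strip_fun c F (\<lambda>r. \<psi> (X * V (of_real r) * \<sigma> r Y)) (\<lambda>r. \<psi> (\<sigma> r Y * X * V (of_real r + \<i> * of_real c)))"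
proof -
  obtain M where M: "\<And>z. \<bar>Im z\<bar> \<le> \<bar>c\<bar> \<Longrightarrow> norm (V z) \<le> M" using V_bounded by blast
  show ?thesis
  proof (rule strip_fun_dense[OF c0 dense, where K = "2 * (norm X * M)"
        and f = "\<lambda>Y r. \<psi> (X * V (of_real r) * \<sigma> r Y)" and g = "\<lambda>Y r. \<psi> (\<sigma> r Y * X * V (of_real r + \<i> * of_real c))"])
    fix y assume "y \<in> eigen_sums \<sigma>"
    then obtain L f where L: "finite (L::real set)" "\<forall>m\<in>L. eigenvector \<sigma> m (f m)" "y = (\<Sum>m\<in>L. f m)"
      by (rule eigen_sumsE)
    define G where "G m z = exp (\<i> * of_real m * z) * \<psi> (X * V z * f m)" for m z
    have G: "strip_fun c (G m) (\<lambda>r. \<psi> (X * V (of_real r) * \<sigma> r (f m)))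
        (\<lambda>r. \<psi> (\<sigma> r (f m) * X * V (of_real r + \<i> * of_real c)))" if m: "m \<in> L" for m
    proof -
      have ev: "eigenvector \<sigma> m (f m)" using L m by blast
      have "G m holomorphic_on UNIV"
        unfolding G_def
        by (intro holomorphic_on_mult holomorphic_functional[OF ent bounded_linear_functional_mult[OF pf]])
           (intro holomorphic_intros)
      moreover have "norm (G m z) \<le> exp (\<bar>m\<bar> * \<bar>c\<bar>) * (2 * (norm X * M * norm (f m)))" if z: "z \<in> strip c" for z
        unfolding G_def norm_mult
      proof (rule mult_mono[OF norm_exp_eigen_le[OF c0 z]])
        have "norm (X * V z * f m) \<le> norm X * norm (V z) * norm (f m)" by (rule norm_mult3_le)
        also have "\<dots> \<le> norm X * M * norm (f m)"
          using M[OF strip_Im_bound[OF c0 z]] by (intro mult_right_mono mult_left_mono) auto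
        finally show "norm (\<psi> (X * V z * f m)) \<le> 2 * (norm X * M * norm (f m))"
          using bound[of "X * V z * f m"] by linarith
      qed auto
      ultimately have "strip_fun c (G m) (\<lambda>t. G m (of_real t)) (\<lambda>t. G m (of_real t + \<i> * of_real c))"
        by (rule entire_strip_fun)
      moreover have "(\<lambda>t. G m (of_real t)) = (\<lambda>r. \<psi> (X * V (of_real r) * \<sigma> r (f m)))"
        by (simp add: G_def \<sigma>_eigen[OF ev] scaleC_mult_right P(2))
      moreover have "(\<lambda>t. G m (of_real t + \<i> * of_real c)) = (\<lambda>r. \<psi> (\<sigma> r (f m) * X * V (of_real r + \<i> * of_real c)))"
      proof
        fix r
        have "\<psi> (\<sigma> r (f m) * X * V (of_real r + \<i> * of_real c))
            = exp (\<i> * of_real m * of_real r) * \<psi> (f m * (X * V (of_real r + \<i> * of_real c)))"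
          by (simp add: \<sigma>_eigen[OF ev] scaleC_mult_left P(2) mult.assoc)
        also have "\<psi> (f m * (X * V (of_real r + \<i> * of_real c)))
            = of_real (exp (- m * c)) * \<psi> (X * V (of_real r + \<i> * of_real c) * f m)"
          by (rule eigen_kms[OF ev])
        also have "exp (\<i> * of_real m * of_real r) * \<dots> = G m (of_real r + \<i> * of_real c)"
          by (simp add: G_def distrib_left exp_add exp_ic)
        finally show "G m (of_real r + \<i> * of_real c) = \<psi> (\<sigma> r (f m) * X * V (of_real r + \<i> * of_real c))" ..
      qed
      ultimately show ?thesis by simp
    qed
    show "\<exists>F. strip_fun c F (\<lambda>r. \<psi> (X * V (of_real r) * \<sigma> r y)) (\<lambda>r. \<psi> (\<sigma> r y * X * V (of_real r + \<i> * of_real c)))"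
      using strip_fun_sum[of L c G, OF G]
      unfolding L(3) star_aut_sum[OF flowD(1)[OF flow]] sum_distrib_left sum_distrib_right P(9) by blast
  next
    fix y y' r
    have "\<psi> (X * V (of_real r) * \<sigma> r y) - \<psi> (X * V (of_real r) * \<sigma> r y') = \<psi> (X * V (of_real r) * \<sigma> r (y - y'))"
      by (simp add: S P right_diff_distrib)
    moreover have "norm (X * V (of_real r) * \<sigma> r (y - y')) \<le> norm X * M * norm (y - y')"
      using norm_mult3_le[of X "V (of_real r)" "\<sigma> r (y - y')"] M[of "of_real r"]
        mult_right_mono[OF mult_left_mono[OF M[of "of_real r"], of "norm X"], of "norm (y - y')"]
      by (simp add: flowD(7)[OF flow])
    ultimately show "norm (\<psi> (X * V (of_real r) * \<sigma> r y) - \<psi> (X * V (of_real r) * \<sigma> r y')) \<le> 2 * (norm X * M) * norm (y - y')"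
      using bound[of "X * V (of_real r) * \<sigma> r (y - y')"] by simp
    let ?W = "V (of_real r + \<i> * of_real c)"
    have "\<psi> (\<sigma> r y * X * ?W) - \<psi> (\<sigma> r y' * X * ?W) = \<psi> (\<sigma> r (y - y') * X * ?W)"
      by (simp add: S P left_diff_distrib)
    moreover have "norm (\<sigma> r (y - y') * X * ?W) \<le> norm (y - y') * norm X * M"
      using norm_mult3_le[of "\<sigma> r (y - y')" X ?W] mult_left_mono[OF M[of "of_real r + \<i> * of_real c"], of "norm (y - y') * norm X"]
      by (simp add: flowD(7)[OF flow])
    ultimately show "norm (\<psi> (\<sigma> r y * X * ?W) - \<psi> (\<sigma> r y' * X * ?W)) \<le> 2 * (norm X * M) * norm (y - y')"
      using bound[of "\<sigma> r (y - y') * X * ?W"] by (simp add: mult_ac)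
  qed
qed

lemma perturbed_linear: "perturbed w V (a + b) = perturbed w V a + perturbed w V b"
    "perturbed w V (k *\<^sub>C a) = k * perturbed w V a"
  by (simp_all add: perturbed_def distrib_left distrib_right scaleC_mult_left scaleC_mult_right P)

lemma cont_perturbed: "continuous_on A f \<Longrightarrow> continuous_on A (\<lambda>x. perturbed w V (f x))"
  unfolding perturbed_def by (intro cont_\<psi> continuous_intros)

text \<open>Both sides of \<open>\<psi> (Y(- cnj a)\<^sup>* Y(a)) = \<psi> (y\<^sup>* Y(2 a))\<close>, where \<open>Y(t) = \<kappa>\<^sub>t \<sigma>\<^sub>t(y)\<close>, are entire
  in \<open>a\<close> and agree for real \<open>a\<close>; at \<open>a = i c / 2\<close> the left side is visibly positive and the
  right side is the perturbed functional at \<open>y y\<^sup>*\<close>.\<close>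

lemma perturbed_positive_dense:
  assumes "y' \<in> eigen_sums \<sigma>"
  shows "Im (perturbed w V ((w * y') * cstar (w * y'))) = 0 \<and> Re (perturbed w V ((w * y') * cstar (w * y'))) \<ge> 0"
proof -
  obtain L f where L: "finite (L::real set)" "\<forall>m\<in>L. eigenvector \<sigma> m (f m)" "y' = (\<Sum>m\<in>L. f m)"
    using assms by (rule eigen_sumsE)
  define E where "E z = (\<Sum>m\<in>L. exp (\<i> * of_real m * z) *\<^sub>C f m)" for z
  \<comment> \<open>The analytic continuation of \<open>\<kappa> t * \<sigma> t y\<close> for
    \<open>y = w * y'\<close>: the factor w is what lets V absorb \<kappa>.\<close>
  define Y where "Y z = w * V z * E z" for z
  define y where "y = w * y'"
  have "entire_fun E"
    unfolding E_def by (intro entire_fun_sum entire_fun_scaleC[OF _ entire_fun_const]) (intro holomorphic_intros)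
  then have entY: "entire_fun Y"
    unfolding Y_def by (rule entire_fun_mult[OF entire_fun_cmult(1)[OF ent]])
  have E_real: "E (of_real t) = \<sigma> t y'" for t
    unfolding E_def L(3) star_aut_sum[OF flowD(1)[OF flow]] using L(2) by (intro sum.cong) (auto simp: \<sigma>_eigen)
  have Y_real: "Y (of_real t) = \<kappa> t * \<sigma> t y" for t
    unfolding Y_def E_real \<kappa>w[symmetric] y_def by (simp add: S mult.assoc)
  have Y0: "Y 0 = y" using Y_real[of 0] by (simp add: K(5) flowD(2)[OF flow])
  define h where "h a = \<psi> (cstar (Y (0 + (-1) * cnj a)) * Y a) - \<psi> (cstar y * Y (0 + 2 * a))" for a
  have e1: "entire_fun (\<lambda>a. cstar (Y (0 + (-1) * cnj a)) * Y a)"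
    by (rule entire_fun_mult[OF entire_fun_cstar_cnj[OF entire_fun_affine[OF entY]] entY]) simp
  have e2: "entire_fun (\<lambda>a. cstar y * Y (0 + 2 * a))"
    by (rule entire_fun_cmult(1)[OF entire_fun_affine[OF entY]]) simp
  have "h holomorphic_on UNIV"
    unfolding h_def
    by (intro holomorphic_on_diff holomorphic_functional[OF e1 bounded_linear_positive_functional[OF pf] P(2)]
        holomorphic_functional[OF e2 bounded_linear_positive_functional[OF pf] P(2)])
  moreover have "h (of_real t) = 0" for t
  proof -
    have "\<kappa> t * \<sigma> t y = \<kappa> (- t) * \<sigma> (- t) (\<kappa> (2 * t) * \<sigma> (2 * t) y)"
      using K(4)[of "- t" "2 * t"] flowD(3)[OF flow, of "- t" "2 * t" y] by (simp add: S mult.assoc)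
    then have "Y (of_real t) = \<kappa> (- t) * \<sigma> (- t) (Y (of_real (2 * t)))" by (simp only: Y_real)
    moreover have "cstar (Y (of_real (- t))) = \<sigma> (- t) (cstar y) * cstar (\<kappa> (- t))"
      by (simp only: Y_real cstar_mult S_star)
    ultimately have "cstar (Y (of_real (- t))) * Y (of_real t)
        = \<sigma> (- t) (cstar y) * (cstar (\<kappa> (- t)) * \<kappa> (- t)) * \<sigma> (- t) (Y (of_real (2 * t)))"
      by (simp only: mult.assoc)
    also have "\<dots> = \<sigma> (- t) (cstar y * Y (of_real (2 * t)))" by (simp add: K(2) S)
    finally have "\<psi> (cstar (Y (of_real (- t))) * Y (of_real t)) = \<psi> (cstar y * Y (of_real (2 * t)))"
      by (simp only: invariant)
    then show ?thesis by (simp add: h_def)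
  qed
  ultimately have "h (\<i> * of_real (c / 2)) = 0" by (rule entire_zero_on_reals)
  then have eq: "\<psi> (cstar y * Y (\<i> * of_real c)) = \<psi> (cstar (Y (\<i> * of_real (c / 2))) * Y (\<i> * of_real (c / 2)))"
    by (simp add: h_def)
  have "perturbed w V (y * cstar y) = \<psi> (y' * (cstar y * w * V (\<i> * of_real c)))"
    by (simp add: perturbed_def y_def wi mult.assoc)
  also have "\<dots> = (\<Sum>m\<in>L. \<psi> (f m * (cstar y * w * V (\<i> * of_real c))))"
    by (simp add: L(3) sum_distrib_right P(9))
  \<comment> \<open>The eigenvectors constituting y' move to the right of V; the factors
    \<open>exp (- m * c)\<close> turn y' into \<open>E (ic)\<close>.\<close>
  also have "\<dots> = (\<Sum>m\<in>L. of_real (exp (- m * c)) * \<psi> (cstar y * w * V (\<i> * of_real c) * f m))"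
    using L(2) by (intro sum.cong refl eigen_kms) auto
  also have "\<dots> = \<psi> (cstar y * Y (\<i> * of_real c))"
    unfolding Y_def E_def exp_ic by (simp add: sum_distrib_left P(9) scaleC_mult_right P(2) mult.assoc)
  finally show ?thesis using P(7,8)[of "Y (\<i> * of_real (c / 2))"] eq by (simp add: y_def)
qed

lemma perturbed_positive: "positive_functional (perturbed w V)"
  unfolding positive_functional_def
proof (intro conjI allI)
  fix a b k
  show "perturbed w V (a + b) = perturbed w V a + perturbed w V b"
    "perturbed w V (k *\<^sub>C a) = k * perturbed w V a" by (rule perturbed_linear)+
next
  fix x
  let ?T = "{y'. Im (perturbed w V ((w * y') * cstar (w * y'))) = 0 \<and> Re (perturbed w V ((w * y') * cstar (w * y'))) \<ge> 0}"
  \<comment> \<open>With this y' the product \<open>(w * y') * cstar (w * y')\<close> is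
    \<open>cstar x * x\<close>.\<close>
  have "inv_el w * cstar x \<in> ?T"
  proof (rule dense_closed)
    show "closed ?T"
      unfolding Collect_conj_eq
      by (intro closed_Int closed_Collect_eq closed_Collect_le continuous_intros cont_perturbed
          bounded_linear.continuous_on[OF bounded_linear_cstar])
    show "eigen_sums \<sigma> \<subseteq> ?T" using perturbed_positive_dense by blast
  qed
  then show "Im (perturbed w V (cstar x * x)) = 0" "Re (perturbed w V (cstar x * x)) \<ge> 0"
    by (simp_all add: wi)
qed

end

section \<open>Two perturbations compared\<close>

context kms_system
begin

text \<open>The relative KMS condition. With equal cocycles it makes the perturbed functional
  satisfy the KMS condition for the perturbed flow; with a trivial second cocycle it ties the
  perturbed functional to \<psi>; with two neighbouring cocycles it compares the functionals along
  the path.\<close>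

lemma perturbed_relation:
  assumes p1: "perturbation \<kappa>1 w1 V1" and p2: "perturbation \<kappa>2 w2 V2"
  shows "\<exists>F. strip_fun c F (\<lambda>r. perturbed w2 V2 (x * (\<kappa>1 r * \<sigma> r y * cstar (\<kappa>2 r))))
      (\<lambda>r. perturbed w1 V1 (\<kappa>1 r * \<sigma> r y * cstar (\<kappa>2 r) * x))"
proof -
  interpret A: kms_perturbation c \<sigma> \<psi> \<kappa>1 w1 V1 by unfold_locales (rule p1)
  interpret B: kms_perturbation c \<sigma> \<psi> \<kappa>2 w2 V2 by unfold_locales (rule p2)
  obtain M1 where M1: "\<And>z. \<bar>Im z\<bar> \<le> \<bar>c\<bar> \<Longrightarrow> norm (V1 z) \<le> M1" using A.V_bounded by blast
  obtain M2 where M2: "\<And>z. \<bar>Im z\<bar> \<le> \<bar>c\<bar> \<Longrightarrow> norm (V2 z) \<le> M2" using B.V_bounded by blast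
  have M0: "M1 \<ge> 0" "M2 \<ge> 0" using order_trans[OF norm_ge_zero M1[of 0]] order_trans[OF norm_ge_zero M2[of 0]] by simp_all
  define ic where "ic = \<i> * complex_of_real c"
  \<comment> \<open>Writing y as \<open>w1 * y' * cstar w2\<close> turns \<kappa>1 and \<kappa>2
    into V1 and V2, so that U extends analytically when y' is an eigenvector; the adjoint factor
    extends as \<open>cstar (V2 (cnj z))\<close>.\<close>
  define U where "U r y' = \<kappa>1 r * \<sigma> r (w1 * y' * cstar w2) * cstar (\<kappa>2 r)" for r y'
  have U: "U r y' = w1 * V1 (of_real r) * \<sigma> r y' * cstar (V2 (of_real r)) * cstar w2" for r y'
  proof -
    have "U r y' = (\<kappa>1 r * \<sigma> r w1) * \<sigma> r y' * cstar (\<kappa>2 r * \<sigma> r w2)"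
      by (simp add: U_def S cstar_mult mult.assoc)
    then show ?thesis unfolding A.\<kappa>w B.\<kappa>w by (simp add: cstar_mult mult.assoc)
  qed
  have nU: "norm (U r y') \<le> norm w1 * norm w2 * norm y'" for r y'
  proof -
    have "norm (U r y') \<le> norm (\<kappa>1 r) * norm (w1 * y' * cstar w2) * norm (\<kappa>2 r)"
      unfolding U_def using norm_mult3_le[of "\<kappa>1 r" "\<sigma> r (w1 * y' * cstar w2)" "cstar (\<kappa>2 r)"]
      by (simp add: flowD(7)[OF flow])
    also have "\<dots> = norm (w1 * y' * cstar w2)"
      using norm_unitary[OF A.K(7)] norm_unitary[OF B.K(7)] by simp
    also have "\<dots> \<le> norm w1 * norm y' * norm w2" using norm_mult3_le[of w1 y' "cstar w2"] by simp
    finally show ?thesis by (simp add: mult_ac)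
  qed
  have U_diff: "U r y - U r y' = U r (y - y')" for r y y'
    by (simp add: U_def S right_diff_distrib left_diff_distrib)
  let ?b1 = "2 * Re (perturbed w1 V1 1)" and ?b2 = "2 * Re (perturbed w2 V2 1)"
  let ?K = "(?b1 + ?b2) * (norm x * (norm w1 * norm w2))"
  note pA = positive_functional_bound[OF A.perturbed_positive] and pB = positive_functional_bound[OF B.perturbed_positive]
  have b0: "?b1 \<ge> 0" "?b2 \<ge> 0"
    using positive_functional_one(2)[OF A.perturbed_positive] positive_functional_one(2)[OF B.perturbed_positive] by simp_all
  have ext: "\<exists>F. strip_fun c F (\<lambda>r. perturbed w2 V2 (x * U r y')) (\<lambda>r. perturbed w1 V1 (U r y' * x))" for y'
  proof (rule strip_fun_dense[OF c0 dense, where K = ?K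
        and f = "\<lambda>y' r. perturbed w2 V2 (x * U r y')" and g = "\<lambda>y' r. perturbed w1 V1 (U r y' * x)"])
    fix y y' r
    have n: "norm (x * U r (y - y')) \<le> norm x * (norm w1 * norm w2 * norm (y - y'))"
        "norm (U r (y - y') * x) \<le> norm x * (norm w1 * norm w2 * norm (y - y'))"
      using norm_mult_ineq[of x "U r (y - y')"] norm_mult_ineq[of "U r (y - y')" x]
        mult_left_mono[OF nU[of r "y - y'"], of "norm x"] by (simp_all add: mult.commute[of _ "norm x"])
    have "perturbed w2 V2 (x * U r y) - perturbed w2 V2 (x * U r y') = perturbed w2 V2 (x * U r (y - y'))"
      by (simp add: U_diff[symmetric] right_diff_distrib positive_functionalD[OF B.perturbed_positive])
    also have "norm \<dots> \<le> ?b2 * (norm x * (norm w1 * norm w2 * norm (y - y')))"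
      by (rule order_trans[OF pB mult_left_mono[OF n(1) b0(2)]])
    also have "\<dots> \<le> ?K * norm (y - y')"
      using mult_right_mono[of ?b2 "?b1 + ?b2" "norm x * (norm w1 * norm w2 * norm (y - y'))"] b0 by (simp add: mult_ac)
    finally show "norm (perturbed w2 V2 (x * U r y) - perturbed w2 V2 (x * U r y')) \<le> ?K * norm (y - y')" .
    have "perturbed w1 V1 (U r y * x) - perturbed w1 V1 (U r y' * x) = perturbed w1 V1 (U r (y - y') * x)"
      by (simp add: U_diff[symmetric] left_diff_distrib positive_functionalD[OF A.perturbed_positive])
    also have "norm \<dots> \<le> ?b1 * (norm x * (norm w1 * norm w2 * norm (y - y')))"
      by (rule order_trans[OF pA mult_left_mono[OF n(2) b0(1)]])
    also have "\<dots> \<le> ?K * norm (y - y')"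
      using mult_right_mono[of ?b1 "?b1 + ?b2" "norm x * (norm w1 * norm w2 * norm (y - y'))"] b0 by (simp add: mult_ac)
    finally show "norm (perturbed w1 V1 (U r y * x) - perturbed w1 V1 (U r y' * x)) \<le> ?K * norm (y - y')" .
  next
    fix y' assume "y' \<in> eigen_sums \<sigma>"
    then obtain L f where L: "finite (L::real set)" "\<forall>m\<in>L. eigenvector \<sigma> m (f m)" "y' = (\<Sum>m\<in>L. f m)"
      by (rule eigen_sumsE)
    define X where "X = inv_el w2 * x * w1"
    have single: "\<exists>F. strip_fun c F (\<lambda>r. perturbed w2 V2 (x * U r e)) (\<lambda>r. perturbed w1 V1 (U r e * x))"
      if e: "eigenvector \<sigma> m e" for m e
    proof -
      \<comment> \<open>\<open>D\<close> records the failure of V2 to be unitary: at real s,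
        \<open>cstar (V2 s) * D * V2 s = \<sigma> s D\<close>.\<close>
      define D where "D = cstar w2 * w2"
      \<comment> \<open>At the far edge \<open>perturbed w2 V2\<close> contributes the constant
        factor \<open>V2 (ic)\<close>. To evaluate the result, r is frozen and this factor is made
        to vary with z as well; the value wanted is \<open>G r ic\<close>.\<close>
      define G where "G r z = exp (\<i> * of_real m * z) *
          \<psi> (X * (V1 (of_real r + 1 * z) * e * cstar (V2 (of_real r + 1 * cnj z)) * D * V2 z))" for r :: real and z
      have entG: "entire_fun (\<lambda>z. V1 (of_real r + 1 * z) * e * cstar (V2 (of_real r + 1 * cnj z)) * D * V2 z)" for r :: real
        by (rule entire_fun_mult[OF entire_fun_cmult(2)[OF entire_fun_mult[OF
              entire_fun_cmult(2)[OF entire_fun_affine[OF A.ent]]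
              entire_fun_cstar_cnj[OF entire_fun_affine[OF B.ent]]]] B.ent]) simp_all
      have holG: "G r holomorphic_on UNIV" for r
        unfolding G_def
        using holomorphic_functional[OF entG[of r] bounded_linear_functional_mult[OF pf, where X = X and Z = 1]]
        by (intro holomorphic_on_mult) (auto intro!: holomorphic_intros)
      have bG: "norm (G r z) \<le> exp (\<bar>m\<bar> * \<bar>c\<bar>) * (2 * (norm X * (M1 * norm e * M2 * norm D * M2)))" if z: "z \<in> strip c" for r z
        unfolding G_def norm_mult
      proof (rule mult_mono[OF norm_exp_eigen_le[OF c0 z]])
        note Imz = strip_Im_bound[OF c0 z]
        let ?Q = "V1 (of_real r + 1 * z) * e * cstar (V2 (of_real r + 1 * cnj z)) * D * V2 z"
        have "norm ?Q \<le> norm (V1 (of_real r + 1 * z)) * norm e * norm (V2 (of_real r + 1 * cnj z)) * norm D * norm (V2 z)"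
          using norm_mult_ineq[of "V1 (of_real r + 1 * z) * e * cstar (V2 (of_real r + 1 * cnj z)) * D" "V2 z"]
            mult_right_mono[OF norm_mult4_le[of "V1 (of_real r + 1 * z)" e "cstar (V2 (of_real r + 1 * cnj z))" D], of "norm (V2 z)"]
          by simp
        also have "\<dots> \<le> M1 * norm e * M2 * norm D * M2"
          using Imz M0 by (intro mult_mono M1 M2) auto
        finally have "norm (X * ?Q) \<le> norm X * (M1 * norm e * M2 * norm D * M2)"
          using norm_mult_ineq[of X ?Q] mult_left_mono[of "norm ?Q" _ "norm X"] by (meson norm_ge_zero order_trans)
        then show "norm (\<psi> (X * ?Q)) \<le> 2 * (norm X * (M1 * norm e * M2 * norm D * M2))"
          using bound[of "X * ?Q"] by linarith
      qed auto
      have stripG: "strip_fun c (G r) (\<lambda>t. G r (of_real t)) (\<lambda>t. G r (of_real t + \<i> * of_real c))" for r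
        by (rule entire_strip_fun[OF holG bG])
      \<comment> \<open>For real s the relation for D collapses the factors V2 and leaves exactly
        the function treated in \<open>analytic_extension\<close>, whose value at ic is
        known.\<close>
      have key: "G r ic = \<psi> (V1 (of_real r) * e * cstar (V2 (of_real r)) * D * X * V1 ic)" for r
      proof -
        define Y where "Y = V1 (of_real r) * e * cstar (V2 (of_real r)) * D"
        obtain F where F: "strip_fun c F (\<lambda>s. \<psi> (X * V1 (of_real s) * \<sigma> s Y)) (\<lambda>s. \<psi> (\<sigma> s Y * X * V1 (of_real s + \<i> * of_real c)))"
          using A.analytic_extension by blast
        have "G r (of_real s) = \<psi> (X * V1 (of_real s) * \<sigma> s Y)" for s
        proof -
          have v1: "V1 (of_real r + of_real s) = V1 (of_real s) * \<sigma> s (V1 (of_real r))"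
            using A.V_shift[of s "of_real r"] by (simp add: add.commute)
          have v2: "V2 (of_real r + of_real s) = V2 (of_real s) * \<sigma> s (V2 (of_real r))"
            using B.V_shift[of s "of_real r"] by (simp add: add.commute)
          have "cstar (V2 (of_real s)) * D * V2 (of_real s) = cstar (\<kappa>2 s * \<sigma> s w2) * (\<kappa>2 s * \<sigma> s w2)"
            unfolding B.\<kappa>w D_def by (simp add: cstar_mult mult.assoc)
          also have "\<dots> = \<sigma> s (cstar w2) * (cstar (\<kappa>2 s) * \<kappa>2 s) * \<sigma> s w2"
            by (simp only: cstar_mult S_star mult.assoc)
          also have "\<dots> = \<sigma> s D" by (simp add: B.K(2) D_def S)
          finally have d: "cstar (V2 (of_real s)) * D * V2 (of_real s) = \<sigma> s D" .
          have "G r (of_real s) = \<psi> (X * (V1 (of_real s) * \<sigma> s (V1 (of_real r)) * \<sigma> s e *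
              cstar (\<sigma> s (V2 (of_real r))) * (cstar (V2 (of_real s)) * D * V2 (of_real s))))"
            by (simp add: G_def v1 v2 cstar_mult \<sigma>_eigen[OF e] scaleC_mult_left scaleC_mult_right P(2) mult.assoc)
          then show ?thesis unfolding d Y_def by (simp add: S mult.assoc)
        qed
        then have "(\<lambda>t. G r (of_real t)) = (\<lambda>s. \<psi> (X * V1 (of_real s) * \<sigma> s Y))" by blast
        then have "strip_fun c (G r) (\<lambda>s. \<psi> (X * V1 (of_real s) * \<sigma> s Y)) (\<lambda>t. G r (of_real t + \<i> * of_real c))"
          using stripG[of r] by simp
        from strip_fun_unique[OF c0 this F, of 0] show ?thesis
          by (simp add: flowD(2)[OF flow] Y_def ic_def)
      qed
      \<comment> \<open>The extension sought: at r it takes the value of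
        \<open>perturbed w2 V2\<close>, and at r + ic it reduces to \<open>G r ic\<close> up to the
        factor \<open>exp (i m r)\<close>.\<close>
      define H where "H z = exp (\<i> * of_real m * z) * perturbed w2 V2 (x * w1 * (V1 z * e * cstar (V2 (cnj z))) * cstar w2)" for z
      have entH: "entire_fun (\<lambda>z. V1 z * e * cstar (V2 (cnj z)))"
        by (rule entire_fun_mult[OF entire_fun_cmult(2)[OF A.ent] entire_fun_cstar_cnj[OF B.ent]])
      have holH: "H holomorphic_on UNIV"
        unfolding H_def
        by (intro holomorphic_on_mult holomorphic_functional[OF entH bounded_linear_functional_mult[OF B.perturbed_positive]])
           (intro holomorphic_intros)
      have bH: "norm (H z) \<le> exp (\<bar>m\<bar> * \<bar>c\<bar>) * (?b2 * (norm (x * w1) * (M1 * norm e * M2) * norm w2))" if z: "z \<in> strip c" for z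
        unfolding H_def norm_mult
      proof (rule mult_mono[OF norm_exp_eigen_le[OF c0 z]])
        note Imz = strip_Im_bound[OF c0 z]
        have "norm (V1 z * e * cstar (V2 (cnj z))) \<le> norm (V1 z) * norm e * norm (V2 (cnj z))"
          using norm_mult3_le[of "V1 z" e "cstar (V2 (cnj z))"] by simp
        also have "\<dots> \<le> M1 * norm e * M2"
          using Imz M0 by (intro mult_mono M1 M2) auto
        finally have "norm (x * w1 * (V1 z * e * cstar (V2 (cnj z))) * cstar w2) \<le> norm (x * w1) * (M1 * norm e * M2) * norm w2"
          using norm_mult3_le[of "x * w1" "V1 z * e * cstar (V2 (cnj z))" "cstar w2"]
            mult_right_mono[OF mult_left_mono[of "norm (V1 z * e * cstar (V2 (cnj z)))" "M1 * norm e * M2" "norm (x * w1)"], of "norm w2"]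
          by simp
        then show "norm (perturbed w2 V2 (x * w1 * (V1 z * e * cstar (V2 (cnj z))) * cstar w2)) \<le> ?b2 * (norm (x * w1) * (M1 * norm e * M2) * norm w2)"
          by (intro order_trans[OF pB] mult_left_mono b0)
      qed auto
      have "strip_fun c H (\<lambda>t. H (of_real t)) (\<lambda>t. H (of_real t + \<i> * of_real c))"
        by (rule entire_strip_fun[OF holH bH])
      moreover have "H (of_real r) = perturbed w2 V2 (x * U r e)" for r
      proof -
        have "x * U r e = exp (\<i> * of_real m * of_real r) *\<^sub>C (x * w1 * (V1 (of_real r) * e * cstar (V2 (of_real r))) * cstar w2)"
          unfolding U \<sigma>_eigen[OF e] by (simp add: scaleC_mult_left scaleC_mult_right mult.assoc)
        then show ?thesis by (simp add: H_def B.perturbed_linear)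
      qed
      moreover have "H (of_real r + \<i> * of_real c) = perturbed w1 V1 (U r e * x)" for r
      proof -
        have "H (of_real r + ic) = exp (\<i> * of_real m * of_real r) * G r ic"
          by (simp add: H_def G_def perturbed_def X_def D_def distrib_left exp_add ic_def[symmetric] mult.assoc)
        also have "\<dots> = exp (\<i> * of_real m * of_real r) *
            \<psi> (V1 (of_real r) * e * cstar (V2 (of_real r)) * cstar w2 * (x * (w1 * V1 ic)))"
          unfolding key D_def X_def by (simp add: mult.assoc B.wi)
        also have "\<dots> = perturbed w1 V1 (U r e * x)"
          unfolding U perturbed_def \<sigma>_eigen[OF e] ic_def
          by (simp add: scaleC_mult_left scaleC_mult_right P(2) mult.assoc A.wi)
        finally show ?thesis by (simp add: ic_def)
      qed
      ultimately show ?thesis by auto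
    qed
    define F where "F m = (SOME F. strip_fun c F (\<lambda>r. perturbed w2 V2 (x * U r (f m))) (\<lambda>r. perturbed w1 V1 (U r (f m) * x)))" for m
    have F: "strip_fun c (F m) (\<lambda>r. perturbed w2 V2 (x * U r (f m))) (\<lambda>r. perturbed w1 V1 (U r (f m) * x))" if "m \<in> L" for m
    proof -
      have "eigenvector \<sigma> m (f m)" using L(2) that by blast
      from someI_ex[OF single[OF this]] show ?thesis unfolding F_def .
    qed
    have Usum: "U r y' = (\<Sum>m\<in>L. U r (f m))" for r
      unfolding U_def L(3) by (simp add: sum_distrib_left sum_distrib_right star_aut_sum[OF flowD(1)[OF flow]])
    show "\<exists>F. strip_fun c F (\<lambda>r. perturbed w2 V2 (x * U r y')) (\<lambda>r. perturbed w1 V1 (U r y' * x))"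
      using strip_fun_sum[of L c F, OF F]
      unfolding Usum sum_distrib_left sum_distrib_right
        positive_functionalD(9)[OF A.perturbed_positive] positive_functionalD(9)[OF B.perturbed_positive] by blast
  qed
  define y' where "y' = inv_el w1 * y * cstar (inv_el w2)"
  have "cstar (inv_el w2) * cstar w2 = 1" unfolding cstar_mult[symmetric] B.wi by simp
  then have "w1 * y' * cstar w2 = y" by (simp add: y'_def mult.assoc A.wi)
  then show ?thesis using ext[of y'] by (simp add: U_def)
qed

text \<open>Zero mass would make the whole perturbed functional vanish. In the relation with the
  trivial cocycle the other boundary function, \<open>\<psi> (\<kappa> r)\<close>, would then vanish
  too, but it is 1 at r = 0.\<close>

lemma perturbed_one_pos:
  assumes p: "perturbation \<kappa> w V"
  shows "Re (perturbed w V 1) > 0"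
proof (rule ccontr)
  interpret A: kms_perturbation c \<sigma> \<psi> \<kappa> w V by unfold_locales (rule p)
  assume "\<not> ?thesis"
  then have "Re (perturbed w V 1) = 0" using positive_functional_one(2)[OF A.perturbed_positive] by simp
  then have z: "perturbed w V a = 0" for a
    using positive_functional_bound[OF A.perturbed_positive, of a] by simp
  obtain F where F: "strip_fun c F (\<lambda>r. \<psi> (1 * (\<kappa> r * \<sigma> r 1 * cstar 1))) (\<lambda>r. perturbed w V (\<kappa> r * \<sigma> r 1 * cstar 1 * 1))"
    using perturbed_relation[OF p perturbation_trivial(1), of 1 1] unfolding perturbation_trivial(2) by blast
  have "\<psi> (1 * (\<kappa> 0 * \<sigma> 0 1 * cstar 1)) = 0"
    using strip_fun_zero_boundary(1)[OF c0 F, of 0] z by simp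
  then show False by (simp add: S A.K(5) one)
qed

end

section \<open>Analytic cocycles by Gaussian smoothing\<close>

lemma has_integral_shift_UNIV:
  fixes f :: "real \<Rightarrow> 'a::banach"
  assumes f: "(f has_integral i) UNIV"
  shows "((\<lambda>t. f (c + t)) has_integral i) UNIV"
proof -
  have int: "f integrable_on cbox a b" for a b using f unfolding has_integral_alt' by simp
  have lim: "\<exists>B>0. \<forall>a b. ball 0 B \<subseteq> cbox a b \<longrightarrow> norm (integral (cbox a b) f - i) < e" if "e > 0" for e
    using f that unfolding has_integral_alt' by simp
  show ?thesis
    unfolding has_integral_alt'
  proof (intro conjI allI impI)
    fix a b :: real
    show "(\<lambda>t. if t \<in> UNIV then f (c + t) else 0) integrable_on cbox a b"
      using int[of "a + c" "b + c"] integrable_on_shift_cbox[of f c a b] by (simp add: o_def)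
  next
    fix e :: real assume "e > 0"
    then obtain B where B: "B > 0" "\<And>a b. ball 0 B \<subseteq> cbox a b \<Longrightarrow> norm (integral (cbox a b) f - i) < e"
      using lim by blast
    show "\<exists>B>0. \<forall>a b. ball 0 B \<subseteq> cbox a b \<longrightarrow>
        norm (integral (cbox a b) (\<lambda>t. if t \<in> UNIV then f (c + t) else 0) - i) < e"
    proof (intro exI[of _ "B + \<bar>c\<bar>"] conjI allI impI)
      fix a b :: real assume sub: "ball 0 (B + \<bar>c\<bar>) \<subseteq> cbox a b"
      have "ball 0 B \<subseteq> cbox (a + c) (b + c)"
      proof
        fix x :: real assume "x \<in> ball 0 B"
        then have "x - c \<in> ball 0 (B + \<bar>c\<bar>)" by (simp add: dist_real_def)
        then have "x - c \<in> cbox a b" using sub by blast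
        then show "x \<in> cbox (a + c) (b + c)" by simp
      qed
      then have "norm (integral (cbox (a + c) (b + c)) f - i) < e" by (rule B(2))
      then show "norm (integral (cbox a b) (\<lambda>t. if t \<in> UNIV then f (c + t) else 0) - i) < e"
        using integral_shift_cbox_plus[of a b f c] by (simp add: o_def)
    qed (use B in auto)
  qed
qed

lemma integrable_dominated_continuous:
  fixes f :: "real \<Rightarrow> 'a::banach"
  assumes "continuous_on UNIV f" "\<And>t. norm (f t) \<le> g t" "g integrable_on UNIV"
  shows "f integrable_on UNIV"
proof (rule integrable_on_all_intervals_integrable_bound[OF _ _ assms(3)])
  fix a b :: real
  show "(\<lambda>t. if t \<in> UNIV then f t else 0) integrable_on cbox a b"
    using integrable_continuous[OF continuous_on_subset[OF assms(1) subset_UNIV]] by simp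
qed (rule assms(2))

lemma normal_density_mult_exp:
  assumes "s > 0"
  shows "normal_density 0 s t * exp (M * t) = exp (M\<^sup>2 * s\<^sup>2 / 2) * normal_density (M * s\<^sup>2) s t"
proof -
  have "- t\<^sup>2 / (2 * s\<^sup>2) + M * t = M\<^sup>2 * s\<^sup>2 / 2 + - (t - M * s\<^sup>2)\<^sup>2 / (2 * s\<^sup>2)"
    using assms by (simp add: field_simps power2_eq_square)
  then have "exp (- t\<^sup>2 / (2 * s\<^sup>2)) * exp (M * t) = exp (M\<^sup>2 * s\<^sup>2 / 2) * exp (- (t - M * s\<^sup>2)\<^sup>2 / (2 * s\<^sup>2))"
    by (simp only: exp_add[symmetric])
  then show ?thesis unfolding normal_density_def by (simp add: mult_ac)
qed

lemma integrable_normal_density_exp: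
  assumes s: "s > 0"
  shows "(\<lambda>t. normal_density 0 s t * (exp (M * t) + exp (- M * t))) integrable_on UNIV"
proof -
  have "(\<lambda>t. normal_density 0 s t * exp (M * t)) integrable_on UNIV" for M
    unfolding normal_density_mult_exp[OF s]
    by (intro integrable_on_lborel integrable_mult_right impI integrable_normal_density s)
  from integrable_add[OF this[of M] this[of "-M"]] show ?thesis by (simp add: distrib_left)
qed

lemma exp_abs_le_sum: "exp (M * \<bar>t\<bar>) \<le> exp (M * t) + exp (- M * (t::real))"
  by (cases "t \<ge> 0") (simp_all add: add_increasing add_increasing2)

lemma abs_le_exp_abs: "\<bar>t\<bar> \<le> exp \<bar>t::real\<bar>"
  using exp_ge_add_one_self[of "\<bar>t\<bar>"] by linarith

lemma square_le_exp_abs: "t\<^sup>2 \<le> 2 * exp \<bar>t::real\<bar>"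
proof -
  have "1 + \<bar>t\<bar> + \<bar>t\<bar>\<^sup>2 / 2 \<le> exp \<bar>t\<bar>" by (rule exp_lower_Taylor_quadratic) simp
  then show ?thesis by simp
qed

locale gaussian_smoothing =
  fixes s :: real and \<kappa> :: "real \<Rightarrow> 'a::cstar_algebra"
  assumes s: "s > 0" and cont: "continuous_on UNIV \<kappa>" and le1: "norm (\<kappa> t) \<le> 1"
begin

abbreviation N where "N \<equiv> normal_density 0 s"

definition q where "q = 1 / s\<^sup>2"

definition I where "I M = integral UNIV (\<lambda>t. N t * (exp (M * t) + exp (- M * t)))"

lemma q: "q > 0" using s by (simp add: q_def)

lemma cont_N: "continuous_on UNIV N"
  unfolding normal_density_def using s by (intro continuous_intros) auto

lemma weighted:
  assumes \<phi>: "continuous_on UNIV \<phi>" and bd: "\<And>t. cmod (\<phi> t) \<le> C * exp (M * \<bar>t\<bar>)"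
  shows "(\<lambda>t. (of_real (N t) * \<phi> t) *\<^sub>C \<kappa> t) integrable_on UNIV"
    "norm (integral UNIV (\<lambda>t. (of_real (N t) * \<phi> t) *\<^sub>C \<kappa> t)) \<le> C * I M"
proof -
  let ?g = "\<lambda>t. C * (N t * (exp (M * t) + exp (- M * t)))"
  have C: "C \<ge> 0" using bd[of 0] norm_ge_zero[of "\<phi> 0"] by (simp add: order_trans[OF norm_ge_zero])
  have le: "norm ((of_real (N t) * \<phi> t) *\<^sub>C \<kappa> t) \<le> ?g t" for t
  proof -
    have "norm ((of_real (N t) * \<phi> t) *\<^sub>C \<kappa> t) = N t * (cmod (\<phi> t) * norm (\<kappa> t))"
      by (simp add: norm_scaleC norm_mult)
    also have "\<dots> \<le> N t * (C * exp (M * \<bar>t\<bar>) * 1)"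
      using bd le1 C by (intro mult_left_mono mult_mono) auto
    also have "\<dots> \<le> N t * (C * (exp (M * t) + exp (- M * t)))"
      using C mult_left_mono[OF exp_abs_le_sum C] by (intro mult_left_mono) auto
    finally show ?thesis by (simp add: mult_ac)
  qed
  have g: "?g integrable_on UNIV"
    using integrable_on_cmult_left[OF integrable_normal_density_exp[OF s], of C M] by simp
  show i: "(\<lambda>t. (of_real (N t) * \<phi> t) *\<^sub>C \<kappa> t) integrable_on UNIV"
    by (rule integrable_dominated_continuous[OF _ le g])
       (intro continuous_on_scaleC continuous_on_mult continuous_on_of_real cont_N \<phi> cont)
  have "norm (integral UNIV (\<lambda>t. (of_real (N t) * \<phi> t) *\<^sub>C \<kappa> t)) \<le> integral UNIV ?g"
    by (rule Henstock_Kurzweil_Integration.integral_norm_bound_integral[OF i g le])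
  also have "integral UNIV ?g = C * I M"
    unfolding I_def by (rule Henstock_Kurzweil_Integration.integral_mult_right)
  finally show "norm (integral UNIV (\<lambda>t. (of_real (N t) * \<phi> t) *\<^sub>C \<kappa> t)) \<le> C * I M" .
qed

text \<open>For real z, \<open>N (t - z)\<close> equals \<open>N t * exp (q * t * z)\<close> times
  \<open>exp (- q * z\<^sup>2 / 2)\<close>. So this is the integral of \<kappa> against the Gaussian
  centred at z, with the factor independent of t split off.\<close>

definition J where "J z = integral UNIV (\<lambda>t. (of_real (N t) * exp (of_real (q * t) * z)) *\<^sub>C \<kappa> t)"

definition J' where
  "J' z = integral UNIV (\<lambda>t. (of_real (N t) * (of_real (q * t) * exp (of_real (q * t) * z))) *\<^sub>C \<kappa> t)"

lemma norm_exp_q: "cmod (exp (of_real (q * t) * z)) \<le> exp (q * cmod z * \<bar>t\<bar>)"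
proof -
  have "cmod (exp (of_real (q * t) * z)) \<le> exp (cmod (of_real (q * t) * z))" by (rule norm_exp)
  also have "cmod (of_real (q * t) * z) = q * cmod z * \<bar>t\<bar>" using q by (simp add: norm_mult abs_mult)
  finally show ?thesis .
qed

lemma J_integrable: "(\<lambda>t. (of_real (N t) * exp (of_real (q * t) * z)) *\<^sub>C \<kappa> t) integrable_on UNIV"
  by (rule weighted(1)[of _ 1 "q * cmod z"]) (intro continuous_intros, use norm_exp_q in simp)

lemma J'_integrable: "(\<lambda>t. (of_real (N t) * (of_real (q * t) * exp (of_real (q * t) * z))) *\<^sub>C \<kappa> t) integrable_on UNIV"
proof (rule weighted(1)[of _ q "1 + q * cmod z"])
  fix t
  have "cmod (of_real (q * t) * exp (of_real (q * t) * z)) \<le> (q * exp \<bar>t\<bar>) * exp (q * cmod z * \<bar>t\<bar>)"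
    unfolding norm_mult using q abs_le_exp_abs[of t] by (intro mult_mono norm_exp_q) (auto simp: abs_mult norm_mult)
  also have "\<dots> = q * exp ((1 + q * cmod z) * \<bar>t\<bar>)" by (simp add: exp_add distrib_right)
  finally show "cmod (of_real (q * t) * exp (of_real (q * t) * z)) \<le> q * exp ((1 + q * cmod z) * \<bar>t\<bar>)" .
qed (intro continuous_intros)

text \<open>A quadratic remainder gives differentiability without interchanging derivative and
  integral. In the argument of \<open>I\<close>, \<open>q * cmod z\<close> comes from
  \<open>exp (q * t * z)\<close>, q from \<open>cmod h \<le> 1\<close>, and 1 from bounding
  \<open>t\<^sup>2\<close> by \<open>2 * exp \<bar>t\<bar>\<close>.\<close>

lemma J_Taylor:
  assumes h: "cmod h \<le> 1"
  shows "norm (J (z + h) - J z - h *\<^sub>C J' z) \<le> (cmod h)\<^sup>2 * (2 * q\<^sup>2 * I (1 + q + q * cmod z))"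
proof -
  define \<phi> where "\<phi> t = exp (of_real (q * t) * z) * (exp (of_real (q * t) * h) - 1 - of_real (q * t) * h)" for t
  let ?C = "(cmod h)\<^sup>2 * (2 * q\<^sup>2)"
  have bd: "cmod (\<phi> t) \<le> ?C * exp ((1 + q + q * cmod z) * \<bar>t\<bar>)" for t
  proof -
    let ?x = "of_real (q * t) * h"
    have nx: "cmod ?x = q * \<bar>t\<bar> * cmod h" using q by (simp add: norm_mult abs_mult)
    have "cmod (exp ?x - 1 - ?x) = cmod (exp ?x - (\<Sum>k\<le>1. ?x ^ k / fact k))" by (simp add: diff_diff_eq)
    also have "\<dots> \<le> exp \<bar>Re ?x\<bar> * cmod ?x ^ Suc 1 / fact 1" by (rule Taylor_exp)
    also have "\<dots> = exp \<bar>Re ?x\<bar> * (cmod ?x)\<^sup>2" by (simp add: power2_eq_square)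
    also have "\<dots> \<le> exp (q * \<bar>t\<bar>) * ((cmod h)\<^sup>2 * q\<^sup>2 * (2 * exp \<bar>t\<bar>))"
    proof (rule mult_mono)
      have "\<bar>Re ?x\<bar> \<le> cmod ?x" by (rule abs_Re_le_cmod)
      also have "\<dots> \<le> q * \<bar>t\<bar> * 1" unfolding nx using h q by (intro mult_left_mono) auto
      finally show "exp \<bar>Re ?x\<bar> \<le> exp (q * \<bar>t\<bar>)" by simp
      have "(cmod ?x)\<^sup>2 = (cmod h)\<^sup>2 * q\<^sup>2 * t\<^sup>2" unfolding nx by (simp add: power_mult_distrib mult_ac)
      also have "\<dots> \<le> (cmod h)\<^sup>2 * q\<^sup>2 * (2 * exp \<bar>t\<bar>)"
        using square_le_exp_abs by (intro mult_left_mono) auto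
      finally show "(cmod ?x)\<^sup>2 \<le> (cmod h)\<^sup>2 * q\<^sup>2 * (2 * exp \<bar>t\<bar>)" .
    qed auto
    finally have "cmod (\<phi> t) \<le> exp (q * cmod z * \<bar>t\<bar>) * (exp (q * \<bar>t\<bar>) * ((cmod h)\<^sup>2 * q\<^sup>2 * (2 * exp \<bar>t\<bar>)))"
      unfolding \<phi>_def norm_mult by (intro mult_mono norm_exp_q) auto
    also have "\<dots> = ?C * exp ((1 + q + q * cmod z) * \<bar>t\<bar>)"
    proof -
      have "exp ((1 + q + q * cmod z) * \<bar>t\<bar>) = exp \<bar>t\<bar> * exp (q * \<bar>t\<bar>) * exp (q * cmod z * \<bar>t\<bar>)"
        by (simp add: distrib_right exp_add)
      then show ?thesis by (simp only: mult_ac)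
    qed
    finally show ?thesis .
  qed
  have contphi: "continuous_on UNIV \<phi>" unfolding \<phi>_def by (intro continuous_intros)
  have hlin: "h *\<^sub>C J' z = integral UNIV (\<lambda>t. h *\<^sub>C ((of_real (N t) * (of_real (q * t) * exp (of_real (q * t) * z))) *\<^sub>C \<kappa> t))"
    unfolding J'_def
    using integral_linear[OF J'_integrable[of z] bounded_bilinear.bounded_linear_right[OF bounded_bilinear_scaleC, of h]]
    by (simp add: o_def)
  have hint: "(\<lambda>t. h *\<^sub>C ((of_real (N t) * (of_real (q * t) * exp (of_real (q * t) * z))) *\<^sub>C \<kappa> t)) integrable_on UNIV"
    using integrable_linear[OF J'_integrable[of z] bounded_bilinear.bounded_linear_right[OF bounded_bilinear_scaleC, of h]]
    by (simp add: o_def)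
  have "J (z + h) - J z - h *\<^sub>C J' z = integral UNIV (\<lambda>t. (of_real (N t) * exp (of_real (q * t) * (z + h))) *\<^sub>C \<kappa> t
      - (of_real (N t) * exp (of_real (q * t) * z)) *\<^sub>C \<kappa> t
      - h *\<^sub>C ((of_real (N t) * (of_real (q * t) * exp (of_real (q * t) * z))) *\<^sub>C \<kappa> t))"
    unfolding hlin unfolding J_def
    by (simp only: Henstock_Kurzweil_Integration.integral_diff[OF integrable_diff[OF J_integrable[of "z + h"] J_integrable[of z]] hint]
        Henstock_Kurzweil_Integration.integral_diff[OF J_integrable[of "z + h"] J_integrable[of z]])
  also have "\<dots> = integral UNIV (\<lambda>t. (of_real (N t) * \<phi> t) *\<^sub>C \<kappa> t)"
  proof (rule arg_cong[where f = "integral UNIV"], rule ext)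
    fix t
    have alg: "n * (e * f) - n * e - h * (n * (x * e)) = n * (e * (f - 1 - x * h))" for n e f x :: complex
      by (simp add: algebra_simps)
    have "of_real (N t) * exp (of_real (q * t) * (z + h)) - of_real (N t) * exp (of_real (q * t) * z)
        - h * (of_real (N t) * (of_real (q * t) * exp (of_real (q * t) * z))) = of_real (N t) * \<phi> t"
      unfolding \<phi>_def distrib_left exp_add by (rule alg)
    then show "(of_real (N t) * exp (of_real (q * t) * (z + h))) *\<^sub>C \<kappa> t - (of_real (N t) * exp (of_real (q * t) * z)) *\<^sub>C \<kappa> t
      - h *\<^sub>C ((of_real (N t) * (of_real (q * t) * exp (of_real (q * t) * z))) *\<^sub>C \<kappa> t) = (of_real (N t) * \<phi> t) *\<^sub>C \<kappa> t"
      by (simp only: scaleC_scaleC scaleC_diff_left[symmetric])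
  qed
  also have "norm \<dots> \<le> ?C * I (1 + q + q * cmod z)" by (rule weighted(2)[OF contphi bd])
  finally show ?thesis by (simp add: mult_ac)
qed

lemma entire_J: "entire_fun J"
  unfolding entire_fun_iff
proof
  fix z
  let ?C = "2 * q\<^sup>2 * I (1 + q + q * cmod z)"
  have "has_cderiv J (J' z) z"
    unfolding has_cderiv_def
  proof (rule LIM_zero_cancel, rule Lim_null_comparison)
    have "\<forall>\<^sub>F h in at 0. h \<noteq> 0 \<and> cmod h \<le> 1"
      unfolding eventually_at by (intro exI[of _ 1]) (auto simp: dist_norm)
    then show "\<forall>\<^sub>F h in at 0. norm (inverse h *\<^sub>C (J (z + h) - J z) - J' z) \<le> cmod h * ?C"
    proof eventually_elim
      case (elim h)
      have "inverse h *\<^sub>C (J (z + h) - J z) - J' z = inverse h *\<^sub>C (J (z + h) - J z - h *\<^sub>C J' z)"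
        using elim by (simp add: scaleC_diff_right scaleC_scaleC)
      then have "norm (inverse h *\<^sub>C (J (z + h) - J z) - J' z) = norm (J (z + h) - J z - h *\<^sub>C J' z) / cmod h"
        by (simp add: norm_scaleC norm_inverse divide_inverse mult.commute)
      also have "\<dots> \<le> ((cmod h)\<^sup>2 * ?C) / cmod h"
        using J_Taylor[of h z] elim by (intro divide_right_mono) auto
      finally show ?case using elim by (simp add: power2_eq_square)
    qed
    have "((\<lambda>h. cmod h * ?C) \<longlongrightarrow> cmod 0 * ?C) (at 0)" by (intro tendsto_intros)
    then show "((\<lambda>h. cmod h * ?C) \<longlongrightarrow> 0) (at 0)" by simp
  qed
  then show "\<exists>D. has_cderiv J D z" ..
qed

text \<open>Chebyshev's estimate. Where \<open>\<bar>t\<bar> < d\<close> the deviation of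
  \<open>\<kappa> t\<close> from 1 is at most 1/4; elsewhere it is at most 2, hence at most
  \<open>2 * t\<^sup>2 / d\<^sup>2\<close>, and the second moment \<open>s\<^sup>2\<close> with s =
  d / 4 makes this contribute 1/8.\<close>

lemma J_0_near_1:
  assumes d: "d > 0" "\<And>t. \<bar>t\<bar> < d \<Longrightarrow> norm (\<kappa> t - 1) \<le> 1 / 4" and sd: "s = d / 4"
  shows "norm (1 - J 0) < 1"
proof -
  have N1: "(N has_integral 1) UNIV"
    using has_integral_integral_lborel[OF integrable_normal_density[OF s, of 0]] integral_normal_density[OF s, of 0] by simp
  have "has_bochner_integral lborel (\<lambda>t. N t * (t - 0) ^ (2 * 1)) (fact (2 * 1) / ((2 / s\<^sup>2) ^ 1 * fact 1))"
    by (rule normal_moment_even[OF s])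
  then have "has_bochner_integral lborel (\<lambda>t. N t * t\<^sup>2) (s\<^sup>2)" by (simp add: fact_numeral)
  then have N2: "((\<lambda>t. N t * t\<^sup>2) has_integral s\<^sup>2) UNIV"
    using has_integral_integral_lborel[OF integrable.intros] has_bochner_integral_integral_eq by metis
  have w: "((\<lambda>t. of_real (N t) *\<^sub>C \<kappa> t) has_integral J 0) UNIV"
    using integrable_integral[OF J_integrable[of 0]] unfolding J_def by simp
  have "((\<lambda>t. N t *\<^sub>R (1::'a)) has_integral 1 *\<^sub>R 1) UNIV"
    using has_integral_linear[OF N1 bounded_linear_scaleR_left[of "1::'a"]] by (simp add: o_def)
  then have diff: "((\<lambda>t. N t *\<^sub>R (1::'a) - of_real (N t) *\<^sub>C \<kappa> t) has_integral 1 - J 0) UNIV"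
    using has_integral_diff[OF _ w] by simp
  have g: "((\<lambda>t. N t * (1 / 4) + (N t * t\<^sup>2) * (2 / d\<^sup>2)) has_integral 1 * (1 / 4) + s\<^sup>2 * (2 / d\<^sup>2)) UNIV"
    by (intro has_integral_add has_integral_mult_left N1 N2)
  have le: "norm (N t *\<^sub>R (1::'a) - of_real (N t) *\<^sub>C \<kappa> t) \<le> N t * (1 / 4) + (N t * t\<^sup>2) * (2 / d\<^sup>2)" for t
  proof -
    have "N t *\<^sub>R (1::'a) - of_real (N t) *\<^sub>C \<kappa> t = N t *\<^sub>R (1 - \<kappa> t)" by (simp add: scaleC_of_real scaleR_diff_right)
    then have n: "norm (N t *\<^sub>R (1::'a) - of_real (N t) *\<^sub>C \<kappa> t) = N t * norm (1 - \<kappa> t)" by simp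
    have "norm (1 - \<kappa> t) \<le> 1 / 4 + t\<^sup>2 * (2 / d\<^sup>2)"
    proof (cases "\<bar>t\<bar> < d")
      case True
      then have "norm (1 - \<kappa> t) \<le> 1 / 4" using d(2) by (simp add: norm_minus_commute)
      then show ?thesis by (simp add: add_increasing2)
    next
      case False
      then have "d\<^sup>2 \<le> t\<^sup>2" using d(1) by (metis abs_le_square_iff abs_of_pos not_less)
      then have "1 \<le> t\<^sup>2 / d\<^sup>2" using d(1) by simp
      moreover have "norm (1 - \<kappa> t) \<le> 2" using norm_triangle_ineq4[of 1 "\<kappa> t"] le1[of t] by simp
      ultimately show ?thesis by simp
    qed
    then have "N t * norm (1 - \<kappa> t) \<le> N t * (1 / 4 + t\<^sup>2 * (2 / d\<^sup>2))" by (rule mult_left_mono) simp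
    then show ?thesis unfolding n by (simp add: distrib_left mult.assoc)
  qed
  have "norm (1 - J 0) \<le> 1 * (1 / 4) + s\<^sup>2 * (2 / d\<^sup>2)"
    using Henstock_Kurzweil_Integration.integral_norm_bound_integral[OF has_integral_integrable[OF diff] has_integral_integrable[OF g] le]
    unfolding integral_unique[OF diff] integral_unique[OF g] .
  also have "\<dots> < 1" unfolding sd using d(1) by (simp add: power_divide)
  finally show ?thesis .
qed

end

text \<open>Take w to be a Gaussian average of \<kappa>, narrow enough to be invertible. By the
  cocycle identity \<open>\<kappa> r * \<sigma> r w\<close> is the average of the translated
  cocycle; translating the Gaussian instead makes r enter analytically.\<close>

lemma cocycle_perturbation_exists:
  assumes \<sigma>: "flow \<sigma>" and coc: "cocycle \<sigma> (\<kappa> :: real \<Rightarrow> 'a::cstar_algebra)"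
  obtains w V where "invertible_el w" "entire_fun V" "\<forall>t. \<kappa> t * \<sigma> t w = w * V (of_real t)"
proof -
  note K = cocycleD[OF \<sigma> coc]
  have "\<exists>d>0. \<forall>t. dist t 0 < d \<longrightarrow> dist (\<kappa> t) (\<kappa> 0) < 1 / 4"
    using K(1) unfolding continuous_on_iff by (metis UNIV_I zero_less_divide_1_iff zero_less_numeral)
  then obtain d where d: "d > 0" "\<And>t. \<bar>t\<bar> < d \<Longrightarrow> norm (\<kappa> t - 1) \<le> 1 / 4"
    by (auto simp: dist_norm K(5) intro: less_imp_le)
  interpret gaussian_smoothing "d / 4" \<kappa> by unfold_locales (use d K in auto)
  obtain wi where wi: "(1 - (1 - J 0)) * wi = 1" "wi * (1 - (1 - J 0)) = 1"
    using neumann_inverse[OF J_0_near_1[OF d refl]] by metis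
  have inv: "invertible_el (J 0)" by (rule invertible_elI[of _ wi]) (use wi in simp_all)
  define V where "V z = inv_el (J 0) * (exp (- of_real (q / 2) * z\<^sup>2) *\<^sub>C J z)" for z
  have ent: "entire_fun V"
    unfolding V_def
    by (rule entire_fun_cmult(1), rule entire_fun_scaleC[OF _ entire_J]) (intro holomorphic_intros)
  have "\<kappa> r * \<sigma> r (J 0) = J 0 * V (of_real r)" for r
  proof -
    let ?h = "\<lambda>x. \<kappa> r * \<sigma> r x"
    have bl: "bounded_linear ?h"
      by (rule bounded_linear_const_mult[OF bounded_linear_star_aut[OF flowD(1)[OF \<sigma>]]])
    have w: "((\<lambda>t. of_real (N t) *\<^sub>C \<kappa> t) has_integral J 0) UNIV"
      using integrable_integral[OF J_integrable[of 0]] unfolding J_def by simp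
    have "((\<lambda>t. ?h (of_real (N t) *\<^sub>C \<kappa> t)) has_integral ?h (J 0)) UNIV"
      using has_integral_linear[OF w bl] by (simp add: o_def)
    moreover have "?h (of_real (N t) *\<^sub>C \<kappa> t) = of_real (N t) *\<^sub>C \<kappa> (r + t)" for t
      by (simp add: flow_simps[OF \<sigma>] scaleC_mult_right K(4))
    ultimately have 1: "((\<lambda>t. of_real (N t) *\<^sub>C \<kappa> (r + t)) has_integral ?h (J 0)) UNIV" by simp
    have "((\<lambda>t. (of_real (N t) * exp (of_real (q * t) * of_real r)) *\<^sub>C \<kappa> t) has_integral J (of_real r)) UNIV"
      unfolding J_def by (rule integrable_integral[OF J_integrable])
    from has_integral_linear[OF this bounded_bilinear.bounded_linear_right[OF bounded_bilinear_scaleC, of "exp (- of_real (q / 2) * (of_real r)\<^sup>2)"]]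
    have "((\<lambda>t. exp (- of_real (q / 2) * (of_real r)\<^sup>2) *\<^sub>C (of_real (N t) * exp (of_real (q * t) * of_real r)) *\<^sub>C \<kappa> t)
        has_integral exp (- of_real (q / 2) * (of_real r)\<^sup>2) *\<^sub>C J (of_real r)) UNIV" by (simp add: o_def)
    moreover have "exp (- of_real (q / 2) * (of_real r)\<^sup>2) *\<^sub>C (of_real (N t) * exp (of_real (q * t) * of_real r)) *\<^sub>C \<kappa> t
        = of_real (N (t - r)) *\<^sub>C \<kappa> t" for t
    proof -
      have re: "exp (- (q / 2) * r\<^sup>2) * (N t * exp (q * t * r)) = N (t - r)"
      proof -
        have "- (q / 2) * r\<^sup>2 + (- (t - 0)\<^sup>2 / (2 * (d / 4)\<^sup>2) + q * t * r) = - (t - r - 0)\<^sup>2 / (2 * (d / 4)\<^sup>2)"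
          using d(1) by (simp add: q_def field_simps power2_eq_square)
        then show ?thesis
          unfolding normal_density_def by (simp add: exp_add[symmetric] mult_ac del: exp_add)
      qed
      have "exp (- of_real (q / 2) * (of_real r)\<^sup>2) * (of_real (N t) * exp (of_real (q * t) * of_real r)) = complex_of_real (N (t - r))"
      proof -
        have "exp (- of_real (q / 2) * (of_real r)\<^sup>2) = complex_of_real (exp (- (q / 2) * r\<^sup>2))"
          "exp (of_real (q * t) * of_real r) = complex_of_real (exp (q * t * r))"
          by (simp_all add: exp_of_real[symmetric])
        with re show ?thesis by (simp only: of_real_mult[symmetric])
      qed
      then show ?thesis by (simp only: scaleC_scaleC)
    qed
    ultimately have "((\<lambda>t. of_real (N (t - r)) *\<^sub>C \<kappa> t) has_integral exp (- of_real (q / 2) * (of_real r)\<^sup>2) *\<^sub>C J (of_real r)) UNIV"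
      by (simp only:)
    from has_integral_shift_UNIV[OF this, of r]
    have "((\<lambda>t. of_real (N t) *\<^sub>C \<kappa> (r + t)) has_integral exp (- of_real (q / 2) * (of_real r)\<^sup>2) *\<^sub>C J (of_real r)) UNIV"
      by (simp only: add_diff_cancel_left')
    from has_integral_unique[OF 1 this] show ?thesis
      by (simp add: V_def inv_el_cancel[OF inv])
  qed
  then show thesis using that[OF inv ent] by blast
qed

section \<open>Cocycles with bounded generator\<close>

lemma has_vector_derivative_imp_continuous_on:
  assumes "\<And>r. (f has_vector_derivative f' r) (at r)"
  shows "continuous_on S f"
  by (intro continuous_at_imp_continuous_on ballI has_vector_derivative_continuous[OF assms])

text \<open>Integrates a monomial bound on both sides of 0; iterated, it produces the factorials in
  the estimates for linear equations below.\<close>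

lemma norm_bound_from_derivative:
  fixes f :: "real \<Rightarrow> 'a::real_normed_vector"
  assumes f0: "f 0 = 0" and f': "\<And>r. (f has_vector_derivative f' r) (at r)"
    and bd: "\<And>r. \<bar>r\<bar> \<le> T \<Longrightarrow> norm (f' r) \<le> C * \<bar>r\<bar> ^ n" and r: "\<bar>r\<bar> \<le> T"
  shows "norm (f r) \<le> C * \<bar>r\<bar> ^ Suc n / Suc n"
proof -
  have pos: "norm (g r) \<le> C * r ^ Suc n / Suc n"
    if g0: "g 0 = 0" and g': "\<And>r. (g has_vector_derivative g' r) (at r)"
      and gb: "\<And>r. 0 \<le> r \<Longrightarrow> r \<le> T \<Longrightarrow> norm (g' r) \<le> C * r ^ n" and r: "0 < r" "r \<le> T"
    for g :: "real \<Rightarrow> 'a" and g' r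
  proof -
    have "norm (g r - g 0) \<le> C * r ^ Suc n / Suc n - C * 0 ^ Suc n / Suc n"
    proof (rule differentiable_bound_general[OF r(1), where f' = g' and \<phi>' = "\<lambda>x. C * x ^ n"])
      show "continuous_on {0..r} g"
        by (rule has_vector_derivative_imp_continuous_on[OF g'])
      show "continuous_on {0..r} (\<lambda>x. C * x ^ Suc n / Suc n)" by (intro continuous_intros) simp
      show "(g has_vector_derivative g' x) (at x)" for x by (rule g')
      show "((\<lambda>x. C * x ^ Suc n / Suc n) has_vector_derivative C * x ^ n) (at x)" for x
        using DERIV_cdivide[OF DERIV_cmult[OF DERIV_pow[of "Suc n" x], of C], of "real (Suc n)"]
        unfolding has_real_derivative_iff_has_vector_derivative[symmetric] by (simp del: power_Suc of_nat_Suc)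
      show "norm (g' x) \<le> C * x ^ n" if "0 < x" "x < r" for x using gb[of x] that r by simp
    qed
    then show ?thesis by (simp add: g0)
  qed
  consider "r = 0" | "r > 0" | "r < 0" by linarith
  then show ?thesis
  proof cases
    case 1
    then show ?thesis by (simp add: f0)
  next
    case 2
    have "norm (f r) \<le> C * r ^ Suc n / Suc n"
    proof (rule pos[OF f0 f' _ 2])
      show "norm (f' t) \<le> C * t ^ n" if "0 \<le> t" "t \<le> T" for t using bd[of t] that by simp
    qed (use r 2 in simp)
    then show ?thesis using 2 by simp
  next
    case 3
    have g': "((\<lambda>r. f (- r)) has_vector_derivative - f' (- r)) (at r)" for r
      using vector_diff_chain_at[of uminus "-1" r f "f' (- r)"] f'[of "- r"]
        has_vector_derivative_minus[OF has_vector_derivative_id[of "at r"]] by (simp add: o_def)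
    have "norm (f (- (- r))) \<le> C * (- r) ^ Suc n / Suc n"
    proof (rule pos[of "\<lambda>r. f (- r)", OF _ g'])
      show "norm (- f' (- t)) \<le> C * t ^ n" if "0 \<le> t" "t \<le> T" for t using bd[of "- t"] that by simp
    qed (use f0 r 3 in simp_all)
    then show ?thesis using 3 by simp
  qed
qed

lemma power_over_fact_tendsto_0: "(\<lambda>n. M * (x ^ n / fact n)) \<longlonglongrightarrow> (0::real)"
proof -
  have "(\<lambda>n. x ^ n / fact n) \<longlonglongrightarrow> 0"
    using summable_LIMSEQ_zero[OF summable_exp[of x]] by (simp add: divide_inverse mult.commute)
  from tendsto_mult_left[OF this, of M] show ?thesis by simp
qed

text \<open>Gronwall in iterated form: on a bounded interval a bound M on X improves to
  \<open>M * (\<bar>K\<bar> * \<bar>r\<bar>) ^ n / fact n\<close> for every n.\<close>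

lemma linear_ode_zero_unique:
  fixes X :: "real \<Rightarrow> 'a::real_normed_vector"
  assumes X0: "X 0 = 0" and X': "\<And>r. (X has_vector_derivative X' r) (at r)"
    and K: "\<And>r. norm (X' r) \<le> K * norm (X r)"
  shows "X r = 0"
proof -
  define T where "T = \<bar>r\<bar>"
  have "continuous_on {-T..T} X"
    by (rule has_vector_derivative_imp_continuous_on[OF X'])
  then have "bounded (X ` {-T..T})" by (intro compact_imp_bounded compact_continuous_image compact_Icc)
  then obtain M where M: "\<forall>x\<in>X ` {-T..T}. norm x \<le> M" unfolding bounded_iff by (elim exE)
  have bd: "norm (X s) \<le> M * \<bar>K\<bar> ^ n / fact n * \<bar>s\<bar> ^ n" if "\<bar>s\<bar> \<le> T" for n s
    using that
  proof (induction n arbitrary: s)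
    case 0
    then have "s \<in> {-T..T}" by (simp add: abs_le_iff)
    then show ?case using M by simp
  next
    case (Suc n)
    have "norm (X s) \<le> (M * \<bar>K\<bar> ^ n / fact n * \<bar>K\<bar>) * \<bar>s\<bar> ^ Suc n / Suc n"
    proof (rule norm_bound_from_derivative[where f = X and f' = X' and T = T, OF X0 X' _ Suc.prems])
      fix t assume t: "\<bar>t\<bar> \<le> T"
      have "norm (X' t) \<le> \<bar>K\<bar> * norm (X t)"
        using K[of t] mult_right_mono[OF abs_ge_self[of K] norm_ge_zero[of "X t"]] by linarith
      also have "\<dots> \<le> \<bar>K\<bar> * (M * \<bar>K\<bar> ^ n / fact n * \<bar>t\<bar> ^ n)"
        using Suc.IH[OF t] by (rule mult_left_mono) simp
      finally show "norm (X' t) \<le> (M * \<bar>K\<bar> ^ n / fact n * \<bar>K\<bar>) * \<bar>t\<bar> ^ n" by (simp add: mult_ac)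
    qed
    then show ?case by (simp add: field_simps)
  qed
  have "norm (X r) \<le> M * ((\<bar>K\<bar> * \<bar>r\<bar>) ^ n / fact n)" for n
    using bd[of r n] by (simp add: T_def power_mult_distrib mult_ac)
  then have "norm (X r) \<le> 0"
    by (intro LIMSEQ_le_const[OF power_over_fact_tendsto_0]) auto
  then show ?thesis by simp
qed

text \<open>The Dyson series: \<open>D n\<close> is the n-fold iterated integral, of norm at most
  \<open>(K * \<bar>r\<bar>) ^ n / fact n\<close>, and the series is differentiated term by
  term.\<close>

lemma linear_ode_exists:
  fixes a :: "real \<Rightarrow> 'a::cstar_algebra"
  assumes cont: "continuous_on UNIV a" and K: "\<And>r. norm (a r) \<le> K"
  obtains u where "u 0 = 1" "\<forall>r. (u has_vector_derivative u r * a r) (at r)"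
proof -
  have K0: "K \<ge> 0" using K[of 0] norm_ge_zero order_trans by blast
  define A where "A f = (SOME J :: real \<Rightarrow> 'a. J 0 = 0 \<and> (\<forall>r. (J has_vector_derivative f r) (at r)))" for f
  have A: "A f 0 = 0 \<and> (\<forall>r. (A f has_vector_derivative f r) (at r))" if f: "continuous_on UNIV f" for f
  proof -
    obtain J :: "real \<Rightarrow> 'a" where "J 0 = 0" "\<And>r. (J has_vector_derivative f r) (at r)"
      using antiderivative_exists[OF f] by metis
    then have "\<exists>J :: real \<Rightarrow> 'a. J 0 = 0 \<and> (\<forall>r. (J has_vector_derivative f r) (at r))" by blast
    then show ?thesis unfolding A_def by (rule someI_ex)
  qed
  define D where "D = rec_nat (\<lambda>r. 1::'a) (\<lambda>n g. A (\<lambda>r. g r * a r))"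
  have D0: "D 0 = (\<lambda>r. 1)" and DS: "D (Suc n) = A (\<lambda>r. D n r * a r)" for n by (simp_all add: D_def)
  have contD: "continuous_on UNIV (D n)" for n
  proof (induction n)
    case (Suc n)
    have "(D (Suc n) has_vector_derivative D n r * a r) (at r)" for r
      using A[of "\<lambda>r. D n r * a r"] continuous_on_mult[OF Suc cont] by (simp add: DS)
    then show ?case by (rule has_vector_derivative_imp_continuous_on)
  qed (simp add: D0)
  have D': "D (Suc n) 0 = 0" "(D (Suc n) has_vector_derivative D n r * a r) (at r)" for n r
    using A[of "\<lambda>r. D n r * a r"] continuous_on_mult[OF contD[of n] cont] by (simp_all add: DS)
  have bdD: "norm (D n r) \<le> (K * \<bar>r\<bar>) ^ n / fact n" for n r
  proof (induction n arbitrary: r)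
    case (Suc n)
    have "norm (D (Suc n) r) \<le> (K ^ n / fact n * K) * \<bar>r\<bar> ^ Suc n / Suc n"
    proof (rule norm_bound_from_derivative[where f = "D (Suc n)" and f' = "\<lambda>r. D n r * a r" and T = "\<bar>r\<bar>", OF D' _ order_refl])
      fix t
      have "norm (D n t * a t) \<le> ((K * \<bar>t\<bar>) ^ n / fact n) * K"
        using norm_mult_ineq[of "D n t" "a t"] mult_mono[OF Suc[of t] K[of t]] K0 by simp
      then show "norm (D n t * a t) \<le> (K ^ n / fact n * K) * \<bar>t\<bar> ^ n"
        by (simp add: power_mult_distrib mult_ac)
    qed
    then show ?case by (simp add: power_mult_distrib field_simps)
  qed (simp add: D0)
  \<comment> \<open>The derivative of \<open>D n\<close>, which is 0 for the constant
    \<open>D 0\<close>; the majorants \<open>Mn\<close> below are shifted in the same way.\<close>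
  define d where "d n r = (case n of 0 \<Rightarrow> 0 | Suc m \<Rightarrow> D m r * a r)" for n r
  have Dd: "(D n has_vector_derivative d n r) (at r)" for n r
    by (cases n) (use D'(2) in \<open>auto simp: d_def D0\<close>)
  have sumD: "summable (\<lambda>n. D n r)" for r
  proof (rule summable_norm_cancel, rule summable_comparison_test)
    show "\<exists>N. \<forall>n\<ge>N. norm (norm (D n r)) \<le> (K * \<bar>r\<bar>) ^ n / fact n" using bdD by simp
    show "summable (\<lambda>n. (K * \<bar>r\<bar>) ^ n / fact n)"
      using summable_exp[of "K * \<bar>r\<bar>"] by (simp add: divide_inverse mult.commute)
  qed
  define u where "u r = (\<Sum>n. D n r)" for r
  have ud: "(\<Sum>n. d n r) = u r * a r" "summable (\<lambda>n. d n r)" for r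
  proof -
    have "summable (\<lambda>n. d (Suc n) r)" using summable_mult2[OF sumD] by (simp add: d_def)
    then show s: "summable (\<lambda>n. d n r)" using summable_Suc_iff[of "\<lambda>n. d n r"] by simp
    have "(\<Sum>n. d n r) = (\<Sum>n. d (Suc n) r) + d 0 r" using suminf_split_head[OF s] by simp
    also have "\<dots> = u r * a r" using suminf_mult2[OF sumD[of r], of "a r"] by (simp add: d_def u_def)
    finally show "(\<Sum>n. d n r) = u r * a r" .
  qed
  have "(u has_vector_derivative u r * a r) (at r)" for r
  proof -
    define T where "T = \<bar>r\<bar> + 1"
    have T: "T > 0" by (simp add: T_def)
    let ?S = "ball 0 T :: real set"
    define Mn where "Mn n = (case n of 0 \<Rightarrow> 0 | Suc m \<Rightarrow> (K * T) ^ m / fact m * K)" for n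
    have "summable (\<lambda>n. Mn (Suc n))"
      unfolding Mn_def using summable_mult2[OF summable_exp[of "K * T"], of K] by (simp add: divide_inverse mult.commute mult.left_commute)
    then have sumM: "summable Mn" using summable_Suc_iff[of Mn] by simp
    have "norm (d n x) \<le> Mn n" if x: "x \<in> ?S" for n x
    proof (cases n)
      case (Suc m)
      have "norm (D m x) \<le> (K * T) ^ m / fact m"
        using order_trans[OF bdD[of m x] divide_right_mono[OF power_mono[OF mult_left_mono[OF _ K0]]]] x K0
        by (simp add: less_imp_le)
      then have "norm (D m x) * norm (a x) \<le> (K * T) ^ m / fact m * K"
        using K[of x] K0 T by (intro mult_mono) auto
      then show ?thesis using norm_mult_ineq[of "D m x" "a x"] by (simp add: Suc d_def Mn_def)
    qed (simp add: d_def Mn_def)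
    then have unif: "uniform_limit ?S (\<lambda>n x. \<Sum>i<n. d i x) (\<lambda>x. \<Sum>n. d n x) sequentially"
      by (rule Weierstrass_m_test[OF _ sumM])
    have "\<exists>g. \<forall>x\<in>?S. (\<lambda>n. D n x) sums g x \<and> (g has_derivative (\<lambda>h. h *\<^sub>R (u x * a x))) (at x within ?S)"
    proof (rule has_derivative_series[where f' = "\<lambda>n x h. h *\<^sub>R d n x" and x = 0 and l = "u 0"])
      show "(D n has_derivative (\<lambda>h. h *\<^sub>R d n x)) (at x within ?S)" for n x
        using Dd[of n x] unfolding has_vector_derivative_def by (rule has_derivative_at_withinI)
      fix e :: real assume e: "e > 0"
      from uniform_limitD[OF unif e]
      show "\<forall>\<^sub>F n in sequentially. \<forall>x\<in>?S. \<forall>h. norm ((\<Sum>i<n. h *\<^sub>R d i x) - h *\<^sub>R (u x * a x)) \<le> e * norm h"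
      proof eventually_elim
        case (elim n)
        show ?case
        proof (intro ballI allI)
          fix x h assume "x \<in> ?S"
          then have "norm ((\<Sum>i<n. d i x) - u x * a x) \<le> e" using elim by (simp add: dist_norm ud less_imp_le)
          then have "\<bar>h\<bar> * norm ((\<Sum>i<n. d i x) - u x * a x) \<le> \<bar>h\<bar> * e" by (rule mult_left_mono) simp
          then show "norm ((\<Sum>i<n. h *\<^sub>R d i x) - h *\<^sub>R (u x * a x)) \<le> e * norm h"
            by (simp add: scaleR_sum_right[symmetric] scaleR_diff_right[symmetric] mult.commute)
        qed
      qed
    next
      show "(\<lambda>n. D n 0) sums u 0" unfolding u_def by (rule summable_sums[OF sumD])
    qed (use T in auto)
    then obtain g where g: "\<And>x. x \<in> ?S \<Longrightarrow> (\<lambda>n. D n x) sums g x"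
      "\<And>x. x \<in> ?S \<Longrightarrow> (g has_derivative (\<lambda>h. h *\<^sub>R (u x * a x))) (at x within ?S)" by blast
    have rS: "r \<in> ?S" by (simp add: T_def)
    have "(g has_vector_derivative u r * a r) (at r)"
      using g(2)[OF rS] at_within_open[OF rS open_ball] unfolding has_vector_derivative_def by simp
    moreover have "g x = u x" if "x \<in> ?S" for x using sums_unique[OF g(1)[OF that]] by (simp add: u_def)
    ultimately show ?thesis
      by (rule has_vector_derivative_transform_within_open[OF _ open_ball rS])
  qed
  moreover have "u 0 = 1"
  proof -
    have "(\<lambda>n. D n 0) sums (\<Sum>n\<in>{0}. D n 0)"
      by (rule sums_finite) (use D'(1) in \<open>auto simp: gr0_conv_Suc\<close>)
    then show ?thesis unfolding u_def using sums_unique by (fastforce simp: D0)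
  qed
  ultimately show thesis using that by blast
qed

text \<open>The solution of the linear equation is unitary because \<open>\<i> *\<^sub>C d\<close>
  is skew, and the cocycle identity holds because both sides solve the same equation in r with the
  same initial value.\<close>

lemma dyson_cocycle:
  fixes \<sigma> :: "real \<Rightarrow> 'a::cstar_algebra \<Rightarrow> 'a"
  assumes \<sigma>: "flow \<sigma>" and d: "cstar d = d"
  obtains \<kappa> where "cocycle \<sigma> \<kappa>" "\<forall>r. (\<kappa> has_vector_derivative \<kappa> r * \<sigma> r (\<i> *\<^sub>C d)) (at r)"
proof -
  note S = flow_simps[OF \<sigma>]
  define a where "a r = \<sigma> r (\<i> *\<^sub>C d)" for r
  have na: "norm (a r) \<le> norm d" for r by (simp add: a_def flowD(7)[OF \<sigma>] norm_scaleC)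
  have sa: "cstar (a r) = - a r" for r
    by (simp add: a_def S cstar_scaleC d S(4)[symmetric])
  obtain u where u0: "u 0 = 1" and u': "\<forall>r. (u has_vector_derivative u r * a r) (at r)"
    using linear_ode_exists[of a "norm d"] na flowD(4)[OF \<sigma>] unfolding a_def by blast
  have u': "(u has_vector_derivative u r * a r) (at r)" for r using u' by blast
  have us': "((\<lambda>r. cstar (u r)) has_vector_derivative - (a r * cstar (u r))) (at r)" for r
    using bounded_linear.has_vector_derivative[OF bounded_linear_cstar u'] by (simp add: cstar_mult sa)
  have uu: "u r * cstar (u r) = 1" for r
  proof -
    have "u r * cstar (u r) = u 0 * cstar (u 0)"
    proof (rule has_vector_derivative_zero_imp_eq[where f = "\<lambda>r. u r * cstar (u r)"])
      fix r
      show "((\<lambda>r. u r * cstar (u r)) has_vector_derivative 0) (at r)"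
        using has_vector_derivative_mult[OF u' us', of r] by (simp add: mult.assoc)
    qed
    then show ?thesis by (simp add: u0)
  qed
  \<comment> \<open>The derivative of \<open>u * cstar u\<close> cancels identically, but that of
    \<open>cstar u * u\<close> is a commutator with a. It vanishes only once the product is known to
    be 1, so uniqueness for the linear equation is invoked.\<close>
  have uu': "cstar (u r) * u r = 1" for r
  proof -
    define Z where "Z r = cstar (u r) * u r - 1" for r
    have "Z r = 0"
    proof (rule linear_ode_zero_unique[where K = "2 * norm d"])
      show "Z 0 = 0" by (simp add: Z_def u0)
      fix r
      have "((\<lambda>r. cstar (u r) * u r - 1) has_vector_derivative
          (cstar (u r) * (u r * a r) + - (a r * cstar (u r)) * u r) - 0) (at r)"
        by (intro has_vector_derivative_diff has_vector_derivative_mult u' us' has_vector_derivative_const)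
      moreover have "(cstar (u r) * (u r * a r) + - (a r * cstar (u r)) * u r) - 0 = Z r * a r - a r * Z r"
        by (simp add: Z_def left_diff_distrib right_diff_distrib mult.assoc)
      ultimately show "(Z has_vector_derivative Z r * a r - a r * Z r) (at r)"
        unfolding Z_def[abs_def] by simp
      have "norm (Z r * a r - a r * Z r) \<le> norm (Z r) * norm (a r) + norm (a r) * norm (Z r)"
        using norm_triangle_ineq4[of "Z r * a r" "a r * Z r"] norm_mult_ineq[of "Z r" "a r"] norm_mult_ineq[of "a r" "Z r"]
        by linarith
      also have "\<dots> \<le> 2 * norm d * norm (Z r)"
        using mult_left_mono[OF na[of r], of "norm (Z r)"] by (simp add: mult_ac)
      finally show "norm (Z r * a r - a r * Z r) \<le> 2 * norm d * norm (Z r)" .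
    qed
    then show ?thesis by (simp add: Z_def)
  qed
  have coc: "u s * \<sigma> s (u r) = u (s + r)" for s r
  proof -
    define X where "X r = u s * \<sigma> s (u r) - u (s + r)" for r
    have "X r = 0"
    proof (rule linear_ode_zero_unique[where K = "norm d"])
      show "X 0 = 0" by (simp add: X_def u0 S)
      fix r
      have "((\<lambda>r. \<sigma> s (u r)) has_vector_derivative \<sigma> s (u r * a r)) (at r)"
        by (rule bounded_linear.has_vector_derivative[OF bounded_linear_star_aut[OF flowD(1)[OF \<sigma>]] u'])
      then have 1: "((\<lambda>r. u s * \<sigma> s (u r)) has_vector_derivative u s * \<sigma> s (u r * a r)) (at r)"
        by (rule has_vector_derivative_mult_right)
      have 2: "((\<lambda>r. u (s + r)) has_vector_derivative u (s + r) * a (s + r)) (at r)"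
        using vector_diff_chain_at[of "\<lambda>r. s + r" 1 r u "u (s + r) * a (s + r)"] u'
          has_vector_derivative_add[OF has_vector_derivative_const[of s] has_vector_derivative_id[of "at r"]]
        by (simp add: o_def)
      have "a (s + r) = \<sigma> s (a r)" by (simp add: a_def flowD(3)[OF \<sigma>])
      then have "u s * \<sigma> s (u r * a r) - u (s + r) * a (s + r) = X r * a (s + r)"
        by (simp add: X_def S left_diff_distrib mult.assoc)
      then show "(X has_vector_derivative X r * a (s + r)) (at r)"
        using has_vector_derivative_diff[OF 1 2] unfolding X_def[abs_def] by simp
      show "norm (X r * a (s + r)) \<le> norm d * norm (X r)"
        using norm_mult_ineq[of "X r" "a (s + r)"] mult_left_mono[OF na[of "s + r"], of "norm (X r)"]
        by (simp add: mult.commute)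
    qed
    then show ?thesis by (simp add: X_def)
  qed
  have "continuous_on UNIV u"
    by (rule has_vector_derivative_imp_continuous_on[OF u'])
  then have "cocycle \<sigma> u" by (simp add: cocycle_def unitary_def uu uu' coc)
  then show thesis using that[of u] u' by (simp add: a_def)
qed

text \<open>The two generators enter the derivative of
  \<open>\<kappa>1 r * cstar (\<kappa>2 r)\<close> only through \<open>d1 - d2\<close>. This is what
  ties each step along the path to the increment of b.\<close>

lemma dyson_Lipschitz:
  assumes \<sigma>: "flow \<sigma>" and c1: "cocycle \<sigma> \<kappa>1" and c2: "cocycle \<sigma> \<kappa>2"
    and d1: "\<forall>r. (\<kappa>1 has_vector_derivative \<kappa>1 r * \<sigma> r (\<i> *\<^sub>C d1)) (at r)"
    and d2: "\<forall>r. (\<kappa>2 has_vector_derivative \<kappa>2 r * \<sigma> r (\<i> *\<^sub>C d2)) (at r)"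
    and sa: "cstar d2 = d2"
  shows "norm (\<kappa>1 (r + h) * cstar (\<kappa>2 (r + h)) - \<kappa>1 r * cstar (\<kappa>2 r)) \<le> \<bar>h\<bar> * norm (d1 - d2 :: 'a::cstar_algebra)"
proof -
  note S = flow_simps[OF \<sigma>]
  define f where "f h = \<kappa>1 (r + h) * cstar (\<kappa>2 (r + h)) - \<kappa>1 r * cstar (\<kappa>2 r)" for h
  define f' where "f' h = \<kappa>1 (r + h) * \<sigma> (r + h) (\<i> *\<^sub>C (d1 - d2)) * cstar (\<kappa>2 (r + h))" for h
  have der: "(f has_vector_derivative f' h) (at h)" for h
  proof -
    have s2: "((\<lambda>r. cstar (\<kappa>2 r)) has_vector_derivative cstar (\<kappa>2 r * \<sigma> r (\<i> *\<^sub>C d2))) (at r)" for r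
      using bounded_linear.has_vector_derivative[OF bounded_linear_cstar] d2 by blast
    have d1': "(\<kappa>1 has_vector_derivative \<kappa>1 r * \<sigma> r (\<i> *\<^sub>C d1)) (at r)" for r using d1 by blast
    have "((\<lambda>r. \<kappa>1 r * cstar (\<kappa>2 r)) has_vector_derivative
        \<kappa>1 r * cstar (\<kappa>2 r * \<sigma> r (\<i> *\<^sub>C d2)) + \<kappa>1 r * \<sigma> r (\<i> *\<^sub>C d1) * cstar (\<kappa>2 r)) (at r)" for r
      by (rule has_vector_derivative_mult[OF d1' s2])
    moreover have "\<kappa>1 r * cstar (\<kappa>2 r * \<sigma> r (\<i> *\<^sub>C d2)) + \<kappa>1 r * \<sigma> r (\<i> *\<^sub>C d1) * cstar (\<kappa>2 r)
        = \<kappa>1 r * \<sigma> r (\<i> *\<^sub>C (d1 - d2)) * cstar (\<kappa>2 r)" for r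
    proof -
      have "cstar (\<sigma> r (\<i> *\<^sub>C d2)) = - (\<i> *\<^sub>C \<sigma> r d2)"
        by (simp add: S cstar_scaleC S(4)[symmetric] sa)
      then show ?thesis
        by (simp add: cstar_mult S scaleC_diff_right left_diff_distrib right_diff_distrib mult.assoc)
    qed
    ultimately have "((\<lambda>r. \<kappa>1 r * cstar (\<kappa>2 r)) has_vector_derivative \<kappa>1 r * \<sigma> r (\<i> *\<^sub>C (d1 - d2)) * cstar (\<kappa>2 r)) (at r)" for r
      by simp
    then have "((\<lambda>h. \<kappa>1 (r + h) * cstar (\<kappa>2 (r + h))) has_vector_derivative f' h) (at h)"
      using vector_diff_chain_at[of "\<lambda>h. r + h" 1 h "\<lambda>r. \<kappa>1 r * cstar (\<kappa>2 r)" "f' h"]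
        has_vector_derivative_add[OF has_vector_derivative_const[of r] has_vector_derivative_id[of "at h"]]
      by (simp add: o_def f'_def)
    from has_vector_derivative_diff[OF this has_vector_derivative_const]
    show ?thesis unfolding f_def[abs_def] by simp
  qed
  have "norm (f h) \<le> norm (d1 - d2) * \<bar>h\<bar> ^ Suc 0 / Suc 0"
  proof (rule norm_bound_from_derivative[where f = f and f' = f' and T = "\<bar>h\<bar>", OF _ der _ order_refl])
    show "f 0 = 0" by (simp add: f_def)
    fix t
    have "norm (f' t) \<le> norm (\<kappa>1 (r + t)) * norm (d1 - d2) * norm (\<kappa>2 (r + t))"
      unfolding f'_def using norm_mult3_le[of "\<kappa>1 (r + t)" "\<sigma> (r + t) (\<i> *\<^sub>C (d1 - d2))" "cstar (\<kappa>2 (r + t))"]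
      by (simp add: flowD(7)[OF \<sigma>] norm_scaleC)
    then show "norm (f' t) \<le> norm (d1 - d2) * \<bar>t\<bar> ^ 0"
      by (simp add: norm_unitary[OF cocycleD(7)[OF \<sigma> c1]] norm_unitary[OF cocycleD(7)[OF \<sigma> c2]])
  qed
  then show ?thesis by (simp add: f_def mult.commute)
qed

section \<open>Generators determine flows\<close>

definition gen_rel :: "(real \<Rightarrow> 'a::cstar_algebra \<Rightarrow> 'a) \<Rightarrow> 'a \<Rightarrow> 'a \<Rightarrow> bool" where
  "gen_rel W x y \<longleftrightarrow> ((\<lambda>h. (1 / h) *\<^sub>R (W h x - x)) \<longlongrightarrow> y) (at 0)"

lemma generator_Some_iff: "generator \<alpha> x = Some y \<longleftrightarrow> gen_rel \<alpha> x y"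
proof
  assume "generator \<alpha> x = Some y"
  then have ex: "\<exists>y. gen_rel \<alpha> x y" and y: "y = Lim (at 0) (\<lambda>t. (1 / t) *\<^sub>R (\<alpha> t x - x))"
    by (auto simp: generator_def gen_rel_def split: if_splits)
  then obtain y' where y': "gen_rel \<alpha> x y'" by blast
  then have "y = y'" unfolding y gen_rel_def by (rule tendsto_Lim[OF trivial_limit_at])
  with y' show "gen_rel \<alpha> x y" by simp
next
  assume "gen_rel \<alpha> x y"
  then show "generator \<alpha> x = Some y"
    unfolding generator_def gen_rel_def
    using tendsto_Lim[OF trivial_limit_at, of "\<lambda>t. (1 / t) *\<^sub>R (\<alpha> t x - x)" y] by auto
qed

lemma gen_rel_eigenvector:
  assumes e: "eigenvector \<sigma> m e" and \<sigma>: "flow \<sigma>"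
  shows "gen_rel \<sigma> e ((\<i> * of_real m) *\<^sub>C e)"
proof -
  have "((\<lambda>z. exp (\<i> * of_real m * z)) has_field_derivative \<i> * of_real m * exp (\<i> * of_real m * of_real 0)) (at (of_real 0))"
    by (auto intro!: derivative_eq_intros)
  then have "((\<lambda>r. exp (\<i> * of_real m * of_real r)) has_vector_derivative \<i> * of_real m) (at 0)"
    using field_vector_diff_chain_at[of of_real 1 0 "\<lambda>z. exp (\<i> * of_real m * z)" "\<i> * of_real m"]
      has_vector_derivative_of_real[OF DERIV_ident[of "at 0"], where 'a=complex] by (simp add: o_def)
  then have "((\<lambda>r. exp (\<i> * of_real m * of_real r) *\<^sub>C e) has_vector_derivative (\<i> * of_real m) *\<^sub>C e) (at 0)"
    by (rule bounded_linear.has_vector_derivative[OF bounded_bilinear.bounded_linear_left[OF bounded_bilinear_scaleC]])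
  then show ?thesis
    using e unfolding gen_rel_def has_vector_derivative_iff_quotient eigenvector_def by (simp add: mult.assoc)
qed

lemma gen_rel_sum:
  assumes \<sigma>: "flow \<sigma>" and "\<And>i. i \<in> I \<Longrightarrow> gen_rel \<sigma> (x i) (y i)"
  shows "gen_rel \<sigma> (\<Sum>i\<in>I. x i) (\<Sum>i\<in>I. y i)"
proof -
  have "((\<lambda>h. \<Sum>i\<in>I. (1 / h) *\<^sub>R (\<sigma> h (x i) - x i)) \<longlongrightarrow> (\<Sum>i\<in>I. y i)) (at 0)"
    using assms(2) unfolding gen_rel_def by (intro tendsto_sum) auto
  then show ?thesis
    unfolding gen_rel_def by (simp add: star_aut_sum[OF flowD(1)[OF \<sigma>]] scaleR_sum_right[symmetric] sum_subtractf)
qed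

text \<open>The domain of the generator of \<beta> is invariant under \<beta>, and there
  \<open>\<tau> (- r) (\<beta> r x)\<close> has derivative 0 in r. Hence one inclusion of generators
  already forces equality.\<close>

lemma flow_eqI_generator:
  assumes \<tau>: "flow \<tau>" and \<beta>: "flow \<beta>" and sub: "\<And>x y. gen_rel \<beta> x y \<Longrightarrow> gen_rel \<tau> x y"
    and dense: "closure {x. \<exists>y. gen_rel \<beta> x y} = UNIV"
  shows "\<tau> = \<beta>"
proof -
  note T = flow_simps[OF \<tau>] and B = flow_simps[OF \<beta>]
  have eq: "\<tau> r x = \<beta> r x" if x: "gen_rel \<beta> x y" for x y r
  proof -
    have "\<tau> (- r) (\<beta> r x) = \<tau> (- 0) (\<beta> 0 x)"
    proof (rule has_vector_derivative_zero_imp_eq[where f = "\<lambda>r. \<tau> (- r) (\<beta> r x)"])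
      fix r
      have "((\<lambda>h. \<beta> r ((1 / h) *\<^sub>R (\<beta> h x - x))) \<longlongrightarrow> \<beta> r y) (at 0)"
        using x unfolding gen_rel_def
        by (rule bounded_linear.tendsto[OF bounded_linear_star_aut[OF flowD(1)[OF \<beta>]]])
      moreover have "\<beta> r ((1 / h) *\<^sub>R (\<beta> h x - x)) = (1 / h) *\<^sub>R (\<beta> h (\<beta> r x) - \<beta> r x)" for h
        using flowD(3)[OF \<beta>, of r h x] flowD(3)[OF \<beta>, of h r x] by (simp add: B add.commute)
      ultimately have g: "gen_rel \<beta> (\<beta> r x) (\<beta> r y)" by (simp add: gen_rel_def)
      have "((\<lambda>h. (1 / h) *\<^sub>R (\<beta> h (\<beta> r x) - \<beta> r x) - (1 / h) *\<^sub>R (\<tau> h (\<beta> r x) - \<beta> r x)) \<longlongrightarrow> \<beta> r y - \<beta> r y) (at 0)"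
        using g sub[OF g] unfolding gen_rel_def by (rule tendsto_diff)
      then have "((\<lambda>h. (1 / h) *\<^sub>R (\<beta> h (\<beta> r x) - \<tau> h (\<beta> r x))) \<longlongrightarrow> 0) (at 0)"
        by (simp add: scaleR_diff_right[symmetric])
      then have "((\<lambda>h. norm ((1 / h) *\<^sub>R (\<beta> h (\<beta> r x) - \<tau> h (\<beta> r x)))) \<longlongrightarrow> 0) (at 0)"
        by (rule tendsto_norm_zero)
      \<comment> \<open>Isometry of \<tau> strips the outer automorphism from the difference
        quotient and leaves the difference of the two flows at \<open>\<beta> r x\<close>.\<close>
      moreover have "norm ((1 / h) *\<^sub>R (\<tau> (- (r + h)) (\<beta> (r + h) x) - \<tau> (- r) (\<beta> r x)))
          = norm ((1 / h) *\<^sub>R (\<beta> h (\<beta> r x) - \<tau> h (\<beta> r x)))" for h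
      proof -
        have "\<tau> (- r) (\<beta> r x) = \<tau> (- (r + h)) (\<tau> h (\<beta> r x))"
          using flowD(3)[OF \<tau>, of "- (r + h)" h] by simp
        moreover have "\<beta> (r + h) x = \<beta> h (\<beta> r x)" using flowD(3)[OF \<beta>, of h r] by (simp add: add.commute)
        ultimately have "\<tau> (- (r + h)) (\<beta> (r + h) x) - \<tau> (- r) (\<beta> r x) = \<tau> (- (r + h)) (\<beta> h (\<beta> r x) - \<tau> h (\<beta> r x))"
          by (simp add: T)
        then show ?thesis by (simp add: flowD(7)[OF \<tau>])
      qed
      ultimately have "((\<lambda>h. norm ((1 / h) *\<^sub>R (\<tau> (- (r + h)) (\<beta> (r + h) x) - \<tau> (- r) (\<beta> r x)))) \<longlongrightarrow> 0) (at 0)"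
        by (simp only:)
      then show "((\<lambda>r. \<tau> (- r) (\<beta> r x)) has_vector_derivative 0) (at r)"
        unfolding has_vector_derivative_iff_quotient by (rule tendsto_norm_zero_cancel)
    qed
    then have "\<tau> r (\<tau> (- r) (\<beta> r x)) = \<tau> r x" by (simp add: flowD(2)[OF \<tau>] flowD(2)[OF \<beta>])
    then show ?thesis by (simp add: flowD(5)[OF \<tau>])
  qed
  show ?thesis
  proof (intro ext)
    fix r x
    have "closed {x. \<tau> r x = \<beta> r x}"
      by (intro closed_Collect_eq linear_continuous_on bounded_linear_star_aut flowD(1) \<tau> \<beta>)
    moreover have "{x. \<exists>y. gen_rel \<beta> x y} \<subseteq> {x. \<tau> r x = \<beta> r x}" using eq by blast
    ultimately have "closure {x. \<exists>y. gen_rel \<beta> x y} \<subseteq> {x. \<tau> r x = \<beta> r x}" by (intro closure_minimal)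
    then show "\<tau> r x = \<beta> r x" using dense by blast
  qed
qed

lemma flow_Ad:
  assumes \<sigma>: "flow \<sigma>" and coc: "cocycle \<sigma> \<kappa>"
  shows "flow (\<lambda>t x. \<kappa> t * \<sigma> t x * cstar (\<kappa> t))"
proof -
  note S = flow_simps[OF \<sigma>] and K = cocycleD[OF \<sigma> coc]
  have K2: "cstar (\<kappa> t) * (\<kappa> t * x) = x" "\<kappa> t * (cstar (\<kappa> t) * x) = x" for t x
    by (simp_all add: mult.assoc[symmetric] K)
  show ?thesis
    unfolding flow_def
  proof (intro conjI allI)
    fix t
    show "star_aut (\<lambda>x. \<kappa> t * \<sigma> t x * cstar (\<kappa> t))"
      unfolding star_aut_def
    proof (intro conjI allI)
      show "bij (\<lambda>x. \<kappa> t * \<sigma> t x * cstar (\<kappa> t))"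
      proof (rule o_bij[of "\<lambda>x. \<sigma> (- t) (cstar (\<kappa> t) * x * \<kappa> t)"])
        show "(\<lambda>x. \<sigma> (- t) (cstar (\<kappa> t) * x * \<kappa> t)) \<circ> (\<lambda>x. \<kappa> t * \<sigma> t x * cstar (\<kappa> t)) = id"
          by (rule ext) (simp add: mult.assoc K2 K flowD(6)[OF \<sigma>])
        show "(\<lambda>x. \<kappa> t * \<sigma> t x * cstar (\<kappa> t)) \<circ> (\<lambda>x. \<sigma> (- t) (cstar (\<kappa> t) * x * \<kappa> t)) = id"
          by (rule ext) (simp add: mult.assoc K2 K flowD(5)[OF \<sigma>])
      qed
    qed (simp_all add: S distrib_left distrib_right scaleC_mult_left scaleC_mult_right mult.assoc K2 cstar_mult)
  next
    show "(\<lambda>x. \<kappa> 0 * \<sigma> 0 x * cstar (\<kappa> 0)) = id" by (rule ext) (simp add: K flowD(2)[OF \<sigma>])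
    show "(\<lambda>x. \<kappa> (s + t) * \<sigma> (s + t) x * cstar (\<kappa> (s + t))) =
        (\<lambda>x. \<kappa> s * \<sigma> s x * cstar (\<kappa> s)) \<circ> (\<lambda>x. \<kappa> t * \<sigma> t x * cstar (\<kappa> t))" for s t
      by (rule ext) (simp add: K(4) S flowD(3)[OF \<sigma>] cstar_mult mult.assoc)
    show "continuous_on UNIV (\<lambda>t. \<kappa> t * \<sigma> t x * cstar (\<kappa> t))" for x
      by (intro continuous_intros K(1) flowD(4)[OF \<sigma>] bounded_linear.continuous_on[OF bounded_linear_cstar])
  qed
qed

lemma gen_rel_Ad:
  assumes \<sigma>: "flow \<sigma>" and coc: "cocycle \<sigma> \<kappa>"
    and d: "\<forall>r. (\<kappa> has_vector_derivative \<kappa> r * \<sigma> r (\<i> *\<^sub>C d)) (at r)" and sa: "cstar d = d"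
    and g: "gen_rel \<sigma> x y"
  shows "gen_rel (\<lambda>t x. \<kappa> t * \<sigma> t x * cstar (\<kappa> t)) x (y + ad_i d x)"
proof -
  note K = cocycleD[OF \<sigma> coc]
  have k: "(\<kappa> has_vector_derivative \<i> *\<^sub>C d) (at 0)" using d[rule_format, of 0] by (simp add: K(5) flowD(2)[OF \<sigma>])
  have ks: "((\<lambda>r. cstar (\<kappa> r)) has_vector_derivative - (\<i> *\<^sub>C d)) (at 0)"
    using bounded_linear.has_vector_derivative[OF bounded_linear_cstar k] by (simp add: cstar_scaleC sa)
  have s: "((\<lambda>r. \<sigma> r x) has_vector_derivative y) (at 0)"
    using g unfolding gen_rel_def has_vector_derivative_iff_quotient by (simp add: flowD(2)[OF \<sigma>])
  have "((\<lambda>r. \<kappa> r * \<sigma> r x * cstar (\<kappa> r)) has_vector_derivative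
      (\<kappa> 0 * \<sigma> 0 x) * - (\<i> *\<^sub>C d) + (\<kappa> 0 * y + \<i> *\<^sub>C d * \<sigma> 0 x) * cstar (\<kappa> 0)) (at 0)"
    by (rule has_vector_derivative_mult[OF has_vector_derivative_mult[OF k s] ks])
  moreover have "(\<kappa> 0 * \<sigma> 0 x) * - (\<i> *\<^sub>C d) + (\<kappa> 0 * y + \<i> *\<^sub>C d * \<sigma> 0 x) * cstar (\<kappa> 0) = y + ad_i d x"
    by (simp add: K(5) flowD(2)[OF \<sigma>] ad_i_def scaleC_diff_right scaleC_mult_left scaleC_mult_right)
  ultimately have "((\<lambda>r. \<kappa> r * \<sigma> r x * cstar (\<kappa> r)) has_vector_derivative y + ad_i d x) (at 0)"
    by (simp only:)
  then show ?thesis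
    unfolding gen_rel_def has_vector_derivative_iff_quotient by (simp add: K(5) flowD(2)[OF \<sigma>])
qed

section \<open>Conjugated flows\<close>

lemma star_aut_comp: "star_aut f \<Longrightarrow> star_aut g \<Longrightarrow> star_aut (f \<circ> g)"
  by (simp add: star_aut_def bij_comp)

lemma flow_conjugate:
  assumes \<alpha>: "flow \<alpha>" and \<gamma>: "star_aut \<gamma>"
  shows "flow (\<lambda>t. \<gamma> \<circ> \<alpha> t \<circ> inv \<gamma>)"
  unfolding flow_def
proof (intro conjI allI)
  show "star_aut (\<gamma> \<circ> \<alpha> t \<circ> inv \<gamma>)" for t
    by (intro star_aut_comp \<gamma> flowD(1)[OF \<alpha>] star_aut_inv(1))
  show "\<gamma> \<circ> \<alpha> 0 \<circ> inv \<gamma> = id"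
    by (rule ext) (simp add: flowD(2)[OF \<alpha>] star_aut_inv(3)[OF \<gamma>])
  show "\<gamma> \<circ> \<alpha> (s + t) \<circ> inv \<gamma> = \<gamma> \<circ> \<alpha> s \<circ> inv \<gamma> \<circ> (\<gamma> \<circ> \<alpha> t \<circ> inv \<gamma>)" for s t
    by (rule ext) (simp add: flowD(3)[OF \<alpha>] star_aut_inv(2)[OF \<gamma>])
  show "continuous_on UNIV (\<lambda>t. (\<gamma> \<circ> \<alpha> t \<circ> inv \<gamma>) x)" for x
    unfolding comp_def
    by (rule bounded_linear.continuous_on[OF bounded_linear_star_aut[OF \<gamma>] flowD(4)[OF \<alpha>]])
qed

lemma gen_rel_conjugate:
  assumes \<gamma>: "star_aut \<gamma>" and g: "gen_rel \<alpha> (inv \<gamma> x) y"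
  shows "gen_rel (\<lambda>t. \<gamma> \<circ> \<alpha> t \<circ> inv \<gamma>) x (\<gamma> y)"
proof -
  have "((\<lambda>h. \<gamma> ((1 / h) *\<^sub>R (\<alpha> h (inv \<gamma> x) - inv \<gamma> x))) \<longlongrightarrow> \<gamma> y) (at 0)"
    using g unfolding gen_rel_def by (rule bounded_linear.tendsto[OF bounded_linear_star_aut[OF \<gamma>]])
  then show ?thesis unfolding gen_rel_def by (simp add: star_autD(9,10)[OF \<gamma>] star_aut_inv(3)[OF \<gamma>])
qed

lemma gen_rel_conjugateD:
  assumes \<gamma>: "star_aut \<gamma>" and g: "gen_rel (\<lambda>t. \<gamma> \<circ> \<alpha> t \<circ> inv \<gamma>) x y"
  shows "gen_rel \<alpha> (inv \<gamma> x) (inv \<gamma> y)"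
proof -
  note I = star_aut_inv[OF \<gamma>]
  have "((\<lambda>h. inv \<gamma> ((1 / h) *\<^sub>R ((\<gamma> \<circ> \<alpha> h \<circ> inv \<gamma>) x - x))) \<longlongrightarrow> inv \<gamma> y) (at 0)"
    using g unfolding gen_rel_def by (rule bounded_linear.tendsto[OF bounded_linear_star_aut[OF I(1)]])
  then show ?thesis unfolding gen_rel_def by (simp add: star_autD(9,10)[OF I(1)] I(2))
qed

lemma eigenvector_conjugate:
  assumes \<gamma>: "star_aut \<gamma>" and e: "eigenvector \<alpha> m e"
  shows "eigenvector (\<lambda>t. \<gamma> \<circ> \<alpha> t \<circ> inv \<gamma>) m (\<gamma> e)"
  using e by (simp add: eigenvector_def star_aut_inv(2)[OF \<gamma>] star_autD(3)[OF \<gamma>])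

lemma eigen_sums_conjugate_dense:
  assumes \<gamma>: "star_aut \<gamma>" and dense: "closure (eigen_sums \<alpha>) = UNIV"
  shows "closure (eigen_sums (\<lambda>t. \<gamma> \<circ> \<alpha> t \<circ> inv \<gamma>)) = UNIV"
proof -
  let ?E = "eigen_sums (\<lambda>t. \<gamma> \<circ> \<alpha> t \<circ> inv \<gamma>)"
  have "\<gamma> ` eigen_sums \<alpha> \<subseteq> ?E"
  proof
    fix y assume "y \<in> \<gamma> ` eigen_sums \<alpha>"
    then obtain L f where "finite (L::real set)" "\<forall>m\<in>L. eigenvector \<alpha> m (f m)" "y = \<gamma> (\<Sum>m\<in>L. f m)"
      by (auto simp: eigen_sums_def)
    then show "y \<in> ?E"
      unfolding eigen_sums_def using eigenvector_conjugate[OF \<gamma>]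
      by (auto simp: star_aut_sum[OF \<gamma>] intro!: exI[of _ L] exI[of _ "\<lambda>m. \<gamma> (f m)"])
  qed
  moreover have "\<gamma> ` closure (eigen_sums \<alpha>) \<subseteq> closure (\<gamma> ` eigen_sums \<alpha>)"
    by (intro image_closure_subset linear_continuous_on bounded_linear_star_aut \<gamma> closed_closure closure_subset)
  ultimately have "range \<gamma> \<subseteq> closure ?E" using dense closure_mono by blast
  then show ?thesis using bij_is_surj[OF star_autD(1)[OF \<gamma>]] by auto
qed

lemma eigen_sums_generator_dense:
  assumes \<sigma>: "flow \<sigma>" and dense: "closure (eigen_sums \<sigma>) = UNIV"
  shows "closure {x. \<exists>y. gen_rel \<sigma> x y} = UNIV"
proof -
  have "eigen_sums \<sigma> \<subseteq> {x. \<exists>y. gen_rel \<sigma> x y}"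
  proof
    fix x assume "x \<in> eigen_sums \<sigma>"
    then obtain L f where L: "finite (L::real set)" "\<forall>m\<in>L. eigenvector \<sigma> m (f m)" "x = (\<Sum>m\<in>L. f m)"
      by (auto simp: eigen_sums_def)
    then have "gen_rel \<sigma> x (\<Sum>m\<in>L. (\<i> * of_real m) *\<^sub>C f m)"
      using gen_rel_eigenvector[OF _ \<sigma>] by (auto intro!: gen_rel_sum[OF \<sigma>])
    then show "x \<in> {x. \<exists>y. gen_rel \<sigma> x y}" by blast
  qed
  then have "closure (eigen_sums \<sigma>) \<subseteq> closure {x. \<exists>y. gen_rel \<sigma> x y}" by (rule closure_mono)
  then show ?thesis using dense by blast
qed

section \<open>Comparison of perturbed states on projections\<close>

lemma strip_fun_shift:
  assumes F: "strip_fun c F f g"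
  shows "strip_fun c (\<lambda>z. F (z + of_real h)) (\<lambda>t. f (t + h)) (\<lambda>t. g (t + h))"
proof -
  have img: "(\<lambda>z. z + of_real h) ` strip c = strip c"
  proof
    show "(\<lambda>z. z + of_real h) ` strip c \<subseteq> strip c" by auto
    show "strip c \<subseteq> (\<lambda>z. z + of_real h) ` strip c"
    proof
      fix z assume "z \<in> strip c"
      then have "z + of_real (- h) \<in> strip c" by (simp only: strip_add_real)
      then show "z \<in> (\<lambda>z. z + of_real h) ` strip c" by (intro image_eqI[of _ _ "z + of_real (- h)"]) simp_all
    qed
  qed
  have int: "(\<lambda>z. z + of_real h) ` interior (strip c) = interior (strip c)"
    using interior_translation[of "of_real h" "strip c"] img by (simp add: add.commute)
  show ?thesis
    unfolding strip_fun_def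
  proof (intro conjI allI)
    show "continuous_on (strip c) (\<lambda>z. F (z + of_real h))"
      using F img unfolding strip_fun_def by (intro continuous_on_compose2[of "strip c" F _ "\<lambda>z. z + of_real h"] continuous_intros) simp_all
    have "(\<lambda>z. F (z + of_real h)) ` strip c = F ` ((\<lambda>z. z + of_real h) ` strip c)" by (simp only: image_image)
    then show "bounded ((\<lambda>z. F (z + of_real h)) ` strip c)" using F img by (simp add: strip_fun_def)
    have "(\<lambda>z. z + of_real h) holomorphic_on interior (strip c)" by (intro holomorphic_intros)
    from holomorphic_on_compose_gen[OF this, of F "interior (strip c)"]
    show "(\<lambda>z. F (z + of_real h)) holomorphic_on interior (strip c)"
      using F int by (simp add: strip_fun_def o_def)
    show "F (of_real t + of_real h) = f (t + h)" for t using F unfolding strip_fun_def by (metis of_real_add)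
    show "F (of_real t + \<i> * of_real c + of_real h) = g (t + h)" for t
      using F unfolding strip_fun_def by (metis of_real_add add.commute add.assoc)
  qed
qed

text \<open>Used for the character by which two cocycles differ: at the far edge it becomes the same
  character times a constant.\<close>

lemma strip_fun_exp_mult:
  assumes c: "c \<noteq> 0" and F: "strip_fun c F f g"
  shows "strip_fun c (\<lambda>z. exp (\<i> * of_real m * z) * F z) (\<lambda>t. exp (\<i> * of_real m * of_real t) * f t)
    (\<lambda>t. exp (\<i> * of_real m * (of_real t + \<i> * of_real c)) * g t)"
proof -
  obtain B where B: "\<And>z. z \<in> strip c \<Longrightarrow> norm (F z) \<le> B"
    using F by (force simp: bounded_iff strip_fun_def)
  have "norm (exp (\<i> * of_real m * z) * F z) \<le> exp (\<bar>m\<bar> * \<bar>c\<bar>) * B" if "z \<in> strip c" for z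
    unfolding norm_mult using norm_exp_eigen_le[OF c that] B[OF that] by (intro mult_mono) auto
  then have "bounded ((\<lambda>z. exp (\<i> * of_real m * z) * F z) ` strip c)" by (auto intro!: boundedI)
  then show ?thesis
    using F unfolding strip_fun_def by (auto intro!: continuous_intros holomorphic_intros)
qed

text \<open>A Lipschitz bound along both boundary lines bounds the derivative inside the strip, hence the
  oscillation across it.\<close>

lemma strip_fun_oscillation:
  assumes c: "c \<noteq> 0" and F: "strip_fun c F f g"
    and f: "\<And>t h. norm (f (t + h) - f t) \<le> M * \<bar>h\<bar>" and g: "\<And>t h. norm (g (t + h) - g t) \<le> M * \<bar>h\<bar>"
  shows "norm (g 0 - f 0) \<le> M * \<bar>c\<bar>"
proof -
  have lip: "norm (F (z + of_real h) - F z) \<le> M * \<bar>h\<bar>" if "z \<in> strip c" for z h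
    by (rule strip_fun_bound[OF c strip_fun_diff[OF strip_fun_shift[OF F] F] _ _ that]) (use f g in auto)
  define p where "p s = \<i> * of_real (c * s)" for s :: real
  have hol: "F holomorphic_on interior (strip c)" and cont: "continuous_on (strip c) F"
    using F by (auto simp: strip_fun_def)
  define d where "d s = deriv F (p s) * (\<i> * of_real c)" for s
  have inner: "p s \<in> interior (strip c)" "p s \<in> strip c" if "0 < s" "s < 1" for s
  proof -
    show "p s \<in> interior (strip c)"
      by (rule subsetD[OF strip_inner_subset]) (use that c in \<open>simp add: p_def\<close>)
    then show "p s \<in> strip c" by (rule subsetD[OF interior_subset])
  qed
  have der: "((\<lambda>s. F (p s)) has_vector_derivative d s) (at s)" if s: "0 < s" "s < 1" for s
  proof -
    have D: "(F has_field_derivative deriv F (p s)) (at (p s))"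
      by (rule holomorphic_derivI[OF hol open_interior inner(1)[OF s]])
    have "((\<lambda>s. \<i> * of_real (c * s)) has_vector_derivative \<i> * of_real c) (at s)"
      by (auto intro!: derivative_eq_intros)
    then have "(p has_vector_derivative \<i> * of_real c) (at s)" by (simp add: p_def[abs_def])
    from field_vector_diff_chain_at[OF this D] show ?thesis by (simp add: o_def d_def mult.commute)
  qed
  have bd: "norm (d s) \<le> M * \<bar>c\<bar>" if s: "0 < s" "s < 1" for s
  proof -
    have D: "(F has_field_derivative deriv F (p s)) (at (p s))"
      by (rule holomorphic_derivI[OF hol open_interior inner(1)[OF s]])
    have "filterlim (\<lambda>h::real. complex_of_real h) (at 0) (at 0)"
      by (auto simp: filterlim_at eventually_at_filter intro!: tendsto_eq_intros)
    then have "((\<lambda>h::real. (F (p s + of_real h) - F (p s)) / of_real h) \<longlongrightarrow> deriv F (p s)) (at 0)"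
      using D unfolding DERIV_def by (rule filterlim_compose[rotated])
    then have "((\<lambda>h::real. norm ((F (p s + of_real h) - F (p s)) / of_real h)) \<longlongrightarrow> norm (deriv F (p s))) (at 0)"
      by (rule tendsto_norm)
    moreover have "\<forall>\<^sub>F h::real in at 0. norm ((F (p s + of_real h) - F (p s)) / of_real h) \<le> M"
      unfolding eventually_at_filter
    proof (intro always_eventually allI impI)
      fix h :: real assume "h \<noteq> 0"
      then show "norm ((F (p s + of_real h) - F (p s)) / of_real h) \<le> M"
        using lip[OF inner(2)[OF s], of h] by (simp add: norm_divide field_simps)
    qed
    ultimately have "norm (deriv F (p s)) \<le> M" by (rule tendsto_upperbound[OF _ _ trivial_limit_at])
    then show ?thesis unfolding d_def by (simp add: norm_mult mult_right_mono)
  qed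
  have "norm (F (p 1) - F (p 0)) \<le> M * \<bar>c\<bar> * 1 - M * \<bar>c\<bar> * 0"
  proof (rule differentiable_bound_general[where f = "\<lambda>s. F (p s)" and f' = d and \<phi> = "\<lambda>s. M * \<bar>c\<bar> * s" and \<phi>' = "\<lambda>s. M * \<bar>c\<bar>"])
    have "continuous_on {0..1} p" unfolding p_def by (intro continuous_intros)
    moreover have "p ` {0..1} \<subseteq> strip c" using c by (auto simp: p_def strip_def)
    ultimately show "continuous_on {0..1} (\<lambda>s. F (p s))" by (intro continuous_on_compose2[OF cont, of _ p])
    show "continuous_on {0..1} (\<lambda>s. M * \<bar>c\<bar> * s)" by (intro continuous_intros)
    show "((\<lambda>s. M * \<bar>c\<bar> * s) has_vector_derivative M * \<bar>c\<bar>) (at s)" for s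
      by (auto intro!: derivative_eq_intros)
  qed (use der bd in auto)
  moreover have "F (p 0) = f 0" "F (p 1) = g 0"
    using F unfolding strip_fun_def p_def by (metis of_real_0 mult_zero_right, metis of_real_0 add_0 mult_1_right)
  ultimately show ?thesis by simp
qed

section \<open>Close invariant projections\<close>

lemma norm_projection_le: "projection (q::'a::cstar_algebra) \<Longrightarrow> norm q \<le> 1"
  using cstar_identity[of q] by (cases "q = 0") (auto simp: projection_def power2_eq_square)

text \<open>Turns a relative additive error into a factor that can be multiplied up along a
  partition. The inequality behind it is \<open>1 \<le> (1 - k) * (1 + 2 * k)\<close> for 0 \<le> k
  \<le> 1/2.\<close>

lemma exp_absorb:
  fixes A B k :: real
  assumes A: "A \<ge> 0" and B: "B \<ge> 0" and k: "0 \<le> k" "k \<le> 1 / 2" and le: "\<bar>B - A\<bar> \<le> k * max A B"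
  shows "B \<le> A * exp (2 * k)"
proof (cases "B \<le> A")
  case True
  have "A * 1 \<le> A * exp (2 * k)" using A k by (intro mult_left_mono) auto
  with True show ?thesis by simp
next
  case False
  then have "B - A \<le> k * B" using le by (simp add: max_def)
  then have BA: "B * (1 - k) \<le> A" by (simp add: algebra_simps)
  have "0 \<le> k * (1 - 2 * k)" using k by simp
  then have "1 \<le> (1 - k) * (1 + 2 * k)" by (simp add: algebra_simps)
  also have "\<dots> \<le> (1 - k) * exp (2 * k)"
    using k exp_ge_add_one_self[of "2 * k"] by (intro mult_left_mono) auto
  finally have "B * 1 \<le> B * ((1 - k) * exp (2 * k))" using B by (rule mult_left_mono)
  also have "\<dots> = (B * (1 - k)) * exp (2 * k)" by simp
  also have "\<dots> \<le> A * exp (2 * k)" using BA by (rule mult_right_mono) simp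
  finally show ?thesis by simp
qed

context kms_system
begin

text \<open>Kato's pair: for close projections, \<open>y = q\<^sub>1 q\<^sub>2\<close> and \<open>x = (1 - (q\<^sub>1 - q\<^sub>2)\<^sup>2)\<^sup>-\<^sup>1 q\<^sub>2 q\<^sub>1\<close> satisfy
  \<open>x y = q\<^sub>2\<close> and \<open>y x = q\<^sub>1\<close>, and \<open>\<kappa>\<^sub>1 \<sigma>(y) \<kappa>\<^sub>2\<^sup>* = q\<^sub>1 (\<kappa>\<^sub>1 \<kappa>\<^sub>2\<^sup>*) q\<^sub>2\<close> varies slowly.\<close>

lemma projection_estimate:
  assumes p1: "perturbation \<kappa>1 w1 V1" and p2: "perturbation \<kappa>2 w2 V2"
    and q1: "projection q1" "\<And>r. \<kappa>1 r * \<sigma> r q1 * cstar (\<kappa>1 r) = q1"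
    and q2: "projection q2" "\<And>r. \<kappa>2 r * \<sigma> r q2 * cstar (\<kappa>2 r) = q2"
    and close: "norm (q1 - q2) \<le> 1 / 2"
    and lip: "\<And>r h. norm (\<kappa>1 (r + h) * cstar (\<kappa>2 (r + h)) - \<kappa>1 r * cstar (\<kappa>2 r)) \<le> \<bar>h\<bar> * d"
    and small: "4 * \<bar>c\<bar> * d \<le> 1 / 2" and d0: "d \<ge> 0"
  shows "Re (perturbed w1 V1 q1) \<le> Re (perturbed w2 V2 q2) * exp (8 * \<bar>c\<bar> * d)"
proof -
  interpret A: kms_perturbation c \<sigma> \<psi> \<kappa>1 w1 V1 by unfold_locales (rule p1)
  interpret B: kms_perturbation c \<sigma> \<psi> \<kappa>2 w2 V2 by unfold_locales (rule p2)
  define \<phi>1 where "\<phi>1 = perturbed w1 V1"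
  define \<phi>2 where "\<phi>2 = perturbed w2 V2"
  have pf1: "positive_functional \<phi>1" and pf2: "positive_functional \<phi>2"
    unfolding \<phi>1_def \<phi>2_def by (rule A.perturbed_positive B.perturbed_positive)+
  have Q1: "cstar q1 = q1" "q1 * q1 = q1" and Q2: "cstar q2 = q2" "q2 * q2 = q2"
    using q1 q2 by (auto simp: projection_def)
  have Q1': "q1 * (q1 * z) = q1 * z" and Q2': "q2 * (q2 * z) = q2 * z" for z
    by (simp_all add: mult.assoc[symmetric] Q1 Q2)
  define e where "e = (q1 - q2) * (q1 - q2)"
  have "norm e \<le> norm (q1 - q2) * norm (q1 - q2)" unfolding e_def by (rule norm_mult_ineq)
  also have "\<dots> \<le> 1 / 2 * (1 / 2)" using close by (intro mult_mono) auto
  finally have ne: "norm e \<le> 1 / 4" by simp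
  then have "norm e < 1" by simp
  then obtain R where R: "(1 - e) * R = 1" "R * (1 - e) = 1" "norm R \<le> 1 / (1 - norm e)"
    by (rule neumann_inverse)
  have "1 / (1 - norm e) \<le> 1 / (1 / 2)" using ne by (intro divide_left_mono) auto
  then have nR: "norm R \<le> 2" using R(3) by simp
  \<comment> \<open>Both projections commute with \<open>1 - e\<close>, hence with its inverse
    R.\<close>
  have e1: "q1 * (1 - e) = q1 * q2 * q1" "(1 - e) * q1 = q1 * q2 * q1"
    by (simp_all add: e_def left_diff_distrib right_diff_distrib Q1 Q2 mult.assoc Q1' Q2')
  have e2: "q2 * (1 - e) = q2 * q1 * q2" "(1 - e) * q2 = q2 * q1 * q2"
    by (simp_all add: e_def left_diff_distrib right_diff_distrib Q1 Q2 mult.assoc Q1' Q2')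
  have R1: "R * q1 = q1 * R" and R2: "R * q2 = q2 * R"
    using inverse_commute[OF R(1,2), of q1] inverse_commute[OF R(1,2), of q2] e1 e2 by simp_all
  define x where "x = R * q2 * q1"
  define y where "y = q1 * q2"
  have xy: "x * y = q2"
  proof -
    have "x * y = R * (q2 * q1 * q2)" by (simp add: x_def y_def mult.assoc Q1')
    also have "\<dots> = R * (1 - e) * q2" by (simp only: e2(2) mult.assoc)
    finally show ?thesis by (simp add: R)
  qed
  have yx: "y * x = q1"
  proof -
    have "y * x = q1 * (q2 * R) * q2 * q1" by (simp add: x_def y_def mult.assoc)
    also have "\<dots> = (q1 * R) * (q2 * q1)" unfolding R2[symmetric] by (simp add: mult.assoc Q2')
    also have "\<dots> = R * (q1 * q2 * q1)" unfolding R1[symmetric] by (simp add: mult.assoc)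
    also have "\<dots> = R * (1 - e) * q1" by (simp only: e1(2) mult.assoc)
    finally show ?thesis by (simp add: R)
  qed
  have q2x: "q2 * x = x" unfolding x_def mult.assoc[symmetric] R2[symmetric] by (simp add: mult.assoc Q2')
  have xq1: "x * q1 = x" by (simp add: x_def mult.assoc Q1)
  have nx: "norm x \<le> 2"
  proof -
    have "norm x \<le> norm R * norm q2 * norm q1" unfolding x_def by (rule norm_mult3_le)
    also have "\<dots> \<le> 2 * 1 * 1" using nR norm_projection_le[OF q1(1)] norm_projection_le[OF q2(1)]
      by (intro mult_mono) auto
    finally show ?thesis by simp
  qed
  define k where "k r = \<kappa>1 r * cstar (\<kappa>2 r)" for r
  have k0: "k 0 = 1" by (simp add: k_def A.K(5) B.K(5))
  \<comment> \<open>Invariance of q1 and q2 under their perturbed flows lets the projections pass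
    outside the cocycles.\<close>
  have U: "\<kappa>1 r * \<sigma> r y * cstar (\<kappa>2 r) = q1 * k r * q2" for r
  proof -
    have "q1 * \<kappa>1 r = \<kappa>1 r * \<sigma> r q1 * (cstar (\<kappa>1 r) * \<kappa>1 r)" using q1(2)[of r] by (metis mult.assoc)
    then have 1: "\<kappa>1 r * \<sigma> r q1 = q1 * \<kappa>1 r" by (simp add: A.K)
    have "cstar (\<kappa>2 r) * q2 = (cstar (\<kappa>2 r) * \<kappa>2 r) * \<sigma> r q2 * cstar (\<kappa>2 r)" using q2(2)[of r] by (metis mult.assoc)
    then have 2: "\<sigma> r q2 * cstar (\<kappa>2 r) = cstar (\<kappa>2 r) * q2" by (simp add: B.K)
    have "\<kappa>1 r * \<sigma> r y * cstar (\<kappa>2 r) = (\<kappa>1 r * \<sigma> r q1) * (\<sigma> r q2 * cstar (\<kappa>2 r))"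
      by (simp add: y_def S mult.assoc)
    then show ?thesis unfolding 1 2 by (simp add: k_def mult.assoc)
  qed
  obtain F where F: "strip_fun c F (\<lambda>r. \<phi>2 (x * (q1 * k r * q2))) (\<lambda>r. \<phi>1 (q1 * k r * q2 * x))"
    using perturbed_relation[OF p1 p2, of x y] unfolding U \<phi>1_def \<phi>2_def by blast
  \<comment> \<open>Compression to the corner replaces the mass of the functional by its value at
    the projection; this is what makes the final error relative.\<close>
  have c1: "norm (\<phi>1 (q1 * a * q1)) \<le> 2 * Re (\<phi>1 q1) * norm a" for a
    using positive_functional_bound[OF positive_functional_compress[OF pf1, of q1], of a] by (simp add: Q1)
  have c2: "norm (\<phi>2 (q2 * a * q2)) \<le> 2 * Re (\<phi>2 q2) * norm a" for a
    using positive_functional_bound[OF positive_functional_compress[OF pf2, of q2], of a] by (simp add: Q2)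
  define b1 where "b1 = Re (\<phi>1 q1)"
  define b2 where "b2 = Re (\<phi>2 q2)"
  have b0: "b1 \<ge> 0" "b2 \<ge> 0"
    unfolding b1_def b2_def using positive_functional_projection(1) pf1 pf2 q1(1) q2(1) by blast+
  have nd: "norm (k (r + h) - k r) \<le> \<bar>h\<bar> * d" for r h using lip by (simp add: k_def)
  have na: "norm (x * (k (r + h) - k r)) \<le> 2 * (\<bar>h\<bar> * d)" "norm ((k (r + h) - k r) * x) \<le> 2 * (\<bar>h\<bar> * d)" for r h
    using norm_mult_ineq[of x "k (r + h) - k r"] norm_mult_ineq[of "k (r + h) - k r" x]
      mult_mono[OF nx nd[of r h]] by (simp_all add: mult.commute)
  \<comment> \<open>The 4 is 2 from the corner bound times 2 from \<open>norm x\<close>; the rate d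
    is the drift of the cocycles.\<close>
  have "norm (\<phi>1 (q1 * k 0 * q2 * x) - \<phi>2 (x * (q1 * k 0 * q2))) \<le> (4 * d * max b2 b1) * \<bar>c\<bar>"
  proof (rule strip_fun_oscillation[OF c0 F])
    fix r h
    have "\<phi>2 (x * (q1 * k (r + h) * q2)) - \<phi>2 (x * (q1 * k r * q2)) = \<phi>2 (q2 * (x * (k (r + h) - k r)) * q2)"
    proof -
      have *: "x * (q1 * K * q2) = q2 * (x * K) * q2" for K
      proof -
        have "x * (q1 * K * q2) = (x * q1) * K * q2" by (simp only: mult.assoc)
        also have "\<dots> = (q2 * x) * K * q2" by (simp only: xq1 q2x)
        finally show ?thesis by (simp only: mult.assoc)
      qed
      show ?thesis unfolding * by (simp add: right_diff_distrib left_diff_distrib positive_functionalD(3)[OF pf2])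
    qed
    then have "norm (\<phi>2 (x * (q1 * k (r + h) * q2)) - \<phi>2 (x * (q1 * k r * q2))) \<le> 2 * b2 * (2 * (\<bar>h\<bar> * d))"
      using order_trans[OF c2 mult_left_mono[OF na(1)[of r h]]] b0 by (simp add: b2_def)
    also have "\<dots> \<le> 4 * d * max b2 b1 * \<bar>h\<bar>"
      using mult_left_mono[of b2 "max b2 b1" "4 * d * \<bar>h\<bar>"] d0 by (simp add: mult_ac)
    finally show "norm (\<phi>2 (x * (q1 * k (r + h) * q2)) - \<phi>2 (x * (q1 * k r * q2))) \<le> 4 * d * max b2 b1 * \<bar>h\<bar>" .
    have "\<phi>1 (q1 * k (r + h) * q2 * x) - \<phi>1 (q1 * k r * q2 * x) = \<phi>1 (q1 * ((k (r + h) - k r) * x) * q1)"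
    proof -
      have *: "q1 * K * q2 * x = q1 * (K * x) * q1" for K
      proof -
        have "q1 * K * q2 * x = q1 * K * (q2 * x)" by (simp only: mult.assoc)
        also have "\<dots> = q1 * K * (x * q1)" by (simp only: xq1 q2x)
        finally show ?thesis by (simp only: mult.assoc)
      qed
      show ?thesis unfolding * by (simp add: right_diff_distrib left_diff_distrib positive_functionalD(3)[OF pf1])
    qed
    then have "norm (\<phi>1 (q1 * k (r + h) * q2 * x) - \<phi>1 (q1 * k r * q2 * x)) \<le> 2 * b1 * (2 * (\<bar>h\<bar> * d))"
      using order_trans[OF c1 mult_left_mono[OF na(2)[of r h]]] b0 by (simp add: b1_def)
    also have "\<dots> \<le> 4 * d * max b2 b1 * \<bar>h\<bar>"
      using mult_left_mono[of b1 "max b2 b1" "4 * d * \<bar>h\<bar>"] d0 by (simp add: mult_ac)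
    finally show "norm (\<phi>1 (q1 * k (r + h) * q2 * x) - \<phi>1 (q1 * k r * q2 * x)) \<le> 4 * d * max b2 b1 * \<bar>h\<bar>" .
  qed
  moreover have "q1 * k 0 * q2 * x = q1" "x * (q1 * k 0 * q2) = q2"
    using yx xy by (simp_all add: k0 y_def)
  ultimately have "norm (\<phi>1 q1 - \<phi>2 q2) \<le> (4 * d * max b2 b1) * \<bar>c\<bar>" by simp
  then have "\<bar>b1 - b2\<bar> \<le> 4 * \<bar>c\<bar> * d * max b2 b1"
    using abs_Re_le_cmod[of "\<phi>1 q1 - \<phi>2 q2"] by (simp add: b1_def b2_def mult_ac)
  then have "b1 \<le> b2 * exp (2 * (4 * \<bar>c\<bar> * d))"
    using b0 small d0 by (intro exp_absorb) auto
  then show ?thesis by (simp add: b1_def b2_def \<phi>1_def \<phi>2_def mult.assoc)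
qed

end

section \<open>Extremality and the data behind Phi\<close>

lemma KMS_conjugate:
  assumes \<gamma>: "star_aut \<gamma>" and k: "KMS c \<alpha> \<omega>"
  shows "KMS c (\<lambda>t. \<gamma> \<circ> \<alpha> t \<circ> inv \<gamma>) (\<lambda>a. \<omega> (inv \<gamma> a))"
proof -
  note I = star_autD[OF star_aut_inv(1)[OF \<gamma>]]
  have "state \<omega>" using k by (simp add: KMS_def)
  then have "state (\<lambda>a. \<omega> (inv \<gamma> a))" unfolding state_def by (simp add: I)
  moreover have "\<exists>F. strip_fun c F (\<lambda>t. \<omega> (inv \<gamma> (x * (\<gamma> \<circ> \<alpha> t \<circ> inv \<gamma>) y))) (\<lambda>t. \<omega> (inv \<gamma> ((\<gamma> \<circ> \<alpha> t \<circ> inv \<gamma>) y * x)))" for x y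
    using k unfolding KMS_iff_strip_fun by (simp add: I(4) star_aut_inv(2)[OF \<gamma>])
  ultimately show ?thesis by (simp add: KMS_iff_strip_fun)
qed

text \<open>For \<open>l = 1 / (C + 1)\<close> one has \<open>l * C < 1\<close>, so \<omega> minus l
  times \<omega>1 is positive; normalised it is again a KMS state, and extremality applies to the
  resulting convex combination.\<close>

lemma extreme_KMS_dominated:
  assumes \<omega>: "\<omega> \<in> extreme_points (KMS_simplex c \<alpha>)" and \<omega>1: "KMS c \<alpha> \<omega>1" and C: "C > 0"
    and le: "\<And>x. Re (\<omega>1 (cstar x * x)) \<le> C * Re (\<omega> (cstar x * x))"
  shows "\<omega>1 = \<omega>"
proof -
  have k: "KMS c \<alpha> \<omega>" using \<omega> by (simp add: extreme_points_def KMS_simplex_def)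
  have s: "state \<omega>" "state \<omega>1" using k \<omega>1 by (auto simp: KMS_def)
  define l where "l = 1 / (C + 1)"
  have l: "0 < l" "l < 1" "l * C \<le> 1 - 0" using C by (auto simp: l_def field_simps)
  define \<omega>2 where "\<omega>2 x = of_real (1 / (1 - l)) * (\<omega> x - of_real l * \<omega>1 x)" for x
  have comb: "\<omega> = (\<lambda>x. of_real l * \<omega>1 x + of_real (1 - l) * \<omega>2 x)"
  proof
    fix x
    have "complex_of_real (1 - l) * of_real (1 / (1 - l)) = 1"
      unfolding of_real_mult[symmetric] using l by simp
    then show "\<omega> x = of_real l * \<omega>1 x + of_real (1 - l) * \<omega>2 x"
      unfolding \<omega>2_def by (simp only: mult.assoc[symmetric]) simp
  qed
  have "state \<omega>2"
    unfolding state_def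
  proof (intro conjI allI)
    fix x y k
    show "\<omega>2 (x + y) = \<omega>2 x + \<omega>2 y" using s by (simp add: state_def \<omega>2_def algebra_simps add_divide_distrib)
    show "\<omega>2 (k *\<^sub>C x) = k * \<omega>2 x" using s by (simp add: state_def \<omega>2_def algebra_simps)
    show "Im (\<omega>2 (cstar x * x)) = 0" using s by (simp add: state_def \<omega>2_def)
    have "l * Re (\<omega>1 (cstar x * x)) \<le> l * (C * Re (\<omega> (cstar x * x)))" using le l by (intro mult_left_mono) auto
    also have "\<dots> \<le> 1 * Re (\<omega> (cstar x * x))"
      unfolding mult.assoc[symmetric] using l s by (intro mult_right_mono) (auto simp: state_def)
    finally show "Re (\<omega>2 (cstar x * x)) \<ge> 0" using l by (simp add: \<omega>2_def)
    have "\<omega> 1 = 1" "\<omega>1 1 = 1" using s by (auto simp: state_def)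
    moreover have "complex_of_real (1 - l) * of_real (1 / (1 - l)) = 1"
      unfolding of_real_mult[symmetric] using l by simp
    ultimately show "\<omega>2 1 = 1" by (simp add: \<omega>2_def mult.commute)
  qed
  moreover have "\<exists>F. strip_fun c F (\<lambda>t. \<omega>2 (x * \<alpha> t y)) (\<lambda>t. \<omega>2 (\<alpha> t y * x))" for x y
  proof -
    obtain F where F: "strip_fun c F (\<lambda>t. \<omega> (x * \<alpha> t y)) (\<lambda>t. \<omega> (\<alpha> t y * x))"
      using k unfolding KMS_iff_strip_fun by blast
    obtain F1 where F1: "strip_fun c F1 (\<lambda>t. \<omega>1 (x * \<alpha> t y)) (\<lambda>t. \<omega>1 (\<alpha> t y * x))"
      using \<omega>1 unfolding KMS_iff_strip_fun by blast
    show ?thesis unfolding \<omega>2_def using strip_fun_cmult[OF strip_fun_diff[OF F strip_fun_cmult[OF F1]]] by blast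
  qed
  ultimately have "KMS c \<alpha> \<omega>2" by (simp add: KMS_iff_strip_fun)
  then have "\<omega>1 = \<omega> \<and> \<omega>2 = \<omega>"
    using \<omega> \<omega>1 l comb unfolding extreme_points_def KMS_simplex_def by blast
  then show ?thesis by simp
qed

lemma assoc_cocycleD:
  assumes \<alpha>: "flow \<alpha>" and \<gamma>: "star_aut \<gamma>" and u: "assoc_cocycle \<alpha> \<gamma> u"
  shows "cocycle \<alpha> u" "u t * \<alpha> t x * cstar (u t) = (\<gamma> \<circ> \<alpha> t \<circ> inv \<gamma>) x"
    "cocycle (\<lambda>t. \<gamma> \<circ> \<alpha> t \<circ> inv \<gamma>) (\<lambda>t. cstar (u t))"
proof -
  show c: "cocycle \<alpha> u" using u by (simp add: assoc_cocycle_def)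
  show e: "\<And>t x. u t * \<alpha> t x * cstar (u t) = (\<gamma> \<circ> \<alpha> t \<circ> inv \<gamma>) x"
  proof -
    fix t x
    have "\<gamma> \<circ> \<alpha> t \<circ> inv \<gamma> = Ad (u t) \<circ> \<alpha> t" using u by (simp add: assoc_cocycle_def)
    then show "u t * \<alpha> t x * cstar (u t) = (\<gamma> \<circ> \<alpha> t \<circ> inv \<gamma>) x" by (simp only: comp_def Ad_def)
  qed
  note K = cocycleD[OF \<alpha> c]
  show "cocycle (\<lambda>t. \<gamma> \<circ> \<alpha> t \<circ> inv \<gamma>) (\<lambda>t. cstar (u t))"
    unfolding cocycle_def
  proof (intro conjI allI)
    show "continuous_on UNIV (\<lambda>t. cstar (u t))"
      by (rule bounded_linear.continuous_on[OF bounded_linear_cstar K(1)])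
    show "unitary (cstar (u t))" for t by (rule unitary_cstar[OF K(7)])
    show "cstar (u s) * (\<gamma> \<circ> \<alpha> s \<circ> inv \<gamma>) (cstar (u t)) = cstar (u (s + t))" for s t
    proof -
      have "cstar (u s) * (\<gamma> \<circ> \<alpha> s \<circ> inv \<gamma>) (cstar (u t)) = (cstar (u s) * u s) * \<alpha> s (cstar (u t)) * cstar (u s)"
        by (simp only: e[symmetric] mult.assoc)
      then show ?thesis by (simp add: K flow_simps[OF \<alpha>] cstar_mult)
    qed
  qed
qed

text \<open>\<open>Phi\<close> fixes its data by a choice operator. Gaussian smoothing shows that
  admissible data exist, so the chosen triple is admissible; its defining relation is restated in
  the form used by \<open>perturbation\<close>.\<close>

lemma Phi_representation:
  assumes \<alpha>: "flow \<alpha>" and \<gamma>: "\<gamma> \<in> symmetry_group \<alpha>"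
  obtains u w V where "assoc_cocycle \<alpha> \<gamma> u" "invertible_el w" "entire_fun V"
    "\<forall>t. cstar (u t) * (\<gamma> \<circ> \<alpha> t \<circ> inv \<gamma>) w = w * V (of_real t)"
    "\<forall>c \<omega>. Phi c \<alpha> \<gamma> \<omega> = (\<lambda>a. \<omega> (inv \<gamma> (inv_el w * a * w * V (\<i> * of_real c)))
        / \<omega> (inv \<gamma> (inv_el w * 1 * w * V (\<i> * of_real c))))"
proof -
  have sa: "star_aut \<gamma>" using \<gamma> by (simp add: symmetry_group_def)
  let ?\<sigma> = "\<lambda>t. \<gamma> \<circ> \<alpha> t \<circ> inv \<gamma>"
  have fl: "flow ?\<sigma>" by (rule flow_conjugate[OF \<alpha> sa])
  note S = flow_simps[OF fl]
  obtain u where u: "assoc_cocycle \<alpha> \<gamma> u" using \<gamma> by (auto simp: symmetry_group_def)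
  obtain w V where wV: "invertible_el w" "entire_fun V" "\<forall>t. cstar (u t) * ?\<sigma> t w = w * V (of_real t)"
    by (rule cocycle_perturbation_exists[OF fl assoc_cocycleD(3)[OF \<alpha> sa u]])
  have Ad: "(Ad (u t) \<circ> \<alpha> t) = ?\<sigma> t" if "assoc_cocycle \<alpha> \<gamma> u" for u t
    using that by (simp add: assoc_cocycle_def)
  have "cstar (u t) = w * V (of_real t) * ?\<sigma> t (inv_el w)" for t
  proof -
    have "w * V (of_real t) * ?\<sigma> t (inv_el w) = cstar (u t) * ?\<sigma> t (w * inv_el w)"
      unfolding wV(3)[rule_format, of t, symmetric] by (simp only: S(3) mult.assoc)
    then show ?thesis by (simp only: inv_el(1)[OF wV(1)] S(6) mult_1_right)
  qed
  then have "Phi_data \<alpha> \<gamma> u w V" unfolding Phi_data_def Ad[OF u] using u wV by blast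
  then have "\<exists>p. case p of (u, w, V) \<Rightarrow> Phi_data \<alpha> \<gamma> u w V" by (intro exI[of _ "(u, w, V)"]) simp
  from someI_ex[OF this]
  have some: "case (SOME (u, w, V). Phi_data \<alpha> \<gamma> u w V) of (u, w, V) \<Rightarrow> Phi_data \<alpha> \<gamma> u w V" .
  obtain u' w' V' where p: "(SOME (u, w, V). Phi_data \<alpha> \<gamma> u w V) = (u', w', V')" by (metis prod_cases3)
  from some p have data: "Phi_data \<alpha> \<gamma> u' w' V'" by simp
  have u': "assoc_cocycle \<alpha> \<gamma> u'" "invertible_el w'" "entire_fun V'" using data by (auto simp: Phi_data_def)
  have "cstar (u' t) * ?\<sigma> t w' = w' * V' (of_real t)" for t
  proof -
    have "cstar (u' t) = w' * V' (of_real t) * ?\<sigma> t (inv_el w')"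
      using data unfolding Phi_data_def Ad[OF u'(1)] by blast
    then have "cstar (u' t) * ?\<sigma> t w' = w' * V' (of_real t) * ?\<sigma> t (inv_el w' * w')"
      by (simp only: S(3) mult.assoc)
    then show ?thesis by (simp only: inv_el(2)[OF u'(2)] S(6) mult_1_right)
  qed
  moreover have "Phi c \<alpha> \<gamma> \<omega> = (\<lambda>a. \<omega> (inv \<gamma> (inv_el w' * a * w' * V' (\<i> * of_real c)))
        / \<omega> (inv \<gamma> (inv_el w' * 1 * w' * V' (\<i> * of_real c))))" for c \<omega>
    unfolding Phi_def p by (simp add: Let_def)
  ultimately show thesis using that[OF u'] by blast
qed

lemma G_path_continuous:
  assumes "G_path \<alpha> \<gamma>"
  shows "continuous_on {0..1} (\<lambda>t. \<gamma> t x)"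
  unfolding continuous_on_sequentially
proof (intro allI ballI impI, elim conjE)
  fix s :: "nat \<Rightarrow> real" and t assume "t \<in> {0..1}" "\<forall>n. s n \<in> {0..1}" "s \<longlonglongrightarrow> t"
  then have "G_converges \<alpha> (\<lambda>n. \<gamma> (s n)) (\<gamma> t)" using assms unfolding G_path_def by blast
  then show "((\<lambda>t. \<gamma> t x) \<circ> s) \<longlonglongrightarrow> \<gamma> t x" by (simp add: G_converges_def comp_def)
qed

text \<open>One mesh serves both functions: the projections must be close and the increments of b
  small on the same subintervals.\<close>

lemma uniform_partition:
  fixes f :: "real \<Rightarrow> 'a::metric_space" and g :: "real \<Rightarrow> 'b::metric_space"
  assumes f: "continuous_on {0..1} f" and g: "continuous_on {0..1} g" and e: "e > 0" "e' > 0"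
  obtains n :: nat where "n > 0"
    "\<forall>i<n. dist (f (real (Suc i) / n)) (f (real i / n)) < e \<and> dist (g (real (Suc i) / n)) (g (real i / n)) < e'"
proof -
  have "uniformly_continuous_on {0..1} f" "uniformly_continuous_on {0..1} g"
    using f g by (simp_all add: compact_uniformly_continuous)
  then obtain d1 d2 where d: "d1 > 0" "d2 > 0"
    "\<And>x y. x \<in> {0..1} \<Longrightarrow> y \<in> {0..1} \<Longrightarrow> dist y x < d1 \<Longrightarrow> dist (f y) (f x) < e"
    "\<And>x y. x \<in> {0..1} \<Longrightarrow> y \<in> {0..1} \<Longrightarrow> dist y x < d2 \<Longrightarrow> dist (g y) (g x) < e'"
    using e unfolding uniformly_continuous_on_def by metis
  obtain n :: nat where n: "n > 0" "1 / real n < min d1 d2"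
    using d(1,2) nat_approx_posE[of "min d1 d2"] by (metis min_less_iff_conj zero_less_Suc)
  have "dist (real (Suc i) / n) (real i / n) < min d1 d2" "real (Suc i) / n \<in> {0..1}" "real i / n \<in> {0..1}" if "i < n" for i
    using n that by (auto simp: dist_real_def diff_divide_distrib[symmetric] field_simps)
  then show thesis using that[OF n(1)] d(3,4) by (metis min_less_iff_conj)
qed

lemma ad_i_add: "ad_i (h + k) x = ad_i h x + ad_i (k::'a::cstar_algebra) x"
  by (simp add: ad_i_def distrib_left distrib_right scaleC_diff_right scaleC_add_right)

section \<open>Constancy along the path\<close>

theorem theorem2p3:
  fixes \<alpha> :: "real \<Rightarrow> 'a::cstar_algebra \<Rightarrow> 'a"
    and \<gamma> :: "real \<Rightarrow> 'a \<Rightarrow> 'a"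
    and b :: "real \<Rightarrow> 'a"
    and c :: real
  assumes "simple_cstar TYPE('a)"
    and "AF_algebra TYPE('a)"
    and "AF_flow \<alpha>"
    and "c \<noteq> 0"
    and "G_path \<alpha> \<gamma>"
    and "rectifiable_sa_path b"
    and "\<forall>t\<in>{0..1}. \<forall>x. map_option (\<gamma> t) (generator \<alpha> (inv (\<gamma> t) x))
                          = map_option (\<lambda>y. y + ad_i (b t) x) (generator \<alpha> x)"
  shows "\<forall>\<omega>\<in>extreme_points (KMS_simplex c \<alpha>). Phi c \<alpha> (\<gamma> 0) \<omega> = Phi c \<alpha> (\<gamma> 1) \<omega>"
proof
  fix \<omega> assume \<omega>: "\<omega> \<in> extreme_points (KMS_simplex c \<alpha>)"
  note simple = assms(1) and AF = assms(3) and c0 = assms(4)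
  have \<alpha>: "flow \<alpha>" using AF by (simp add: AF_flow_def)
  have dense: "closure (eigen_sums \<alpha>) = UNIV" by (rule AF_flow_eigen_sums_dense[OF AF])
  have k\<omega>: "KMS c \<alpha> \<omega>" using \<omega> by (simp add: extreme_points_def KMS_simplex_def)
  have G: "\<gamma> t \<in> symmetry_group \<alpha>" if "t \<in> {0..1}" for t using assms(5) that by (simp add: G_path_def)
  have sa: "star_aut (\<gamma> t)" if "t \<in> {0..1}" for t using G[OF that] by (simp add: symmetry_group_def)
  define \<sigma> where "\<sigma> t = (\<lambda>r. \<gamma> t \<circ> \<alpha> r \<circ> inv (\<gamma> t))" for t
  define \<psi> where "\<psi> t = (\<lambda>a. \<omega> (inv (\<gamma> t) a))" for t
  have fl\<sigma>: "flow (\<sigma> t)" if "t \<in> {0..1}" for t unfolding \<sigma>_def by (rule flow_conjugate[OF \<alpha> sa[OF that]])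
  have dense\<sigma>: "closure (eigen_sums (\<sigma> t)) = UNIV" if "t \<in> {0..1}" for t
    unfolding \<sigma>_def by (rule eigen_sums_conjugate_dense[OF sa[OF that] dense])
  have sys: "kms_system c (\<sigma> t) (\<psi> t)" if t: "t \<in> {0..1}" for t
  proof (rule kms_system.intro)
    show "KMS c (\<sigma> t) (\<psi> t)" unfolding \<sigma>_def \<psi>_def by (rule KMS_conjugate[OF sa[OF t] k\<omega>])
  qed (use c0 fl\<sigma>[OF t] dense\<sigma>[OF t] simple in auto)
  have zero: "(0::real) \<in> {0..1}" and one: "(1::real) \<in> {0..1}" by simp_all
  interpret S: kms_system c "\<sigma> 0" "\<psi> 0" by (rule sys[OF zero])
  interpret S1: kms_system c "\<sigma> 1" "\<psi> 1" by (rule sys[OF one])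
  have bsa: "cstar (b t - b 0) = b t - b 0" if "t \<in> {0..1}" for t
    using assms(6) that zero by (simp add: rectifiable_sa_path_def selfadjoint_def cstar_diff)
  \<comment> \<open>The triple consists of the cocycle, w and V. At t = 0 the trivial data are
    imposed, so that the perturbed functional there is exactly \<open>\<psi> 0\<close>.\<close>
  define good where "good t X \<longleftrightarrow> S.perturbation (fst X) (fst (snd X)) (snd (snd X)) \<and>
      (\<forall>r. (fst X has_vector_derivative fst X r * \<sigma> 0 r (\<i> *\<^sub>C (b t - b 0))) (at r)) \<and>
      (t = 0 \<longrightarrow> fst (snd X) = 1 \<and> snd (snd X) = (\<lambda>z. 1))" for t X
  have "\<exists>X. good t X" if t: "t \<in> {0..1}" for t
  proof (cases "t = 0")
    case True
    have "good t (\<lambda>r. 1, 1, \<lambda>z. 1)"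
      unfolding good_def using True S.perturbation_trivial(1) by (simp add: S.S)
    then show ?thesis ..
  next
    case False
    obtain \<kappa> where \<kappa>: "cocycle (\<sigma> 0) \<kappa>" "\<forall>r. (\<kappa> has_vector_derivative \<kappa> r * \<sigma> 0 r (\<i> *\<^sub>C (b t - b 0))) (at r)"
      by (rule dyson_cocycle[OF S.flow bsa[OF t]])
    obtain w V where "invertible_el w" "entire_fun V" "\<forall>r. \<kappa> r * \<sigma> 0 r w = w * V (of_real r)"
      by (rule cocycle_perturbation_exists[OF S.flow \<kappa>(1)])
    then have "good t (\<kappa>, w, V)" unfolding good_def S.perturbation_def using \<kappa> False by simp
    then show ?thesis ..
  qed
  then have "\<exists>X. \<forall>t\<in>{0..1}. good t (X t)" by (intro bchoice) blast
  then obtain X where X: "\<forall>t\<in>{0..1}. good t (X t)" ..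
  define \<kappa> where "\<kappa> t = fst (X t)" for t
  define w where "w t = fst (snd (X t))" for t
  define V where "V t = snd (snd (X t))" for t
  have pert: "S.perturbation (\<kappa> t) (w t) (V t)"
    and der: "\<forall>r. (\<kappa> t has_vector_derivative \<kappa> t r * \<sigma> 0 r (\<i> *\<^sub>C (b t - b 0))) (at r)"
    if "t \<in> {0..1}" for t
    using bspec[OF X that] unfolding good_def \<kappa>_def w_def V_def by blast+
  have wV0: "w 0 = 1" "V 0 = (\<lambda>z. 1)"
    using bspec[OF X zero] unfolding good_def w_def V_def by blast+
  have coc: "cocycle (\<sigma> 0) (\<kappa> t)" if "t \<in> {0..1}" for t
    using pert[OF that] by (simp add: S.perturbation_def)

  \<comment> \<open>The generator of \<open>\<sigma> 0\<close> is that of \<alpha> plus ad i b(0),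
    and the cocycle adds ad i (b(t) - b(0)); the sum is the generator of
    \<open>\<sigma> t\<close>.\<close>
  have Ad: "\<kappa> t r * \<sigma> 0 r x * cstar (\<kappa> t r) = \<sigma> t r x" if t: "t \<in> {0..1}" for t r x
  proof -
    have "(\<lambda>r x. \<kappa> t r * \<sigma> 0 r x * cstar (\<kappa> t r)) = \<sigma> t"
    proof (rule flow_eqI_generator[OF flow_Ad[OF S.flow coc[OF t]] fl\<sigma>[OF t]])
      show "closure {x. \<exists>y. gen_rel (\<sigma> t) x y} = UNIV"
        by (rule eigen_sums_generator_dense[OF fl\<sigma>[OF t] dense\<sigma>[OF t]])
      fix x y assume "gen_rel (\<sigma> t) x y"
      then have "gen_rel \<alpha> (inv (\<gamma> t) x) (inv (\<gamma> t) y)"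
        unfolding \<sigma>_def by (rule gen_rel_conjugateD[OF sa[OF t]])
      then have "generator \<alpha> (inv (\<gamma> t) x) = Some (inv (\<gamma> t) y)" by (simp only: generator_Some_iff)
      then have "Some y = map_option (\<lambda>y. y + ad_i (b t) x) (generator \<alpha> x)"
        using assms(7)[rule_format, OF t, of x] by (simp add: star_aut_inv(3)[OF sa[OF t]])
      then obtain z where z: "generator \<alpha> x = Some z" "y = z + ad_i (b t) x"
        by (cases "generator \<alpha> x") auto
      have "map_option (\<gamma> 0) (generator \<alpha> (inv (\<gamma> 0) x)) = Some (z + ad_i (b 0) x)"
        using assms(7)[rule_format, OF zero, of x] z(1) by simp
      then obtain z' where z': "generator \<alpha> (inv (\<gamma> 0) x) = Some z'" "\<gamma> 0 z' = z + ad_i (b 0) x"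
        by (cases "generator \<alpha> (inv (\<gamma> 0) x)") auto
      have "gen_rel (\<sigma> 0) x (\<gamma> 0 z')"
        unfolding \<sigma>_def using z'(1) by (intro gen_rel_conjugate[OF sa[OF zero]]) (simp only: generator_Some_iff)
      from gen_rel_Ad[OF S.flow coc[OF t] der[OF t] bsa[OF t] this]
      have "gen_rel (\<lambda>r x. \<kappa> t r * \<sigma> 0 r x * cstar (\<kappa> t r)) x (z + ad_i (b 0) x + ad_i (b t - b 0) x)"
        by (simp only: z'(2))
      moreover have "z + ad_i (b 0) x + ad_i (b t - b 0) x = y"
        using ad_i_add[of "b 0" "b t - b 0" x] z(2) by (simp add: add.assoc)
      ultimately show "gen_rel (\<lambda>r x. \<kappa> t r * \<sigma> 0 r x * cstar (\<kappa> t r)) x y" by (simp only:)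
    qed
    then show ?thesis by (rule fun_cong[OF fun_cong])
  qed
  have \<sigma>\<gamma>: "\<sigma> t r (\<gamma> t x) = \<gamma> t (\<alpha> r x)" if t: "t \<in> {0..1}" for t r x
    by (simp add: \<sigma>_def star_aut_inv(2)[OF sa[OF t]])

  obtain M where M: "\<forall>(n::nat) (p::nat \<Rightarrow> real). 0 \<le> p 0 \<and> p n \<le> 1 \<and> (\<forall>i<n. p i \<le> p (Suc i))
            \<longrightarrow> (\<Sum>i<n. norm (b (p (Suc i)) - b (p i))) \<le> M"
    using assms(6) unfolding rectifiable_sa_path_def by (elim conjE exE)
  have contb: "continuous_on {0..1} b" using assms(6) by (simp add: rectifiable_sa_path_def)
  define C where "C = exp (8 * \<bar>c\<bar> * M)"
  have C: "C > 0" by (simp add: C_def)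
  \<comment> \<open>The mesh of the partition depends on p through the modulus of continuity of
    \<open>\<gamma> t p\<close>; C does not, and domination requires just that.\<close>
  have main: "Re (S.perturbed (w 1) (V 1) (\<gamma> 1 p)) \<le> C * Re (\<omega> p)"
    if p: "projection p" "\<And>r. \<alpha> r p = p" for p
  proof -
    define B where "B t = Re (S.perturbed (w t) (V t) (\<gamma> t p))" for t
    have B0: "B 0 = Re (\<omega> p)"
      unfolding B_def wV0 S.perturbation_trivial(2) by (simp add: \<psi>_def star_aut_inv(2)[OF sa[OF zero]])
    \<comment> \<open>The thresholds that \<open>projection_estimate\<close> asks for: distance at
      most 1/2 for the projections, and increments of b with
      \<open>4 * \<bar>c\<bar> * D i \<le> 1 / 2\<close>.\<close>
    have e: "(1 / 2 :: real) > 0" "1 / (8 * \<bar>c\<bar>) > 0" using c0 by simp_all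
    obtain n where n: "n > 0"
      "\<forall>i<n. dist (\<gamma> (real (Suc i) / n) p) (\<gamma> (real i / n) p) < 1 / 2 \<and> dist (b (real (Suc i) / n)) (b (real i / n)) < 1 / (8 * \<bar>c\<bar>)"
      by (rule uniform_partition[OF G_path_continuous[OF assms(5), of p] contb e])
    define T where "T i = real i / n" for i
    have T01: "T i \<in> {0..1}" if "i \<le> n" for i using that n(1) by (simp add: T_def)
    have proj: "projection (\<gamma> t p)" "\<kappa> t r * \<sigma> 0 r (\<gamma> t p) * cstar (\<kappa> t r) = \<gamma> t p" if t: "t \<in> {0..1}" for t r
    proof -
      show "projection (\<gamma> t p)"
        using p(1) star_autD(4,5)[OF sa[OF t]] unfolding projection_def by metis
      show "\<kappa> t r * \<sigma> 0 r (\<gamma> t p) * cstar (\<kappa> t r) = \<gamma> t p"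
        by (simp only: Ad[OF t] \<sigma>\<gamma>[OF t] p(2))
    qed
    define D where "D i = norm (b (T (Suc i)) - b (T i))" for i
    have step: "B (T (Suc i)) \<le> B (T i) * exp (8 * \<bar>c\<bar> * D i)" if i: "i < n" for i
    proof -
      have t1: "T (Suc i) \<in> {0..1}" and t2: "T i \<in> {0..1}" using T01 i by simp_all
      have ni: "dist (\<gamma> (T (Suc i)) p) (\<gamma> (T i) p) < 1 / 2" "dist (b (T (Suc i))) (b (T i)) < 1 / (8 * \<bar>c\<bar>)"
        using n(2) i unfolding T_def by blast+
      have "D i * (8 * \<bar>c\<bar>) \<le> 1"
        using ni(2) c0 by (simp add: D_def dist_norm pos_less_divide_eq less_imp_le)
      then have small: "4 * \<bar>c\<bar> * D i \<le> 1 / 2" by (simp add: mult_ac)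
      have lip: "norm (\<kappa> (T (Suc i)) (r + h) * cstar (\<kappa> (T i) (r + h)) - \<kappa> (T (Suc i)) r * cstar (\<kappa> (T i) r)) \<le> \<bar>h\<bar> * D i" for r h
        using dyson_Lipschitz[OF S.flow coc[OF t1] coc[OF t2] der[OF t1] der[OF t2] bsa[OF t2], of r h]
        by (simp add: D_def)
      show ?thesis
        unfolding B_def
        by (rule S.projection_estimate[OF pert[OF t1] pert[OF t2] proj(1)[OF t1] proj(2)[OF t1] proj(1)[OF t2] proj(2)[OF t2] _ lip small])
           (use ni(1) in \<open>simp_all add: dist_norm D_def\<close>)
    qed
    have Bm: "B (T m) \<le> B 0 * exp (8 * \<bar>c\<bar> * (\<Sum>i<m. D i))" if "m \<le> n" for m
      using that
    proof (induction m)
      case 0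
      then show ?case by (simp add: T_def)
    next
      case (Suc m)
      have "B (T (Suc m)) \<le> B (T m) * exp (8 * \<bar>c\<bar> * D m)" using step Suc.prems by simp
      also have "\<dots> \<le> (B 0 * exp (8 * \<bar>c\<bar> * (\<Sum>i<m. D i))) * exp (8 * \<bar>c\<bar> * D m)"
        using Suc by (intro mult_right_mono) auto
      also have "\<dots> = B 0 * exp (8 * \<bar>c\<bar> * (\<Sum>i<Suc m. D i))"
        by (simp add: distrib_left exp_add mult.assoc)
      finally show ?case .
    qed
    have "T n = 1" using n(1) by (simp add: T_def)
    moreover have "T i \<le> T (Suc i)" for i unfolding T_def by (intro divide_right_mono) auto
    ultimately have "0 \<le> T 0 \<and> T n \<le> 1 \<and> (\<forall>i<n. T i \<le> T (Suc i))" by (simp add: T_def[of 0])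
    then have "(\<Sum>i<n. D i) \<le> M" using M[rule_format, of T n] unfolding D_def by blast
    then have "exp (8 * \<bar>c\<bar> * (\<Sum>i<n. D i)) \<le> C" unfolding C_def by (simp add: mult_left_mono)
    moreover have "B 0 \<ge> 0"
      unfolding B0 using positive_functional_projection(1)[OF _ p(1)] k\<omega> by (simp add: KMS_def state_iff_positive_functional)
    ultimately have "B 0 * exp (8 * \<bar>c\<bar> * (\<Sum>i<n. D i)) \<le> B 0 * C" by (intro mult_left_mono)
    then have "B 1 \<le> B 0 * C" using Bm[of n] \<open>T n = 1\<close> by simp
    then show ?thesis by (simp add: B0 B_def[of 1] mult.commute)
  qed

  interpret P1: kms_perturbation c "\<sigma> 0" "\<psi> 0" "\<kappa> 1" "w 1" "V 1" by unfold_locales (rule pert[OF one])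
  note g1 = star_autD[OF sa[OF one]]
  \<comment> \<open>Pulling back by \<open>\<gamma> 1\<close> turns a functional adapted to
    \<open>\<sigma> 1\<close> into one for \<alpha>, which can be compared with \<omega>.\<close>
  define om where "om a = S.perturbed (w 1) (V 1) (\<gamma> 1 a)" for a
  define k where "k = Re (om 1)"
  have k0: "k > 0" unfolding k_def om_def g1(7) by (rule S.perturbed_one_pos[OF pert[OF one]])
  have om1: "om 1 = of_real k"
    using positive_functional_one(1)[OF P1.perturbed_positive] by (simp add: k_def om_def g1(7) complex_eq_iff)
  define \<omega>1 where "\<omega>1 a = of_real (1 / k) * om a" for a
  have st1: "state \<omega>1"
    unfolding state_def
  proof (intro conjI allI)
    fix x y l
    show "\<omega>1 (x + y) = \<omega>1 x + \<omega>1 y" "\<omega>1 (l *\<^sub>C x) = l * \<omega>1 x"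
      by (simp_all add: \<omega>1_def om_def g1 P1.perturbed_linear distrib_left)
    show "Im (\<omega>1 (cstar x * x)) = 0" "0 \<le> Re (\<omega>1 (cstar x * x))"
      using positive_functionalD(7,8)[OF P1.perturbed_positive, of "\<gamma> 1 x"] k0
      by (simp_all add: \<omega>1_def om_def g1)
    show "\<omega>1 1 = 1" using k0 by (simp add: \<omega>1_def om1)
  qed
  have k\<omega>1: "KMS c \<alpha> \<omega>1"
    unfolding KMS_iff_strip_fun
  proof (intro conjI allI st1)
    fix x y
    obtain F where "strip_fun c F (\<lambda>r. S.perturbed (w 1) (V 1) (\<gamma> 1 x * (\<kappa> 1 r * \<sigma> 0 r (\<gamma> 1 y) * cstar (\<kappa> 1 r))))
        (\<lambda>r. S.perturbed (w 1) (V 1) (\<kappa> 1 r * \<sigma> 0 r (\<gamma> 1 y) * cstar (\<kappa> 1 r) * \<gamma> 1 x))"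
      using S.perturbed_relation[OF pert[OF one] pert[OF one]] by blast
    then have "strip_fun c F (\<lambda>r. om (x * \<alpha> r y)) (\<lambda>r. om (\<alpha> r y * x))"
      unfolding om_def by (simp only: Ad[OF one] \<sigma>\<gamma>[OF one] g1(4))
    then show "\<exists>F. strip_fun c F (\<lambda>t. \<omega>1 (x * \<alpha> t y)) (\<lambda>t. \<omega>1 (\<alpha> t y * x))"
      unfolding \<omega>1_def using strip_fun_cmult by blast
  qed
  interpret W: kms_system c \<alpha> \<omega> by (rule kms_system.intro[OF c0 \<alpha> dense k\<omega> simple])
  interpret W1: kms_system c \<alpha> \<omega>1 by (rule kms_system.intro[OF c0 \<alpha> dense k\<omega>1 simple])
  have "\<omega>1 = \<omega>"
  proof (rule extreme_KMS_dominated[OF \<omega> k\<omega>1, of "(1 / k) * C"])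
    show "0 < 1 / k * C" using k0 C by simp
    show "Re (\<omega>1 (cstar x * x)) \<le> 1 / k * C * Re (\<omega> (cstar x * x))" for x
    proof (rule positive_functional_comparison[OF AF W1.pf W.pf W1.eigen_zero W.eigen_zero])
      fix p assume p: "projection p" "\<And>r. \<alpha> r p = p"
      have "Re (\<omega>1 p) = (1 / k) * Re (S.perturbed (w 1) (V 1) (\<gamma> 1 p))" by (simp add: \<omega>1_def om_def)
      also have "\<dots> \<le> (1 / k) * (C * Re (\<omega> p))" using main[OF p] k0 by (intro mult_left_mono) auto
      finally show "Re (\<omega>1 p) \<le> 1 / k * C * Re (\<omega> p)" by simp
    qed
  qed
  have "om a = of_real k * \<omega> a" for a
    unfolding \<open>\<omega>1 = \<omega>\<close>[symmetric] \<omega>1_def using k0 by simp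
  \<comment> \<open>Extremality has identified the perturbation of \<open>\<psi> 0\<close> by
    \<open>\<kappa> 1\<close> with a multiple of \<open>\<psi> 1\<close>. It remains to relate
    \<open>\<kappa> 1\<close> to the cocycles chosen by \<open>Phi\<close>.\<close>
  then have pert1: "S.perturbed (w 1) (V 1) a = of_real k * \<psi> 1 a" for a
    unfolding om_def \<psi>_def using star_aut_inv(3)[OF sa[OF one], of a] by metis

  obtain u0 w0 V0 where u0: "assoc_cocycle \<alpha> (\<gamma> 0) u0" "invertible_el w0" "entire_fun V0"
    "\<forall>t. cstar (u0 t) * (\<gamma> 0 \<circ> \<alpha> t \<circ> inv (\<gamma> 0)) w0 = w0 * V0 (of_real t)"
    and Phi0: "\<forall>c \<omega>. Phi c \<alpha> (\<gamma> 0) \<omega> = (\<lambda>a. \<omega> (inv (\<gamma> 0) (inv_el w0 * a * w0 * V0 (\<i> * of_real c)))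
        / \<omega> (inv (\<gamma> 0) (inv_el w0 * 1 * w0 * V0 (\<i> * of_real c))))"
    by (rule Phi_representation[OF \<alpha> G[OF zero]])
  obtain u1 w1 V1 where u1: "assoc_cocycle \<alpha> (\<gamma> 1) u1" "invertible_el w1" "entire_fun V1"
    "\<forall>t. cstar (u1 t) * (\<gamma> 1 \<circ> \<alpha> t \<circ> inv (\<gamma> 1)) w1 = w1 * V1 (of_real t)"
    and Phi1: "\<forall>c \<omega>. Phi c \<alpha> (\<gamma> 1) \<omega> = (\<lambda>a. \<omega> (inv (\<gamma> 1) (inv_el w1 * a * w1 * V1 (\<i> * of_real c)))
        / \<omega> (inv (\<gamma> 1) (inv_el w1 * 1 * w1 * V1 (\<i> * of_real c))))"
    by (rule Phi_representation[OF \<alpha> G[OF one]])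
  note A0 = assoc_cocycleD[OF \<alpha> sa[OF zero] u0(1)] and A1 = assoc_cocycleD[OF \<alpha> sa[OF one] u1(1)]
  have Ad0: "u0 r * \<alpha> r x * cstar (u0 r) = \<sigma> 0 r x" and Ad1: "u1 r * \<alpha> r x * cstar (u1 r) = \<sigma> 1 r x" for r x
    by (simp_all only: A0(2) A1(2) \<sigma>_def)
  have p0: "S.perturbation (\<lambda>t. cstar (u0 t)) w0 V0"
    unfolding S.perturbation_def using A0(3) u0(2-4) by (simp add: \<sigma>_def)
  have p1: "S1.perturbation (\<lambda>t. cstar (u1 t)) w1 V1"
    unfolding S1.perturbation_def using A1(3) u1(2-4) by (simp add: \<sigma>_def)
  have Phi0': "Phi c \<alpha> (\<gamma> 0) \<omega> = (\<lambda>a. S.perturbed w0 V0 a / S.perturbed w0 V0 1)"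
    unfolding Phi0[rule_format] S.perturbed_def unfolding \<psi>_def ..
  have Phi1': "Phi c \<alpha> (\<gamma> 1) \<omega> = (\<lambda>a. S1.perturbed w1 V1 a / S1.perturbed w1 V1 1)"
    unfolding Phi1[rule_format] S1.perturbed_def unfolding \<psi>_def ..

  note K0 = cocycleD[OF \<alpha> A0(1)] and K1 = cocycleD[OF \<alpha> A1(1)] and KK = cocycleD[OF S.flow coc[OF one]]
  note As = flow_simps[OF \<alpha>]
  \<comment> \<open>Both \<open>\<kappa> 1 r\<close> and \<open>u1 r * cstar (u0 r)\<close>
    implement the passage from \<open>\<sigma> 0\<close> to \<open>\<sigma> 1\<close>; z measures
    their discrepancy and implements the identity.\<close>
  define z where "z r = cstar (u1 r) * \<kappa> 1 r * u0 r" for r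
  have zunit: "unitary (z r)" for r
    unfolding z_def by (intro unitary_mult unitary_cstar K0(7) K1(7) KK(7))
  have z\<alpha>: "z r * \<alpha> r x * cstar (z r) = \<alpha> r x" for r x
  proof -
    have "z r * \<alpha> r x * cstar (z r) = cstar (u1 r) * (\<kappa> 1 r * (u0 r * \<alpha> r x * cstar (u0 r)) * cstar (\<kappa> 1 r)) * u1 r"
      by (simp add: z_def cstar_mult mult.assoc)
    also have "\<dots> = cstar (u1 r) * (u1 r * \<alpha> r x * cstar (u1 r)) * u1 r"
      by (simp only: Ad0 Ad1 Ad[OF one])
    also have "\<dots> = (cstar (u1 r) * u1 r) * \<alpha> r x * (cstar (u1 r) * u1 r)" by (simp only: mult.assoc)
    finally show ?thesis by (simp add: K1)
  qed
  have central: "z r * a = a * z r" for r a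
  proof -
    have "a * z r = (z r * a * cstar (z r)) * z r" using z\<alpha>[of r "\<alpha> (- r) a"] by (simp add: flowD(5)[OF \<alpha>])
    also have "\<dots> = z r * a * (cstar (z r) * z r)" by (simp only: mult.assoc)
    finally show ?thesis using zunit[of r] by (simp add: unitary_def)
  qed
  have zcoc: "z (s + r) = z s * \<alpha> s (z r)" for s r
  proof -
    have "z (s + r) = cstar (\<alpha> s (u1 r)) * (cstar (u1 s) * \<kappa> 1 s * u0 s) * \<alpha> s (\<kappa> 1 r) * (cstar (u0 s) * u0 s) * \<alpha> s (u0 r)"
      unfolding z_def K0(4) K1(4) KK(4) Ad0[symmetric] by (simp only: cstar_mult mult.assoc)
    also have "\<dots> = (cstar (\<alpha> s (u1 r)) * z s) * (\<alpha> s (\<kappa> 1 r) * \<alpha> s (u0 r))"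
      by (simp add: K0(2) z_def mult.assoc)
    also have "\<dots> = z s * (cstar (\<alpha> s (u1 r)) * (\<alpha> s (\<kappa> 1 r) * \<alpha> s (u0 r)))"
      by (simp only: central[symmetric] mult.assoc)
    also have "cstar (\<alpha> s (u1 r)) * (\<alpha> s (\<kappa> 1 r) * \<alpha> s (u0 r)) = \<alpha> s (z r)"
      by (simp add: z_def As mult.assoc)
    finally show ?thesis .
  qed
  have zcont: "continuous_on UNIV z"
    unfolding z_def by (intro continuous_on_mult K0(1) KK(1) bounded_linear.continuous_on[OF bounded_linear_cstar K1(1)])
  obtain m :: real where m: "\<forall>r. z r = exp (\<i> * of_real (m * r)) *\<^sub>C 1"
    by (rule central_cocycle_scalar[OF simple W.st \<alpha> zcont zunit central zcoc])
  have rel: "cstar (u1 r) * \<sigma> 1 r y = exp (\<i> * of_real m * of_real r) *\<^sub>C (cstar (u0 r) * \<sigma> 0 r y * cstar (\<kappa> 1 r))" for r y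
  proof -
    have "z r * cstar (u0 r) = cstar (u1 r) * \<kappa> 1 r * (u0 r * cstar (u0 r))" by (simp only: z_def mult.assoc)
    then have zu: "cstar (u1 r) * \<kappa> 1 r = z r * cstar (u0 r)" by (simp add: K0)
    have "cstar (u1 r) * \<sigma> 1 r y = (cstar (u1 r) * \<kappa> 1 r) * \<sigma> 0 r y * cstar (\<kappa> 1 r)"
      by (simp only: Ad[OF one, symmetric] mult.assoc)
    also have "\<dots> = z r * (cstar (u0 r) * \<sigma> 0 r y * cstar (\<kappa> 1 r))" by (simp only: zu mult.assoc)
    finally show ?thesis using m by (simp add: scaleC_mult_left mult.assoc)
  qed
  \<comment> \<open>The mass k times the value at ic of the inverse of the character z.\<close>
  define E where "E = of_real k * exp (\<i> * of_real (- m) * (of_real 0 + \<i> * of_real c))"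
  \<comment> \<open>Two relative KMS functions are compared: over \<open>\<sigma> 0\<close> with the
    adjoint of u0 and \<open>\<kappa> 1\<close>, and over \<open>\<sigma> 1\<close> with the adjoint
    of u1 and the trivial cocycle. On the real line they agree up to k and the character, and at ic
    they are the two functionals behind \<open>Phi\<close>.\<close>
  have proportional: "S.perturbed w0 V0 x = E * S1.perturbed w1 V1 x" for x
  proof -
    let ?Q = "\<lambda>r. cstar (u0 r) * \<sigma> 0 r 1 * cstar (\<kappa> 1 r)"
    obtain F0 where F0: "strip_fun c F0 (\<lambda>r. of_real k * \<psi> 1 (x * ?Q r)) (\<lambda>r. S.perturbed w0 V0 (?Q r * x))"
      using S.perturbed_relation[OF p0 pert[OF one], of x 1] unfolding pert1 by blast
    obtain F1 where F1: "strip_fun c F1 (\<lambda>r. \<psi> 1 (x * (cstar (u1 r) * \<sigma> 1 r 1 * cstar 1)))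
        (\<lambda>r. S1.perturbed w1 V1 (cstar (u1 r) * \<sigma> 1 r 1 * cstar 1 * x))"
      using S1.perturbed_relation[OF p1 S1.perturbation_trivial(1), of x 1] unfolding S1.perturbation_trivial(2) by blast
    have "of_real k * (exp (\<i> * of_real (- m) * of_real r) * \<psi> 1 (x * (cstar (u1 r) * \<sigma> 1 r 1 * cstar 1)))
        = of_real k * \<psi> 1 (x * ?Q r)" for r
    proof -
      have "exp (\<i> * of_real (- m) * of_real r) * exp (\<i> * of_real m * of_real r) = (1::complex)"
        unfolding exp_add[symmetric] by simp
      then have "exp (\<i> * of_real (- m) * of_real r) * \<psi> 1 (x * (cstar (u1 r) * \<sigma> 1 r 1)) = \<psi> 1 (x * ?Q r)"
        unfolding rel scaleC_mult_right S1.P(2) by (simp only: mult.assoc[symmetric] mult_1_left)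
      then show ?thesis by simp
    qed
    then have "strip_fun c (\<lambda>z. of_real k * (exp (\<i> * of_real (- m) * z) * F1 z)) (\<lambda>r. of_real k * \<psi> 1 (x * ?Q r))
        (\<lambda>r. of_real k * (exp (\<i> * of_real (- m) * (of_real r + \<i> * of_real c)) * S1.perturbed w1 V1 (cstar (u1 r) * \<sigma> 1 r 1 * cstar 1 * x)))"
      using strip_fun_cmult[OF strip_fun_exp_mult[OF c0 F1, of "- m"], of "of_real k"] by (simp only:)
    from strip_fun_unique[OF c0 F0 this, of 0] show ?thesis
      by (simp add: E_def K0(5) K1(5) KK(5) S.S S1.S mult.assoc)
  qed
  have "E \<noteq> 0" using k0 by (simp add: E_def)
  then show "Phi c \<alpha> (\<gamma> 0) \<omega> = Phi c \<alpha> (\<gamma> 1) \<omega>"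
    unfolding Phi0' Phi1' proportional by simp
qed

end
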